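(* For $m$ ranging over the positive integers such that $p=2m+1$ is a prime, asymptotically almost surely a random tree with $m$ edges decomposes $K_{4m+2}\setminus M$, where $M$ is any perfect matching of the complete graph $K_{4m+2}$; that is, the probability that a random tree with $m$ edges decomposes $K_{4m+2}\setminus M$ tends to $1$ as $m\to\infty$ through the integers $m$ such that $2m+1$ is prime.
   Context: A graph $H$ decomposes a graph $G$ if $G$ is the edge-disjoint union of isomorphic copies of $H$ (i.e. the edge set of $G$ can be partitioned into edge sets of subgraphs of $G$ each isomorphic to $H$). A random tree with $m$ edges is an unlabelled tree (isomorphism class of trees) chosen uniformly at random among all unlabelled trees with $m$ edges. $K_{4m+2}\setminus M$ is the complete graph on $4m+2$ vertices with the edges of $M$ removed. *)

theory Defs
  imports
    "HOL-Probability.Probability"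
    "HOL-Computational_Algebra.Primes"
    "HOL-Library.Disjoint_Sets"
begin

text \<open>
  Graphs are undirected, with edges as two-element vertex sets. Symmetric digraphs would not
  do here: there every edge gives a directed cycle of length two, so that a graph with at
  least one edge is never acyclic.
\<close>

record 'a ugraph =
  verts :: "'a set"
  edges :: "'a set set"

definition simple_graph :: "'a ugraph \<Rightarrow> bool" where
  "simple_graph G \<longleftrightarrow>
     finite (verts G) \<and> (\<forall>e\<in>edges G. e \<subseteq> verts G \<and> card e = 2)"

definition subgraph :: "'a ugraph \<Rightarrow> 'a ugraph \<Rightarrow> bool" where
  "subgraph H G \<longleftrightarrow> simple_graph H \<and> verts H \<subseteq> verts G \<and> edges H \<subseteq> edges G"

definition isomorphic :: "'a ugraph \<Rightarrow> 'b ugraph \<Rightarrow> bool" where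
  "isomorphic G H \<longleftrightarrow>
     (\<exists>f. bij_betw f (verts G) (verts H) \<and>
          (\<forall>u\<in>verts G. \<forall>v\<in>verts G. {u, v} \<in> edges G \<longleftrightarrow> {f u, f v} \<in> edges H))"

definition connected_graph :: "'a ugraph \<Rightarrow> bool" where
  "connected_graph G \<longleftrightarrow> verts G \<noteq> {} \<and>
     (\<forall>u\<in>verts G. \<forall>v\<in>verts G. (u, v) \<in> {(x, y). {x, y} \<in> edges G}\<^sup>*)"

definition is_cycle :: "'a ugraph \<Rightarrow> 'a list \<Rightarrow> bool" where
  "is_cycle G xs \<longleftrightarrow> length xs \<ge> 3 \<and> distinct xs \<and>
     (\<forall>i<length xs. {xs ! i, xs ! (Suc i mod length xs)} \<in> edges G)"

definition tree :: "'a ugraph \<Rightarrow> bool" where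
  "tree G \<longleftrightarrow> simple_graph G \<and> connected_graph G \<and> (\<nexists>xs. is_cycle G xs)"

definition decomposes :: "'a ugraph \<Rightarrow> 'b ugraph \<Rightarrow> bool" where
  "decomposes H G \<longleftrightarrow>
     (\<exists>P. partition_on (edges G) P \<and>
          (\<forall>E\<in>P. \<exists>S. subgraph S G \<and> isomorphic H S \<and> edges S = E))"

definition complete_ugraph :: "nat \<Rightarrow> nat ugraph" where
  "complete_ugraph n = \<lparr>verts = {..<n}, edges = {e. e \<subseteq> {..<n} \<and> card e = 2}\<rparr>"

definition perfect_matching :: "'a ugraph \<Rightarrow> 'a set set \<Rightarrow> bool" where
  "perfect_matching G M \<longleftrightarrow> M \<subseteq> edges G \<and> (\<forall>v\<in>verts G. \<exists>!e. e \<in> M \<and> v \<in> e)"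

definition delete_edges :: "'a ugraph \<Rightarrow> 'a set set \<Rightarrow> 'a ugraph" where
  "delete_edges G M = \<lparr>verts = verts G, edges = edges G - M\<rparr>"

text \<open>
  Every finite tree is isomorphic to one whose vertices are natural numbers, so the
  isomorphism classes below represent all unlabelled trees with \<open>m\<close> edges.
\<close>

definition labelled_trees :: "nat \<Rightarrow> nat ugraph set" where
  "labelled_trees m = {T. tree T \<and> card (edges T) = m}"

definition unlabelled_trees :: "nat \<Rightarrow> nat ugraph set set" where
  "unlabelled_trees m =
     labelled_trees m //
       {(S, T). S \<in> labelled_trees m \<and> T \<in> labelled_trees m \<and> isomorphic S T}"

text \<open>
  The set \<open>unlabelled_trees m\<close> is finite and nonempty, so \<open>pmf_of_set\<close> is the uniform
  distribution on it.
\<close>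

definition random_tree :: "nat \<Rightarrow> nat ugraph set pmf" where
  "random_tree m = pmf_of_set (unlabelled_trees m)"

text \<open>
  An unlabelled tree is a class of isomorphic trees. Whether \<open>T\<close> decomposes \<open>G\<close> depends only
  on the class of \<open>T\<close>, so it does not matter which representative is considered.
\<close>

definition class_decomposes :: "'a ugraph set \<Rightarrow> 'b ugraph \<Rightarrow> bool" where
  "class_decomposes C G \<longleftrightarrow> (\<forall>T\<in>C. decomposes T G)"

end

theory Submission
  imports Defs "HOL-Computational_Algebra.Polynomial" "HOL-Combinatorics.Permutations"
    "HOL-Number_Theory.Cong"
begin

text \<open>
  Let \<open>p = 2 * m + 1\<close>. The graph \<open>K_{4m+2} - M\<close> is \<open>K_p\<close> with every vertex doubled. Map the
  tree \<open>T\<close> to \<open>Z_p\<close> such that the differences along its edges are distinct up to sign, the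
  fibres have at most two elements, and identifying the fibres gives a 3-colourable graph.
  Then \<open>T\<close> has four lifts to the doubled graph whose translates partition its edges.

  To find the map, embed \<open>T\<close> without its leaves and without the vertices of degree two
  next to a leaf greedily, and place the remaining vertices in two groups by the polynomial
  method, as in Alon's theorem on additive Latin transversals. The first group avoids
  everything placed before. The leaves of the second group have distinct places, but a leaf
  may hit a vertex placed before, which adds an edge to the identified graph. Every vertex is
  hit at most once, and the polynomial method leaves just enough room to let each leaf avoid
  the vertices that carry an earlier leaf; so the added edges are acyclic enough to keep
  the graph 3-colourable. All this works if the number of leaves plus the number of vertices
  of degree two next to a leaf is at least \<open>m / 2\<close>.

  On average this number is about \<open>0.546 * m\<close>. That it is rarely below \<open>m / 2\<close> follows by
  weighting the generating function of rooted trees: the trees below the threshold grow at a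
  rate of at most \<open>2.947\<close>, whereas there are about \<open>2.955 ^ n\<close> rooted trees with \<open>n\<close>
  vertices, and passing from rooted to free trees costs only a factor \<open>n\<close>.
\<close>

section \<open>The polynomial method\<close>

text \<open>The obstacle is the last stage: as many differences are then free as vertices remain,
  and the polynomial method can keep the \<open>i\<close>-th of these (counted from 0) off only
  \<open>i + 1\<close> places, far too few to avoid everything placed before. Doubling pays for the
  collisions: two tree vertices over one residue may sit on opposite levels in every lift. Colours
  enter because a vertex takes its level in the four lifts from a linear form on
  \<open>F_2^2\<close>. The lifts of an edge are its four blow-ups exactly if its ends use different
  nonzero forms, and there are only three.

  To make three colours enough, the second group consists of the leaves whose parents lie on one
  side of the bipartition, together with all leaves whose parent has degree two. The latter do no
  harm on either side, since such a parent has just one other neighbour to respect; so they are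
  available for both sides. This is why the vertices of degree two next to a leaf enter the
  count.\<close>

definition lag_disc :: "int set \<Rightarrow> int" where
  "lag_disc S = (\<Prod>s\<in>S. \<Prod>t\<in>S - {s}. s - t)"

text \<open>This is \<open>lag_disc S\<close> divided by the Lagrange denominator of
  \<open>s\<close>, written as a product so that everything stays integral and can be reduced modulo
  \<open>p\<close>.\<close>

definition lag_weight :: "int set \<Rightarrow> int \<Rightarrow> int" where
  "lag_weight S s = (\<Prod>s'\<in>S - {s}. \<Prod>t\<in>S - {s'}. s' - t)"

lemma lag_weight_mult:
  assumes "finite S" "s \<in> S"
  shows "lag_weight S s * (\<Prod>t\<in>S - {s}. s - t) = lag_disc S"
  using assms by (simp add: lag_weight_def lag_disc_def prod.remove mult.commute)

text \<open>Lagrange interpolation on \<open>S\<close> with cleared denominators. If the degree of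
  \<open>q\<close> is below \<open>card S - 1\<close>, the sum vanishes; this later kills all terms
  but one.\<close>

lemma sum_lag_weight:
  assumes S: "finite S" and q: "degree q < card S"
  shows "(\<Sum>s\<in>S. lag_weight S s * poly q s) = lag_disc S * coeff q (card S - 1)"
proof -
  define L where "L s = (\<Prod>t\<in>S - {s}. [:- t, 1:])" for s :: int
  define r where "r = (\<Sum>s\<in>S. smult (lag_weight S s * poly q s) (L s))"
  have degL: "degree (L s) = card S - 1" if "s \<in> S" for s
    using that S by (simp add: L_def degree_prod_sum_eq)
  have lcL: "coeff (L s) (card S - 1) = 1" if "s \<in> S" for s
    using lead_coeff_prod[of "\<lambda>t. [:- t, 1:]" "S - {s}"] degL[OF that]
    by (simp add: L_def)
  have polyL: "poly (L s) u = (if u = s then (\<Prod>t\<in>S - {s}. s - t) else 0)" if "s \<in> S" "u \<in> S" for s u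
    using that S by (auto simp: L_def poly_prod)
  have "smult (lag_disc S) q = r"
  proof (rule poly_eqI_degree[where A = S])
    show "poly (smult (lag_disc S) q) u = poly r u" if "u \<in> S" for u
    proof -
      have "poly r u = (\<Sum>s\<in>S. lag_weight S s * poly q s * poly (L s) u)"
        by (simp add: r_def poly_sum)
      also have "\<dots> = (\<Sum>s\<in>S. if s = u then lag_disc S * poly q s else 0)"
        using that S
        by (intro sum.cong) (auto simp: polyL lag_weight_mult[symmetric] mult_ac)
      also have "\<dots> = lag_disc S * poly q u"
        using that S by simp
      finally show ?thesis by simp
    qed
    have "degree (smult (lag_disc S) q) \<le> degree q" by (rule degree_smult_le)
    thus "degree (smult (lag_disc S) q) < card S" using q by simp
    have "degree r \<le> card S - 1"
      unfolding r_def
      by (rule degree_sum_le) (use S degL degree_smult_le order.trans in \<open>force+\<close>)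
    thus "degree r < card S" using q by simp
  qed
  hence "lag_disc S * coeff q (card S - 1) = coeff r (card S - 1)"
    by (metis coeff_smult)
  also have "\<dots> = (\<Sum>s\<in>S. lag_weight S s * poly q s)"
    using lcL by (simp add: r_def coeff_sum)
  finally show ?thesis by simp
qed

lemma lag_disc_not_dvd:
  fixes p :: int
  assumes "prime p" "finite S" "inj_on (\<lambda>s. s mod p) S"
  shows "\<not> p dvd lag_disc S"
proof
  assume "p dvd lag_disc S"
  then obtain s where s: "s \<in> S" "p dvd (\<Prod>t\<in>S - {s}. s - t)"
    using assms unfolding lag_disc_def by (auto simp: prime_dvd_prod_iff)
  then obtain t where "t \<in> S - {s}" "p dvd s - t"
    using assms by (auto simp: prime_dvd_prod_iff)
  thus False using assms(3) s by (auto simp: inj_on_def mod_eq_dvd_iff)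
qed

text \<open>The Vandermonde determinant in Leibniz form. The expanded sum is what the extraction of
  coefficients works on.\<close>

definition alternant :: "nat \<Rightarrow> (nat \<Rightarrow> int) \<Rightarrow> int" where
  "alternant n y = (\<Sum>\<sigma> | \<sigma> permutes {..<n}. sign \<sigma> * (\<Prod>i<n. y i ^ \<sigma> i))"

text \<open>Composing with the transposition of \<open>a\<close> and \<open>b\<close> negates the
  sum, yet leaves it unchanged modulo \<open>p\<close>. So \<open>p\<close> divides twice the
  alternant, and \<open>p\<close> is odd.\<close>

lemma alternant_dvd:
  fixes p :: int
  assumes p: "prime p" "odd p" and ab: "a < n" "b < n" "a \<noteq> b" "[y a = y b] (mod p)"
  shows "p dvd alternant n y"
proof -
  let ?t = "Transposition.transpose a b"
  have t: "?t permutes {..<n}"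
    using ab by (intro permutes_swap_id) auto
  have "alternant n y = (\<Sum>\<sigma> | \<sigma> permutes {..<n}. sign (\<sigma> \<circ> ?t) * (\<Prod>i<n. y i ^ (\<sigma> \<circ> ?t) i))"
    unfolding alternant_def by (rule sum_permutations_compose_right[OF t])
  also have "\<dots> = (\<Sum>\<sigma> | \<sigma> permutes {..<n}. - (sign \<sigma> * (\<Prod>i<n. y (?t i) ^ \<sigma> i)))"
  proof (rule sum.cong[OF refl])
    fix \<sigma> assume "\<sigma> \<in> {\<sigma>. \<sigma> permutes {..<n}}"
    hence \<sigma>: "\<sigma> permutes {..<n}" by simp
    have "sign (\<sigma> \<circ> ?t) = - sign \<sigma>"
      using ab \<sigma> permutes_imp_permutation[of "{..<n}" \<sigma>]
      by (simp add: sign_compose permutation_swap_id sign_swap_id)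
    moreover have "(\<Prod>i<n. y i ^ (\<sigma> \<circ> ?t) i) = (\<Prod>i<n. y (?t i) ^ \<sigma> i)"
      using prod.permute[OF t, of "\<lambda>i. y i ^ (\<sigma> \<circ> ?t) i"] by (simp add: o_def)
    ultimately show "sign (\<sigma> \<circ> ?t) * (\<Prod>i<n. y i ^ (\<sigma> \<circ> ?t) i) = - (sign \<sigma> * (\<Prod>i<n. y (?t i) ^ \<sigma> i))"
      by simp
  qed
  finally have eq: "alternant n y = (\<Sum>\<sigma> | \<sigma> permutes {..<n}. - (sign \<sigma> * (\<Prod>i<n. y (?t i) ^ \<sigma> i)))" .
  have "[alternant n y = - alternant n y] (mod p)"
  proof -
    have "[(\<Sum>\<sigma> | \<sigma> permutes {..<n}. - (sign \<sigma> * (\<Prod>i<n. y (?t i) ^ \<sigma> i)))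
        = (\<Sum>\<sigma> | \<sigma> permutes {..<n}. - (sign \<sigma> * (\<Prod>i<n. y i ^ \<sigma> i)))] (mod p)"
      using ab
      by (intro cong_sum cong_minus_minus_iff[THEN iffD2] cong_scalar_left cong_prod cong_pow)
         (auto simp: Transposition.transpose_def cong_sym_eq)
    thus ?thesis using eq by (simp add: alternant_def sum_negf)
  qed
  hence "p dvd 2 * alternant n y"
    by (simp add: cong_iff_dvd_diff)
  moreover have "\<not> p dvd 2"
  proof
    assume "p dvd 2"
    moreover have "p \<ge> 2" using p(1) by (rule prime_ge_2_int)
    ultimately have "p = 2" using zdvd_imp_le[of p 2] by simp
    thus False using p(2) by simp
  qed
  ultimately show ?thesis using p prime_dvd_mult_iff by blast
qed

lemma sum_lessThan_double: "4 * (\<Sum>i<n. i) = n * (2 * (n - 1))" for n :: nat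
  by (induction n) (auto simp: algebra_simps, case_tac n, auto)

text \<open>Induction on \<open>v\<close>. Let \<open>i\<close> be the place where \<sigma> takes
  the value \<open>n - 1 - v\<close>. By induction the arguments below \<open>v\<close> have other
  values under \<sigma>, and \<tau> has used up the values below \<open>v\<close>; so
  \<open>i\<close> and \<open>\<tau> i\<close> are both at least \<open>v\<close>, and the equation
  leaves no room for more.\<close>

lemma permutes_antidiagonal_unique:
  fixes n :: nat
  assumes \<sigma>: "\<sigma> permutes {..<n}" and \<tau>: "\<tau> permutes {..<n}"
    and eq: "\<And>i. i < n \<Longrightarrow> 2 * \<sigma> i + \<tau> i + i = 2 * (n - 1)"
    and v: "v < n"
  shows "\<sigma> v = n - 1 - v" "\<tau> v = v"
proof -
  have "\<sigma> v = n - 1 - v \<and> \<tau> v = v" using v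
  proof (induction v rule: less_induct)
    case (less v)
    define i where "i = inv \<sigma> (n - 1 - v)"
    have \<sigma>i: "\<sigma> i = n - 1 - v" unfolding i_def using \<sigma> by (simp add: permutes_inverses)
    have "\<sigma> i \<in> {..<n}" using \<sigma>i less.prems by simp
    hence "i < n" using permutes_in_image[OF \<sigma>] by simp
    have ge1: "i \<ge> v"
    proof (rule ccontr)
      assume "\<not> i \<ge> v"
      hence "\<sigma> i = n - 1 - i" using less.IH[of i] \<open>i < n\<close> by simp
      thus False using \<sigma>i \<open>\<not> i \<ge> v\<close> less.prems by simp
    qed
    have ge2: "\<tau> i \<ge> v"
    proof (rule ccontr)
      assume a: "\<not> \<tau> i \<ge> v"
      hence "\<tau> (\<tau> i) = \<tau> i" using less.IH[of "\<tau> i"] less.prems by simp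
      hence "\<tau> i = i" using permutes_inj[OF \<tau>] by (simp add: inj_eq)
      thus False using a ge1 by simp
    qed
    have "i = v" "\<tau> i = v" using eq[OF \<open>i < n\<close>] \<sigma>i ge1 ge2 less.prems by auto
    thus ?case using \<sigma>i by simp
  qed
  thus "\<sigma> v = n - 1 - v" "\<tau> v = v" by auto
qed

text \<open>
  The Combinatorial Nullstellensatz, in the form of the linear functional that extracts the
  coefficient of the monomial in which every variable has exponent \<open>2 * M - 1\<close>. The
  polynomial is the product of the alternants of the squares \<open>x i ^ 2\<close> and of the places
  \<open>a i + x i\<close> and of factors excluding the forbidden places; the only pair of permutations
  contributing to the coefficient is the reversal and the identity.
\<close>

lemma polynomial_placement:
  fixes p :: int and S :: "int set" and a :: "nat \<Rightarrow> int" and F :: "nat \<Rightarrow> int set"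
  assumes p: "prime p" "odd p" and S: "finite S" "inj_on (\<lambda>s. s mod p) S" "card S = 2 * M"
    and n: "n \<le> M"
    and F: "\<And>i. i < n \<Longrightarrow> finite (F i)" "\<And>i. i < n \<Longrightarrow> card (F i) \<le> 2 * (M - n) + 1 + i"
  obtains x where "\<And>i. i < n \<Longrightarrow> x i \<in> S"
    "\<And>i j. i < n \<Longrightarrow> j < n \<Longrightarrow> i \<noteq> j \<Longrightarrow> \<not> [x i ^ 2 = x j ^ 2] (mod p)"
    "\<And>i j. i < n \<Longrightarrow> j < n \<Longrightarrow> i \<noteq> j \<Longrightarrow> \<not> [a i + x i = a j + x j] (mod p)"
    "\<And>i u. i < n \<Longrightarrow> u \<in> F i \<Longrightarrow> \<not> [a i + x i = u] (mod p)"
proof (cases "n = 0")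
  case True
  thus ?thesis using that by auto
next
  case False
  \<comment> \<open>Extra factors \<open>x i\<close> use up each budget, so that the term of
    \<sigma> and \<tau> has degree \<open>2 * \<sigma> i + \<tau> i + i + 2 * (M - n) + 1\<close> in
    \<open>x i\<close>, whatever the size of \<open>F i\<close>. For the reversal and the identity
    this is \<open>2 * M - 1\<close>.\<close>
  define pad where "pad i = 2 * (M - n) + 1 + i - card (F i)" for i
  define P where "P \<sigma> \<tau> i = monom 1 (2 * \<sigma> i) * [:a i, 1:] ^ \<tau> i * (\<Prod>u\<in>F i. [:a i - u, 1:]) * monom 1 (pad i)"
    for \<sigma> \<tau> :: "nat \<Rightarrow> nat" and i
  define Q where "Q x = alternant n (\<lambda>i. x i ^ 2) * alternant n (\<lambda>i. a i + x i) *
      (\<Prod>i<n. (\<Prod>u\<in>F i. a i + x i - u) * x i ^ pad i)" for x :: "nat \<Rightarrow> int"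
  define rv where "rv i = (if i < n then n - 1 - i else i)" for i
  let ?Pm = "{\<sigma>. \<sigma> permutes {..<n}}"
  have polyP: "poly (P \<sigma> \<tau> i) x = (x ^ 2) ^ \<sigma> i * (a i + x) ^ \<tau> i * ((\<Prod>u\<in>F i. a i + x - u) * x ^ pad i)"
    for \<sigma> \<tau> i x
    by (simp add: P_def poly_monom poly_prod power_mult[symmetric] add_diff_eq diff_add_eq mult_ac)
  have degP: "degree (P \<sigma> \<tau> i) = 2 * \<sigma> i + \<tau> i + card (F i) + pad i" if "i < n" for \<sigma> \<tau> i
    unfolding P_def using F(1)[OF that]
    by (simp add: degree_mult_eq degree_monom_eq degree_power_eq degree_prod_sum_eq)
  have lcP: "lead_coeff (P \<sigma> \<tau> i) = 1" for \<sigma> \<tau> i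
    unfolding P_def by (simp add: lead_coeff_mult lead_coeff_power lead_coeff_prod degree_monom_eq)
  have degP': "degree (P \<sigma> \<tau> i) = 2 * \<sigma> i + \<tau> i + (2 * (M - n) + 1 + i)" if "i < n" for \<sigma> \<tau> i
    using F(2)[OF that] degP[OF that] by (simp add: pad_def)
  have Q: "Q x = (\<Sum>\<sigma>\<in>?Pm. \<Sum>\<tau>\<in>?Pm. sign \<sigma> * sign \<tau> * (\<Prod>i<n. poly (P \<sigma> \<tau> i) (x i)))" for x
    unfolding Q_def alternant_def polyP
    by (subst sum_product, simp only: sum_distrib_right, intro sum.cong refl) (simp add: prod.distrib mult_ac)
  have fP: "finite ?Pm" by (simp add: finite_permutations)
  let ?G = "{..<n} \<rightarrow>\<^sub>E S"
  let ?W = "lag_weight S"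
  \<comment> \<open>Every term of \<open>Q\<close> is a product of polynomials in one variable each,
    so the weighted sum over the grid factors into sums over \<open>S\<close>, which read off the
    coefficients of degree \<open>2 * M - 1\<close>.\<close>
  have "(\<Sum>x\<in>?G. (\<Prod>i<n. ?W (x i)) * Q x)
      = (\<Sum>x\<in>?G. \<Sum>\<sigma>\<in>?Pm. \<Sum>\<tau>\<in>?Pm. sign \<sigma> * sign \<tau> * (\<Prod>i<n. ?W (x i) * poly (P \<sigma> \<tau> i) (x i)))"
    unfolding Q by (simp add: sum_distrib_left prod.distrib mult_ac)
  also have "\<dots> = (\<Sum>\<sigma>\<in>?Pm. \<Sum>x\<in>?G. \<Sum>\<tau>\<in>?Pm. sign \<sigma> * sign \<tau> * (\<Prod>i<n. ?W (x i) * poly (P \<sigma> \<tau> i) (x i)))"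
    by (rule sum.swap)
  also have "\<dots> = (\<Sum>\<sigma>\<in>?Pm. \<Sum>\<tau>\<in>?Pm. \<Sum>x\<in>?G. sign \<sigma> * sign \<tau> * (\<Prod>i<n. ?W (x i) * poly (P \<sigma> \<tau> i) (x i)))"
    by (intro sum.cong refl sum.swap)
  also have "\<dots> = (\<Sum>\<sigma>\<in>?Pm. \<Sum>\<tau>\<in>?Pm. sign \<sigma> * sign \<tau> * (\<Prod>i<n. \<Sum>s\<in>S. ?W s * poly (P \<sigma> \<tau> i) s))"
    using S by (simp add: prod_sum_PiE sum_distrib_left)
  also have "\<dots> = (\<Sum>\<sigma>\<in>?Pm. \<Sum>\<tau>\<in>?Pm.
      if \<forall>i<n. \<sigma> i = n - 1 - i \<and> \<tau> i = i then sign \<sigma> * sign \<tau> * lag_disc S ^ n else 0)"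
  proof (intro sum.cong refl)
    fix \<sigma> \<tau> assume "\<sigma> \<in> ?Pm" "\<tau> \<in> ?Pm"
    hence \<sigma>: "\<sigma> permutes {..<n}" and \<tau>: "\<tau> permutes {..<n}" by auto
    let ?f = "\<lambda>i. \<Sum>s\<in>S. ?W s * poly (P \<sigma> \<tau> i) s"
    show "sign \<sigma> * sign \<tau> * (\<Prod>i<n. ?f i)
        = (if \<forall>i<n. \<sigma> i = n - 1 - i \<and> \<tau> i = i then sign \<sigma> * sign \<tau> * lag_disc S ^ n else 0)"
    proof (cases "\<forall>i<n. \<sigma> i = n - 1 - i \<and> \<tau> i = i")
      case True
      have "?f i = lag_disc S" if "i < n" for i
      proof -
        have d: "degree (P \<sigma> \<tau> i) = 2 * M - 1"
          using degP'[OF that] True that n by simp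
        have "?f i = lag_disc S * coeff (P \<sigma> \<tau> i) (card S - 1)"
          by (rule sum_lag_weight) (use S d n False in auto)
        thus ?thesis using lcP[of \<sigma> \<tau> i] d S(3) by simp
      qed
      thus ?thesis using True by simp
    next
      case False
      \<comment> \<open>The degrees of each term add up to \<open>n * (2 * M - 1)\<close>. Unless
        all of them equal \<open>2 * M - 1\<close>, one is smaller and its factor vanishes; and
        equality throughout happens only for the reversal and the identity.\<close>
      have "\<exists>i<n. degree (P \<sigma> \<tau> i) < 2 * M - 1"
      proof (rule ccontr)
        assume neg: "\<not> ?thesis"
        let ?d = "\<lambda>i. 2 * \<sigma> i + \<tau> i + i"
        have ge: "?d i \<ge> 2 * (n - 1)" if "i < n" for i
        proof -
          have "2 * M - 1 \<le> degree (P \<sigma> \<tau> i)" using neg that leI by blast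
          thus ?thesis using degP'[OF that, of \<sigma> \<tau>] n by simp
        qed
        have "(\<Sum>i<n. ?d i) = 2 * (\<Sum>i<n. \<sigma> i) + (\<Sum>i<n. \<tau> i) + (\<Sum>i<n. i)"
          by (simp add: sum.distrib sum_distrib_left)
        also have "(\<Sum>i<n. \<sigma> i) = (\<Sum>i<n. i)"
          using sum.permute[OF \<sigma>, of id] by (simp add: o_def)
        also have "(\<Sum>i<n. \<tau> i) = (\<Sum>i<n. i)"
          using sum.permute[OF \<tau>, of id] by (simp add: o_def)
        also have "2 * (\<Sum>i<n. i) + (\<Sum>i<n. i) + (\<Sum>i<n. i) = (\<Sum>i<n. 2 * (n - 1))"
          using sum_lessThan_double[of n] by (simp add: mult.commute)
        finally have tot: "(\<Sum>i<n. ?d i) = (\<Sum>i<n. 2 * (n - 1))" .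
        have "?d i = 2 * (n - 1)" if "i < n" for i
        proof (rule ccontr)
          assume "?d i \<noteq> 2 * (n - 1)"
          hence "?d i > 2 * (n - 1)" using ge[OF that] by simp
          hence "(\<Sum>i<n. ?d i) > (\<Sum>i<n. 2 * (n - 1))"
            by (intro sum_strict_mono_ex1) (use ge that in auto)
          thus False using tot by simp
        qed
        with permutes_antidiagonal_unique[OF \<sigma> \<tau>] False show False by blast
      qed
      then obtain i where i: "i < n" "degree (P \<sigma> \<tau> i) < 2 * M - 1" by blast
      have "?f i = lag_disc S * coeff (P \<sigma> \<tau> i) (card S - 1)"
        by (rule sum_lag_weight) (use S i in auto)
      hence "?f i = 0" using i S by (simp add: coeff_eq_0)
      hence "(\<Prod>i<n. ?f i) = 0" using i by (intro prod_zero) auto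
      thus ?thesis unfolding if_not_P[OF False] by simp
    qed
  qed
  also have "\<dots> = (\<Sum>\<sigma>\<in>?Pm. \<Sum>\<tau>\<in>?Pm.
      if \<sigma> = rv then if \<tau> = id then sign \<sigma> * sign \<tau> * lag_disc S ^ n else 0 else 0)"
  proof (intro sum.cong refl)
    fix \<sigma> \<tau> assume "\<sigma> \<in> ?Pm" "\<tau> \<in> ?Pm"
    hence "\<And>i. i \<ge> n \<Longrightarrow> \<sigma> i = i" "\<And>i. i \<ge> n \<Longrightarrow> \<tau> i = i"
      by (auto simp: permutes_def)
    hence "(\<forall>i<n. \<sigma> i = n - 1 - i \<and> \<tau> i = i) \<longleftrightarrow> \<sigma> = rv \<and> \<tau> = id"
      by (auto simp: fun_eq_iff rv_def) (metis not_le)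
    thus "(if \<forall>i<n. \<sigma> i = n - 1 - i \<and> \<tau> i = i then sign \<sigma> * sign \<tau> * lag_disc S ^ n else 0)
      = (if \<sigma> = rv then if \<tau> = id then sign \<sigma> * sign \<tau> * lag_disc S ^ n else 0 else 0)"
      by simp
  qed
  also have "\<dots> = (\<Sum>\<sigma>\<in>?Pm. if \<sigma> = rv then sign \<sigma> * lag_disc S ^ n else 0)"
  proof (intro sum.cong refl)
    fix \<sigma> :: "nat \<Rightarrow> nat"
    have "(id :: nat \<Rightarrow> nat) \<in> ?Pm" by (simp add: permutes_id)
    hence "(\<Sum>\<tau>\<in>?Pm. if \<tau> = id then sign \<sigma> * sign \<tau> * lag_disc S ^ n else 0)
        = sign \<sigma> * lag_disc S ^ n"
      by (subst sum.delta[OF fP]) simp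
    thus "(\<Sum>\<tau>\<in>?Pm. if \<sigma> = rv then if \<tau> = id then sign \<sigma> * sign \<tau> * lag_disc S ^ n else 0 else 0)
        = (if \<sigma> = rv then sign \<sigma> * lag_disc S ^ n else 0)"
      by (cases "\<sigma> = rv") simp_all
  qed
  also have "\<dots> = sign rv * lag_disc S ^ n"
  proof -
    have "rv permutes {..<n}" unfolding rv_def
      by (rule bij_imp_permutes, rule bij_betwI[where g = "\<lambda>i. n - 1 - i"]) auto
    hence "rv \<in> ?Pm" by simp
    thus ?thesis by (subst sum.delta[OF fP]) simp
  qed
  finally have main: "(\<Sum>x\<in>?G. (\<Prod>i<n. ?W (x i)) * Q x) = sign rv * lag_disc S ^ n" .
  have "\<not> p dvd lag_disc S ^ n"
    using lag_disc_not_dvd[OF p(1) S(1,2)] p(1) prime_dvd_power by blast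
  hence "\<not> p dvd (\<Sum>x\<in>?G. (\<Prod>i<n. ?W (x i)) * Q x)"
    unfolding main sign_def by simp
  then obtain x where x: "x \<in> ?G" "\<not> p dvd Q x"
    by (meson dvd_mult dvd_sum)
  show ?thesis
  proof (rule that)
    show "x i \<in> S" if "i < n" for i using x(1) that by auto
    show "\<not> [x i ^ 2 = x j ^ 2] (mod p)" if "i < n" "j < n" "i \<noteq> j" for i j
    proof
      assume "[x i ^ 2 = x j ^ 2] (mod p)"
      hence "p dvd alternant n (\<lambda>i. x i ^ 2)" by (rule alternant_dvd[OF p that])
      thus False using x(2) by (simp add: Q_def)
    qed
    show "\<not> [a i + x i = a j + x j] (mod p)" if "i < n" "j < n" "i \<noteq> j" for i j
    proof
      assume "[a i + x i = a j + x j] (mod p)"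
      hence "p dvd alternant n (\<lambda>i. a i + x i)" by (rule alternant_dvd[OF p that])
      thus False using x(2) by (simp add: Q_def)
    qed
    show "\<not> [a i + x i = u] (mod p)" if "i < n" "u \<in> F i" for i u
    proof
      assume "[a i + x i = u] (mod p)"
      hence "p dvd a i + x i - u" by (simp add: cong_iff_dvd_diff)
      hence "p dvd (\<Prod>u\<in>F i. a i + x i - u)" using that F(1) by (meson dvd_prodI dvd_trans)
      hence "p dvd (\<Prod>i<n. (\<Prod>u\<in>F i. a i + x i - u) * x i ^ pad i)" using that
        by (meson dvd_mult2 dvd_prodI dvd_trans finite_lessThan lessThan_iff)
      thus False using x(2) by (simp add: Q_def)
    qed
  qed
qed

section \<open>Lifting to the doubled complete graph\<close>

definition parent_graph :: "'a set \<Rightarrow> 'a \<Rightarrow> ('a \<Rightarrow> 'a) \<Rightarrow> 'a ugraph" where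
  "parent_graph V r par = \<lparr>verts = V, edges = (\<lambda>v. {v, par v}) ` (V - {r})\<rparr>"

text \<open>Names the vertices by residue and level such that the matching edges are the fibres over
  the residues. In these coordinates all perfect matchings look alike.\<close>

lemma perfect_matching_enum:
  assumes M: "perfect_matching (complete_ugraph (2 * p)) M"
  obtains \<beta> :: "int \<times> bool \<Rightarrow> nat" where "bij_betw \<beta> ({0..<int p} \<times> UNIV) {..<2 * p}"
    "M = (\<lambda>y. {\<beta> (y, False), \<beta> (y, True)}) ` {0..<int p}"
proof -
  have e: "e \<subseteq> {..<2 * p}" "card e = 2" if "e \<in> M" for e
    using M that by (auto simp: perfect_matching_def complete_ugraph_def)
  have cov: "\<exists>!e. e \<in> M \<and> v \<in> e" if "v < 2 * p" for v
    using M that by (auto simp: perfect_matching_def complete_ugraph_def)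
  have fM: "finite M"
    by (rule finite_subset[of _ "Pow {..<2 * p}"]) (use e in auto)
  have disj: "e = e'" if "e \<in> M" "e' \<in> M" "v \<in> e" "v \<in> e'" for e e' v
    using that cov[of v] e(1)[of e] by blast
  have UM: "\<Union>M = {..<2 * p}" using e cov by blast
  have "card (\<Union>M) = (\<Sum>e\<in>M. card e)"
  proof (rule card_Union_disjoint)
    show "pairwise disjnt M" using disj by (auto simp: pairwise_def disjnt_iff)
    show "finite e" if "e \<in> M" for e using e(1)[OF that] finite_subset by blast
  qed
  hence "2 * p = 2 * card M" using UM e by simp
  hence cM: "card M = p" by simp
  obtain en :: "int \<Rightarrow> nat set" where en: "bij_betw en {0..<int p} M"
    using fM cM finite_same_card_bij[of "{0..<int p}" M] by auto
  have "\<exists>ab. en y = {fst ab, snd ab} \<and> fst ab \<noteq> snd ab" if "y \<in> {0..<int p}" for y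
  proof -
    have "en y \<in> M" using en that by (auto simp: bij_betw_def)
    then obtain a b where "en y = {a, b}" "a \<noteq> b" using e(2) card_2_iff[of "en y"] by metis
    thus ?thesis by (intro exI[of _ "(a, b)"]) auto
  qed
  then obtain ab where ab: "\<And>y. y \<in> {0..<int p} \<Longrightarrow> en y = {fst (ab y), snd (ab y)} \<and> fst (ab y) \<noteq> snd (ab y)"
    by metis
  define \<beta> where "\<beta> z = (if snd z then snd (ab (fst z)) else fst (ab (fst z)))" for z :: "int \<times> bool"
  have \<beta>en: "\<beta> (y, i) \<in> en y" if "y \<in> {0..<int p}" for y i using ab[OF that] by (auto simp: \<beta>_def)
  have enM: "en y \<in> M" if "y \<in> {0..<int p}" for y using en that by (auto simp: bij_betw_def)
  have "inj_on \<beta> ({0..<int p} \<times> UNIV)"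
  proof (rule inj_onI, clarify)
    fix y y' i i' assume yy: "y \<in> {0..<int p}" "y' \<in> {0..<int p}" and eq: "\<beta> (y, i) = \<beta> (y', i')"
    have "en y = en y'" using disj[OF enM enM] \<beta>en yy eq by metis
    hence "y = y'" using en yy by (auto simp: bij_betw_def inj_on_def)
    moreover have "i = i'" using eq \<open>y = y'\<close> ab[OF yy(1)] by (auto simp: \<beta>_def split: if_splits)
    ultimately show "y = y' \<and> i = i'" by simp
  qed
  moreover have "\<beta> ` ({0..<int p} \<times> UNIV) = {..<2 * p}"
  proof
    show "\<beta> ` ({0..<int p} \<times> UNIV) \<subseteq> {..<2 * p}" using \<beta>en enM UM by blast
    show "{..<2 * p} \<subseteq> \<beta> ` ({0..<int p} \<times> UNIV)"
    proof
      fix v assume "v \<in> {..<2 * p}"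
      then obtain e where "e \<in> M" "v \<in> e" using UM by blast
      then obtain y where y: "y \<in> {0..<int p}" "v \<in> en y" using en by (auto simp: bij_betw_def)
      hence "v = \<beta> (y, False) \<or> v = \<beta> (y, True)" using ab by (auto simp: \<beta>_def)
      thus "v \<in> \<beta> ` ({0..<int p} \<times> UNIV)" using y by blast
    qed
  qed
  moreover have "M = (\<lambda>y. {\<beta> (y, False), \<beta> (y, True)}) ` {0..<int p}"
  proof -
    have "M = en ` {0..<int p}" using en by (simp add: bij_betw_def)
    also have "\<dots> = (\<lambda>y. {\<beta> (y, False), \<beta> (y, True)}) ` {0..<int p}"
      using ab by (intro image_cong refl) (simp add: \<beta>_def)
    finally show ?thesis .
  qed
  ultimately show ?thesis using that by (auto simp: bij_betw_def)
qed

definition dir_level :: "nat \<Rightarrow> bool \<times> bool \<Rightarrow> bool" where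
  "dir_level c k = (if c = 1 then fst k else if c = 2 then snd k else fst k \<noteq> snd k)"

text \<open>The numbers 1, 2, 3 stand for the nonzero linear forms on \<open>F_2^2\<close>, any two
  of which are coordinates.\<close>

lemma dir_level_inj:
  assumes "c \<in> {1, 2, 3}" "c' \<in> {1, 2, 3}" "c \<noteq> c'"
    and "dir_level c k = dir_level c k'" "dir_level c' k = dir_level c' k'"
  shows "k = k'"
  using assms by (cases k; cases k') (auto simp: dir_level_def)

lemma abs_eq_of_dvd:
  fixes x y :: int and m :: nat
  assumes "int (2 * m + 1) dvd x - y" "\<bar>x\<bar> \<le> int m" "\<bar>y\<bar> \<le> int m"
  shows "x = y"
proof (rule ccontr)
  assume "x \<noteq> y"
  hence "int (2 * m + 1) \<le> \<bar>x - y\<bar>" using assms(1) by (intro zdvd_imp_le) auto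
  thus False using assms(2,3) by linarith
qed

text \<open>
  The levels of a vertex in the four lifts are one of the three balanced functions
  \<open>a\<close>, \<open>b\<close>, \<open>a + b\<close> on \<open>{0, 1}\<^sup>2\<close> or its complement. Two different directions
  are orthogonal, so that the four lifts of an edge are its four blow-ups, and two vertices
  with the same direction but opposite complements never meet.
\<close>

lemma decomposes_of_lift:
  fixes f :: "'a \<Rightarrow> int" and c :: "'a \<Rightarrow> nat" and h :: "'a \<Rightarrow> bool"
  assumes V: "finite V" "r \<in> V" "card V = m + 1" and m: "m > 0"
    and par: "\<And>v. v \<in> V - {r} \<Longrightarrow> par v \<in> V"
    and cls: "\<And>v. v \<in> V - {r} \<Longrightarrow> \<bar>f v - f (par v)\<bar> \<in> {1..int m}"
    and inj: "inj_on (\<lambda>v. \<bar>f v - f (par v)\<bar>) (V - {r})"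
    and c: "\<And>v. v \<in> V \<Longrightarrow> c v \<in> {1, 2, 3}" "\<And>v. v \<in> V - {r} \<Longrightarrow> c v \<noteq> c (par v)"
    and fib: "\<And>u v. u \<in> V \<Longrightarrow> v \<in> V \<Longrightarrow> u \<noteq> v \<Longrightarrow> [f u = f v] (mod int (2 * m + 1)) \<Longrightarrow>
      c u = c v \<and> h u \<noteq> h v"
    and M: "perfect_matching (complete_ugraph (4 * m + 2)) M"
  shows "decomposes (parent_graph V r par) (delete_edges (complete_ugraph (4 * m + 2)) M)"
proof -
  define p where "p = 2 * m + 1"
  let ?G = "delete_edges (complete_ugraph (4 * m + 2)) M"
  have n2: "4 * m + 2 = 2 * p" by (simp add: p_def)
  obtain \<beta> :: "int \<times> bool \<Rightarrow> nat" where \<beta>: "bij_betw \<beta> ({0..<int p} \<times> UNIV) {..<2 * p}"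
      and M_eq: "M = (\<lambda>y. {\<beta> (y, False), \<beta> (y, True)}) ` {0..<int p}"
  proof (rule perfect_matching_enum)
    show "perfect_matching (complete_ugraph (2 * p)) M" using M n2 by simp
  qed
  have \<beta>_eq: "\<beta> (y, i) = \<beta> (y', i') \<longleftrightarrow> y = y' \<and> i = i'"
    if "y \<in> {0..<int p}" "y' \<in> {0..<int p}" for y y' i i'
    using inj_on_eq_iff[OF bij_betw_imp_inj_on[OF \<beta>], of "(y, i)" "(y', i')"] that by simp
  have p0: "int p > 0" by (simp add: p_def)
  define lev where "lev k v \<longleftrightarrow> dir_level (c v) k \<noteq> h v" for k v
  define g where "g y k v = \<beta> ((f v + y) mod int p, lev k v)" for y k v
  have pos_in: "(z mod int p) \<in> {0..<int p}" for z using p0 by simp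
  have g_eq: "g y k u = g y' k' v \<longleftrightarrow> [f u + y = f v + y'] (mod int p) \<and> lev k u = lev k' v" for y y' k k' u v
    unfolding g_def by (subst \<beta>_eq[OF pos_in pos_in]) (auto simp: cong_def)
  have g_dvd: "int p dvd (f u + y) - (f v + y')" if "g y k u = g y' k' v" for y y' k k' u v
    using that by (simp add: g_eq cong_iff_dvd_diff)
  have g_lt: "g y k v < 2 * p" for y k v
    using \<beta> pos_in by (auto simp: g_def bij_betw_def)
  have g_inj: "inj_on (g y k) V" for y k
  proof (rule inj_onI, rule ccontr)
    fix u v assume uv: "u \<in> V" "v \<in> V" "g y k u = g y k v" "u \<noteq> v"
    hence "[f u = f v] (mod int p)" by (simp add: g_eq cong_add_rcancel)
    hence "c u = c v \<and> h u \<noteq> h v" using fib uv by (simp add: p_def)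
    thus False using uv by (auto simp: g_eq lev_def)
  qed
  define \<Phi> where "\<Phi> z = (case z of (v, y, k) \<Rightarrow> {g y k v, g y k (par v)})"
    for z :: "'a \<times> int \<times> bool \<times> bool"
  let ?D = "(V - {r}) \<times> {0..<int p} \<times> (UNIV :: (bool \<times> bool) set)"
  have posne: "\<not> [f v + y = f (par v) + y] (mod int p)" if "v \<in> V - {r}" for v y
  proof
    assume "[f v + y = f (par v) + y] (mod int p)"
    hence "int p dvd (f v - f (par v)) - 0" by (simp add: cong_iff_dvd_diff)
    hence "f v - f (par v) = 0" using cls[OF that] unfolding p_def
      by (intro abs_eq_of_dvd) auto
    thus False using cls[OF that] by simp
  qed
  \<comment> \<open>An edge determines its origin: the difference of its residues, up to sign, gives
    \<open>v\<close>; the ends cannot be swapped, because a nonzero difference is not its own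
    negative modulo an odd number; then the residues give the translate and the two levels give the
    lift.\<close>
  have inj\<Phi>: "inj_on \<Phi> ?D"
  proof (rule inj_onI)
    fix z z' assume z: "z \<in> ?D" "z' \<in> ?D" "\<Phi> z = \<Phi> z'"
    obtain v y k where z1: "z = (v, y, k)" by (cases z) auto
    obtain v' y' k' where z2: "z' = (v', y', k')" by (cases z') auto
    have v: "v \<in> V - {r}" "v' \<in> V - {r}" and y: "y \<in> {0..<int p}" "y' \<in> {0..<int p}"
      using z z1 z2 by auto
    let ?x = "f v - f (par v)" and ?x' = "f v' - f (par v')"
    have alt: "g y k v = g y' k' v' \<and> g y k (par v) = g y' k' (par v') \<or>
       g y k v = g y' k' (par v') \<and> g y k (par v) = g y' k' v'"
      using z(3) z1 z2 by (auto simp: \<Phi>_def doubleton_eq_iff)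
    have "?x = ?x' \<or> ?x = - ?x'"
    proof -
      from alt have "int p dvd ?x - ?x' \<or> int p dvd ?x - (- ?x')"
      proof (elim disjE conjE)
        assume "g y k v = g y' k' v'" "g y k (par v) = g y' k' (par v')"
        from dvd_diff[OF g_dvd[OF this(1)] g_dvd[OF this(2)]]
        have "int p dvd (f v + y - (f v' + y')) - (f (par v) + y - (f (par v') + y'))" .
        thus ?thesis by (simp add: algebra_simps)
      next
        assume "g y k v = g y' k' (par v')" "g y k (par v) = g y' k' v'"
        from dvd_diff[OF g_dvd[OF this(1)] g_dvd[OF this(2)]]
        have "int p dvd (f v + y - (f (par v') + y')) - (f (par v) + y - (f v' + y'))" .
        thus ?thesis by (simp add: algebra_simps)
      qed
      thus ?thesis using cls[OF v(1)] cls[OF v(2)] unfolding p_def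
        by (elim disjE; intro disjI1 disjI2 abs_eq_of_dvd) auto
    qed
    hence "\<bar>?x\<bar> = \<bar>?x'\<bar>" by auto
    hence vv: "v' = v" using inj v by (auto simp: inj_on_def)
    have straight: "g y k v = g y' k' v" "g y k (par v) = g y' k' (par v)"
    proof -
      have False if "g y k v = g y' k' (par v)" "g y k (par v) = g y' k' v"
      proof -
        have "int p dvd (f v + y - (f (par v) + y')) - (f (par v) + y - (f v + y'))"
          using dvd_diff[OF g_dvd[OF that(1)] g_dvd[OF that(2)]] .
        hence "int p dvd ?x - (- ?x)" by (simp add: algebra_simps)
        hence "?x = - ?x" using cls[OF v(1)] unfolding p_def by (intro abs_eq_of_dvd) auto
        thus False using cls[OF v(1)] by simp
      qed
      thus "g y k v = g y' k' v" "g y k (par v) = g y' k' (par v)" using alt vv by auto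
    qed
    have "[y = y'] (mod int p)" using straight(1) by (simp add: g_eq cong_add_lcancel)
    hence yy: "y' = y" using y by (auto simp: cong_def)
    have "k = k'"
      using straight c(1)[of v] c(1)[OF par[OF v(1)]] c(2)[OF v(1)] v(1)
      by (intro dir_level_inj[of "c v" "c (par v)"]) (auto simp: g_eq lev_def)
    thus "z = z'" using z1 z2 vv yy by simp
  qed
  have edges_G: "edges ?G = {e. e \<subseteq> {..<2 * p} \<and> card e = 2} - M"
    by (simp add: delete_edges_def complete_ugraph_def p_def)
  have \<Phi>_in: "\<Phi> z \<in> edges ?G" if z: "z \<in> ?D" for z
  proof -
    obtain v y k where z1: "z = (v, y, k)" by (cases z) auto
    have v: "v \<in> V - {r}" using z z1 by auto
    have ne: "g y k v \<noteq> g y k (par v)" using posne[OF v] by (simp add: g_eq)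
    have "\<Phi> z \<notin> M"
    proof
      assume "\<Phi> z \<in> M"
      then obtain w where w: "w \<in> {0..<int p}" "{g y k v, g y k (par v)} = {\<beta> (w, False), \<beta> (w, True)}"
        by (auto simp: M_eq \<Phi>_def z1)
      hence "(f v + y) mod int p = w" "(f (par v) + y) mod int p = w"
        using \<beta>_eq[OF pos_in w(1)] by (auto simp: g_def doubleton_eq_iff)
      thus False using posne[OF v, of y] by (simp add: cong_def)
    qed
    thus ?thesis using ne g_lt unfolding edges_G by (simp add: \<Phi>_def z1)
  qed
  have "card (\<Phi> ` ?D) = m * (p * 4)"
    using card_image[OF inj\<Phi>] V by (simp add: card_cartesian_product card_UNIV_bool)
  moreover have "card (edges ?G) = m * (p * 4)"
  proof -
    have fM: "finite M" using M_eq by simp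
    have cM: "card M = p"
    proof -
      have "inj_on (\<lambda>y. {\<beta> (y, False), \<beta> (y, True)}) {0..<int p}"
        by (rule inj_onI) (auto simp: doubleton_eq_iff \<beta>_eq)
      thus ?thesis by (simp add: M_eq card_image)
    qed
    have sub: "M \<subseteq> {e. e \<subseteq> {..<2 * p} \<and> card e = 2}"
      using M unfolding n2 by (simp add: perfect_matching_def complete_ugraph_def)
    have "card (edges ?G) = card {e. e \<subseteq> {..<2 * p} \<and> card e = 2} - card M"
      unfolding edges_G by (rule card_Diff_subset[OF fM sub])
    also have "\<dots> = (2 * p choose 2) - p" by (simp add: n_subsets cM)
    also have "\<dots> = m * (p * 4)" by (simp add: choose_two p_def algebra_simps)
    finally show ?thesis .
  qed
  moreover have "finite (edges ?G)"
    unfolding edges_G by (rule finite_subset[of _ "Pow {..<2 * p}"]) auto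
  \<comment> \<open>Both sides have \<open>4 * m * p\<close> elements, since
    \<open>p * (2 * p - 1) - p = 4 * m * p\<close>. So injectivity alone shows that every edge is
    covered.\<close>
  ultimately have im: "\<Phi> ` ?D = edges ?G"
    using \<Phi>_in by (intro card_subset_eq) auto
  define blk where "blk w = \<Phi> ` ((V - {r}) \<times> {fst w} \<times> {snd w})" for w
  let ?I = "{0..<int p} \<times> (UNIV :: (bool \<times> bool) set)"
  have blk_sub: "(V - {r}) \<times> {fst w} \<times> {snd w} \<subseteq> ?D" if "w \<in> ?I" for w using that by auto
  have "V - {r} \<noteq> {}"
  proof
    assume "V - {r} = {}"
    hence "V = {r}" using V(2) by blast
    thus False using V(3) m by simp
  qed
  have "partition_on (edges ?G) (blk ` ?I)"
  proof (rule partition_onI)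
    show "\<Union> (blk ` ?I) = edges ?G" unfolding im[symmetric] blk_def by force
    show "{} \<notin> blk ` ?I"
      using \<open>V - {r} \<noteq> {}\<close> by (auto simp: blk_def)
    show "disjnt E E'" if EE: "E \<in> blk ` ?I" "E' \<in> blk ` ?I" "E \<noteq> E'" for E E'
    proof -
      obtain w w' where w: "w \<in> ?I" "w' \<in> ?I" "E = blk w" "E' = blk w'" using EE(1,2) by blast
      hence "w \<noteq> w'" using EE(3) by blast
      hence "((V - {r}) \<times> {fst w} \<times> {snd w}) \<inter> ((V - {r}) \<times> {fst w'} \<times> {snd w'}) = {}"
        by (cases w; cases w') auto
      thus ?thesis
        using inj_on_image_Int[OF inj\<Phi> blk_sub[OF w(1)] blk_sub[OF w(2)]] w
        by (simp add: disjnt_def blk_def)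
    qed
  qed
  moreover have "\<exists>S. subgraph S ?G \<and> isomorphic (parent_graph V r par) S \<and> edges S = E" if EI: "E \<in> blk ` ?I" for E
  proof -
    obtain y k where w: "y \<in> {0..<int p}" "E = blk (y, k)" using EI by blast
    define S where "S = \<lparr>verts = g y k ` V, edges = E\<rparr>"
    have E: "E = (\<lambda>e. g y k ` e) ` edges (parent_graph V r par)"
    proof -
      have "(V - {r}) \<times> {y} \<times> {k} = (\<lambda>v. (v, y, k)) ` (V - {r})" by auto
      thus ?thesis by (simp add: w blk_def \<Phi>_def parent_graph_def image_image)
    qed
    have EG: "E \<subseteq> edges ?G" unfolding im[symmetric] w blk_def using w(1) by auto
    have pv: "e \<subseteq> V" if "e \<in> edges (parent_graph V r par)" for e
      using that par by (auto simp: parent_graph_def)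
    have "subgraph S ?G"
    proof -
      have "finite (g y k ` V)" using V by simp
      moreover have "\<forall>e\<in>E. e \<subseteq> g y k ` V" using pv by (auto simp: E)
      moreover have "\<forall>e\<in>E. card e = 2" using EG unfolding edges_G by auto
      moreover have "g y k ` V \<subseteq> verts ?G"
        using g_lt[of y k] unfolding n2 by (auto simp: delete_edges_def complete_ugraph_def)
      ultimately show ?thesis using EG
        unfolding subgraph_def simple_graph_def S_def ugraph.simps by blast
    qed
    moreover have "isomorphic (parent_graph V r par) S"
      unfolding isomorphic_def
    proof (intro exI conjI ballI)
      show "bij_betw (g y k) (verts (parent_graph V r par)) (verts S)"
        using g_inj by (simp add: S_def parent_graph_def bij_betw_def)
      fix u v assume "u \<in> verts (parent_graph V r par)" "v \<in> verts (parent_graph V r par)"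
      hence uv: "u \<in> V" "v \<in> V" by (auto simp: parent_graph_def)
      show "{u, v} \<in> edges (parent_graph V r par) \<longleftrightarrow> {g y k u, g y k v} \<in> edges S"
      proof
        assume "{u, v} \<in> edges (parent_graph V r par)"
        hence "g y k ` {u, v} \<in> E" unfolding E by (rule imageI)
        thus "{g y k u, g y k v} \<in> edges S" by (simp add: S_def)
      next
        assume "{g y k u, g y k v} \<in> edges S"
        hence "g y k ` {u, v} \<in> (\<lambda>e. g y k ` e) ` edges (parent_graph V r par)"
          unfolding S_def E by simp
        then obtain e where e: "g y k ` {u, v} = g y k ` e" "e \<in> edges (parent_graph V r par)"
          by (rule imageE)
        have "{u, v} \<subseteq> V" using uv by simp
        hence "{u, v} = e" using inj_on_image_eq_iff[OF g_inj, of "{u, v}" e y k] pv[OF e(2)] e(1) by simp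
        thus "{u, v} \<in> edges (parent_graph V r par)" using e by simp
      qed
    qed
    ultimately show ?thesis by (intro exI[of _ S]) (simp add: S_def)
  qed
  ultimately show ?thesis unfolding decomposes_def by blast
qed

section \<open>Embedding in three stages\<close>

text \<open>Greedy colouring in the order of \<mu>: \<open>N v\<close> contains only earlier
  neighbours, so a list longer than \<open>N v\<close> always has a colour left.\<close>

lemma list_colouring:
  fixes \<mu> :: "'a \<Rightarrow> nat" and L :: "'a \<Rightarrow> nat set"
  assumes L: "\<And>v. v \<in> X \<Longrightarrow> finite (L v)"
    and N: "\<And>v u. v \<in> X \<Longrightarrow> u \<in> N v \<Longrightarrow> u \<in> X \<and> \<mu> u < \<mu> v"
    and card: "\<And>v. v \<in> X \<Longrightarrow> finite (N v) \<and> card (N v) < card (L v)"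
  obtains c where "\<And>v. v \<in> X \<Longrightarrow> c v \<in> L v" "\<And>v u. v \<in> X \<Longrightarrow> u \<in> N v \<Longrightarrow> c u \<noteq> c v"
proof -
  define pick where "pick c v = (SOME k. k \<in> L v - c ` N v)" for c :: "'a \<Rightarrow> nat" and v
  have pick: "pick c v \<in> L v - c ` N v" if "v \<in> X" for c v
  proof -
    have "card (c ` N v) < card (L v)"
      using card[OF that] card_image_le[of "N v" c] by linarith
    hence "\<not> L v \<subseteq> c ` N v" using card[OF that] by (meson card_mono finite_imageI not_le)
    hence "\<exists>k. k \<in> L v - c ` N v" by blast
    thus ?thesis unfolding pick_def by (rule someI_ex)
  qed
  \<comment> \<open>Stage \<open>k\<close> colours all vertices of rank \<open>k\<close> at once,
    which is safe because \<open>N\<close> never joins equal ranks. The start colour 0 of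
    \<open>v\<close> is overwritten in stage \<open>\<mu> v\<close>, before any vertex of greater
    rank looks at it.\<close>
  define cs where "cs = rec_nat (\<lambda>_. 0) (\<lambda>k c v. if \<mu> v = k then pick c v else c v)"
  have cs_Suc: "cs (Suc k) v = (if \<mu> v = k then pick (cs k) v else cs k v)" for k v
    by (simp add: cs_def)
  define c where "c v = cs (Suc (\<mu> v)) v" for v
  have stable: "cs k v = c v" if "k > \<mu> v" for k v
    using that by (induction k) (auto simp: cs_Suc c_def less_Suc_eq)
  have c_pick: "c v = pick (cs (\<mu> v)) v" for v by (simp add: c_def cs_Suc)
  show ?thesis
  proof (rule that)
    show "c v \<in> L v" if "v \<in> X" for v using pick[OF that] by (simp add: c_pick)
    show "c u \<noteq> c v" if "v \<in> X" "u \<in> N v" for v u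
    proof -
      have "cs (\<mu> v) u = c u" using N[OF that] by (intro stable) simp
      thus ?thesis using pick[OF that(1), of "cs (\<mu> v)"] that(2) c_pick[of v] by (metis Diff_iff imageI)
    qed
  qed
qed

lemma finite_sorted_enum:
  fixes \<kappa> :: "'a \<Rightarrow> nat"
  assumes "finite X"
  obtains e where "bij_betw e {..<card X} X" "\<And>i j. i < j \<Longrightarrow> j < card X \<Longrightarrow> \<kappa> (e i) \<le> \<kappa> (e j)"
proof -
  obtain xs where xs: "set xs = X" "distinct xs" using assms finite_distinct_list by blast
  define ys where "ys = sort_key \<kappa> xs"
  have ys: "set ys = X" "distinct ys" "sorted (map \<kappa> ys)" using xs by (auto simp: ys_def)
  have len: "length ys = card X" using ys distinct_card by fastforce
  have "bij_betw ((!) ys) {..<card X} X" using ys len by (intro bij_betw_nth) auto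
  moreover have "\<kappa> (ys ! i) \<le> \<kappa> (ys ! j)" if "i < j" "j < card X" for i j
    using sorted_nth_mono[OF ys(3), of i j] that len by simp
  ultimately show ?thesis using that by blast
qed

text \<open>The depth forces iterated parents to end at \<open>r\<close>, and its parity later
  supplies the bipartition. Only differences of depths are constrained: \<open>d r\<close> may be
  any number, and \<open>par r\<close> is arbitrary.\<close>

locale rooted_tree =
  fixes V :: "'a set" and r :: 'a and par :: "'a \<Rightarrow> 'a" and d :: "'a \<Rightarrow> nat"
  assumes finite_V: "finite V" and root: "r \<in> V"
    and par_in: "v \<in> V - {r} \<Longrightarrow> par v \<in> V"
    and depth: "v \<in> V - {r} \<Longrightarrow> d v = Suc (d (par v))"
begin

definition children :: "'a \<Rightarrow> 'a set" where
  "children v = {u \<in> V - {r}. par u = v}"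

text \<open>Here and in \<open>pendant_set\<close> the root never counts, so both numbers depend on
  the choice of the root. The members of \<open>pendant_set\<close> have degree two: a parent and a
  single child, which is a leaf.\<close>

definition leaf_set :: "'a set" where
  "leaf_set = {v \<in> V - {r}. children v = {}}"

definition pendant_set :: "'a set" where
  "pendant_set = {v \<in> V - {r}. \<exists>x. children v = {x} \<and> children x = {}}"

abbreviation gap :: "('a \<Rightarrow> int) \<Rightarrow> 'a \<Rightarrow> int" where
  "gap f v \<equiv> \<bar>f v - f (par v)\<bar>"

text \<open>Differences are taken over the integers, whereas collisions are judged modulo
  \<open>2 * m + 1\<close>. For a tree with \<open>m\<close> edges and \<open>U = V\<close>, each of
  \<open>1, ..., m\<close> occurs once: one representative of every nonzero residue up to
  sign.\<close>

definition rainbow :: "nat \<Rightarrow> ('a \<Rightarrow> int) \<Rightarrow> 'a set \<Rightarrow> bool" where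
  "rainbow m f U \<longleftrightarrow> gap f ` (U - {r}) \<subseteq> {1..int m} \<and> inj_on (gap f) (U - {r})"

lemma rainbow_extend:
  assumes p: "prime (2 * m + 1)" "m > 0"
    and U: "U \<subseteq> V" "r \<in> U" "\<And>v. v \<in> U - {r} \<Longrightarrow> par v \<in> U" and f: "rainbow m f U"
    and W: "W \<subseteq> V - U" "par ` W \<subseteq> U" and cd: "card U + card W \<le> m + 1"
    and e: "bij_betw e {..<card W} W"
    and F: "\<And>i. i < card W \<Longrightarrow> finite (F i)"
      "\<And>i. i < card W \<Longrightarrow> card (F i) \<le> 2 * (m + 1 - card U - card W) + 1 + i"
  obtains f' where "\<And>v. v \<in> U \<Longrightarrow> f' v = f v" "rainbow m f' (U \<union> W)"
    "\<And>u v. u \<in> W \<Longrightarrow> v \<in> W \<Longrightarrow> u \<noteq> v \<Longrightarrow> \<not> [f' u = f' v] (mod int (2 * m + 1))"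
    "\<And>i u. i < card W \<Longrightarrow> u \<in> F i \<Longrightarrow> \<not> [f' (e i) = u] (mod int (2 * m + 1))"
proof -
  let ?p = "int (2 * m + 1)"
  have pp: "prime ?p" "odd ?p" using p(1) unfolding prime_nat_int_transfer by simp_all
  have finU: "finite U" and finW: "finite W" using U W finite_V finite_subset by blast+
  define C where "C = {1..int m} - gap f ` (U - {r})"
  define S where "S = C \<union> uminus ` C"
  have cU: "card (gap f ` (U - {r})) = card U - 1"
    using f U(2) finU by (simp add: rainbow_def card_image)
  have cU1: "card U \<ge> 1" using U(2) finU by (metis One_nat_def Suc_leI card_gt_0_iff empty_iff)
  have cC: "card C = m + 1 - card U"
    unfolding C_def using f cU cU1 finU by (subst card_Diff_subset) (auto simp: rainbow_def)
  have finC: "finite C" by (simp add: C_def)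
  have C1: "1 \<le> z" "z \<le> int m" if "z \<in> C" for z using that by (auto simp: C_def)
  have cS: "card S = 2 * (m + 1 - card U)"
  proof -
    have "z \<notin> C" if "z \<in> uminus ` C" for z
    proof -
      obtain w where "w \<in> C" "z = - w" using \<open>z \<in> uminus ` C\<close> by blast
      thus ?thesis using C1(1)[of w] C1(1)[of z] by auto
    qed
    hence "C \<inter> uminus ` C = {}" by blast
    moreover have "card (uminus ` C) = card C" by (rule card_image) simp
    ultimately show ?thesis unfolding S_def using finC cC by (subst card_Un_disjoint) auto
  qed
  have S_abs: "\<bar>s\<bar> \<in> C" if "s \<in> S" for s using that C1 by (fastforce simp: S_def)
  have injS: "inj_on (\<lambda>s. s mod ?p) S"
  proof (rule inj_onI)
    fix s t assume st: "s \<in> S" "t \<in> S" "s mod ?p = t mod ?p"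
    show "s = t"
    proof (rule abs_eq_of_dvd[of m])
      show "?p dvd s - t" using st(3) by (simp only: mod_eq_dvd_iff)
      show "\<bar>s\<bar> \<le> int m" "\<bar>t\<bar> \<le> int m" using S_abs C1 st by blast+
    qed
  qed
  obtain x where x: "\<And>i. i < card W \<Longrightarrow> x i \<in> S"
    "\<And>i j. i < card W \<Longrightarrow> j < card W \<Longrightarrow> i \<noteq> j \<Longrightarrow> \<not> [x i ^ 2 = x j ^ 2] (mod ?p)"
    "\<And>i j. i < card W \<Longrightarrow> j < card W \<Longrightarrow> i \<noteq> j \<Longrightarrow> \<not> [f (par (e i)) + x i = f (par (e j)) + x j] (mod ?p)"
    "\<And>i u. i < card W \<Longrightarrow> u \<in> F i \<Longrightarrow> \<not> [f (par (e i)) + x i = u] (mod ?p)"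
  proof -
    have fS: "finite S" using finC by (simp add: S_def)
    have cW: "card W \<le> m + 1 - card U" using cd by simp
    have cF: "card (F i) \<le> 2 * (m + 1 - card U - card W) + 1 + i" if "i < card W" for i
      using F that by auto
    show thesis
      by (rule polynomial_placement[OF pp fS injS cS cW F(1) cF, of "\<lambda>i. f (par (e i))"])
        (assumption, assumption, rule that)
  qed
  define ix where "ix = inv_into {..<card W} e"
  have ix: "ix v < card W" "e (ix v) = v" if "v \<in> W" for v
    using e that by (auto simp: ix_def bij_betw_def f_inv_into_f inv_into_into[of v e "{..<card W}", simplified])
  have ixe: "ix (e i) = i" "e i \<in> W" if "i < card W" for i
    using e that by (auto simp: ix_def bij_betw_def)
  define f' where "f' v = (if v \<in> W then f (par v) + x (ix v) else f v)" for v
  have f'U: "f' v = f v" if "v \<in> U" for v using that W by (auto simp: f'_def)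
  have gapU: "gap f' v = gap f v" if "v \<in> U - {r}" for v using f'U that U(3) by auto
  have gapW: "gap f' v = \<bar>x (ix v)\<bar>" if "v \<in> W" for v
  proof -
    have "f' (par v) = f (par v)" using that W by (intro f'U) auto
    thus ?thesis using that by (simp add: f'_def)
  qed
  have gapW_C: "gap f' v \<in> C" if "v \<in> W" for v using gapW[OF that] S_abs x(1) ix(1)[OF that] by simp
  have "rainbow m f' (U \<union> W)"
    unfolding rainbow_def
  proof
    show "gap f' ` (U \<union> W - {r}) \<subseteq> {1..int m}"
    proof (rule image_subsetI)
      fix v assume v: "v \<in> U \<union> W - {r}"
      show "gap f' v \<in> {1..int m}"
      proof (cases "v \<in> W")
        case True thus ?thesis using gapW_C C1 by force
      next
        case False
        hence "v \<in> U - {r}" using v by auto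
        thus ?thesis using gapU[of v] f unfolding rainbow_def by auto
      qed
    qed
    show "inj_on (gap f') (U \<union> W - {r})"
    proof (rule inj_onI)
      fix u v assume uv: "u \<in> U \<union> W - {r}" "v \<in> U \<union> W - {r}" "gap f' u = gap f' v"
      have mixed: False if "u \<in> W" "v \<in> U - {r}" "gap f' u = gap f' v" for u v
      proof -
        have "gap f' u \<in> gap f ` (U - {r})" using that gapU by auto
        thus False using gapW_C[OF that(1)] by (simp add: C_def)
      qed
      show "u = v"
      proof (cases "u \<in> W"; cases "v \<in> W")
        assume "u \<in> W" "v \<in> W"
        hence "\<bar>x (ix u)\<bar> = \<bar>x (ix v)\<bar>" using uv(3) gapW by simp
        hence "x (ix u) ^ 2 = x (ix v) ^ 2" by (simp add: abs_eq_iff power2_eq_iff)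
        hence "ix u = ix v" using x(2) ix \<open>u \<in> W\<close> \<open>v \<in> W\<close> by (metis cong_refl)
        thus "u = v" using ix \<open>u \<in> W\<close> \<open>v \<in> W\<close> by metis
      next
        assume "u \<notin> W" "v \<notin> W"
        hence "u \<in> U - {r}" "v \<in> U - {r}" using uv by auto
        thus "u = v" using uv(3) gapU f unfolding rainbow_def inj_on_def by metis
      next
        assume "u \<in> W" "v \<notin> W" thus "u = v" using mixed[of u v] uv by blast
      next
        assume "u \<notin> W" "v \<in> W" thus "u = v" using mixed[of v u] uv by (metis Diff_iff UnE)
      qed
    qed
  qed
  moreover have "\<not> [f' u = f' v] (mod ?p)" if "u \<in> W" "v \<in> W" "u \<noteq> v" for u v
    using x(3)[OF ix(1)[OF that(1)] ix(1)[OF that(2)]] that ix(2)[OF that(1)] ix(2)[OF that(2)]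
    by (metis f'_def)
  moreover have "\<not> [f' (e i) = u] (mod ?p)" if "i < card W" "u \<in> F i" for i u
    using x(4)[OF that] ixe[OF that(1)] by (simp add: f'_def)
  ultimately show ?thesis using f'U by (intro that[of f'])
qed

text \<open>Vertices are added singly by \<open>rainbow_extend\<close>. With \<open>k\<close> of
  them placed, the next one can avoid \<open>2 * (m - k) + 1\<close> places, which covers the
  \<open>k\<close> occupied ones as long as \<open>3 * k \<le> 2 * m + 1\<close>. The last step has
  \<open>k = card T - 1\<close>.\<close>

lemma greedy_embedding:
  assumes p: "prime (2 * m + 1)" "m > 0"
    and T: "T \<subseteq> V" "r \<in> T" "\<And>v. v \<in> T - {r} \<Longrightarrow> par v \<in> T" "3 * (card T - 1) \<le> 2 * m + 1"
      "card T \<le> m + 1"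
  obtains f where "rainbow m f T"
    "\<And>u v. u \<in> T \<Longrightarrow> v \<in> T \<Longrightarrow> u \<noteq> v \<Longrightarrow> \<not> [f u = f v] (mod int (2 * m + 1))"
proof -
  let ?p = "int (2 * m + 1)"
  have finT: "finite T" using T(1) finite_V finite_subset by blast
  have "\<exists>U f. U \<subseteq> T \<and> r \<in> U \<and> (\<forall>v\<in>U - {r}. par v \<in> U) \<and> card U = Suc k \<and> rainbow m f U \<and>
      (\<forall>u\<in>U. \<forall>v\<in>U. u \<noteq> v \<longrightarrow> \<not> [f u = f v] (mod ?p))" if "Suc k \<le> card T" for k
    using that
  proof (induction k)
    case 0
    show ?case using T by (intro exI[of _ "{r}"]) (auto simp: rainbow_def)
  next
    case (Suc k)
    then obtain U f where U: "U \<subseteq> T" "r \<in> U" "\<And>v. v \<in> U - {r} \<Longrightarrow> par v \<in> U" "card U = Suc k"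
      and f: "rainbow m f U" "\<And>u v. u \<in> U \<Longrightarrow> v \<in> U \<Longrightarrow> u \<noteq> v \<Longrightarrow> \<not> [f u = f v] (mod ?p)"
      by (metis Suc_leD)
    have finU: "finite U" using U(1) finT finite_subset by blast
    have "T - U \<noteq> {}" using Suc.prems U finT card_mono[of U T] finU by auto
    \<comment> \<open>A missing vertex of least depth has its parent placed already.\<close>
    define v where "v = arg_min_on d (T - U)"
    have v: "v \<in> T - U" "\<And>u. u \<in> T - U \<Longrightarrow> d v \<le> d u"
      unfolding v_def using \<open>T - U \<noteq> {}\<close> finT arg_min_if_finite(1)[of "T - U" d] arg_min_least[of "T - U" _ d]
      by blast+
    have vr: "v \<in> V - {r}" "v \<in> T - {r}" using v(1) U T by auto
    have pv: "par v \<in> U"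
    proof (rule ccontr)
      assume "par v \<notin> U"
      hence "d v \<le> d (par v)" using v(2) T(3)[OF vr(2)] by blast
      thus False using depth[OF vr(1)] by simp
    qed
    have "card {v} = 1" by simp
    have T4: "3 * (Suc k) \<le> 2 * m + 1" using T(4) Suc.prems by simp
    obtain f' where f': "\<And>w. w \<in> U \<Longrightarrow> f' w = f w" "rainbow m f' (U \<union> {v})"
      "\<And>i u. i < card {v} \<Longrightarrow> u \<in> f ` U \<Longrightarrow> \<not> [f' ((\<lambda>_. v) i) = u] (mod ?p)"
    proof (rule rainbow_extend[OF p, of U f "{v}" "\<lambda>_. v" "\<lambda>_. f ` U"])
      show "U \<subseteq> V" "r \<in> U" "rainbow m f U" using U T f by auto
      show "par w \<in> U" if "w \<in> U - {r}" for w using U(3)[OF that] .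
      show "{v} \<subseteq> V - U" "par ` {v} \<subseteq> U" using v vr pv by auto
      show "card U + card {v} \<le> m + 1" using U(4) Suc.prems T(5) by simp
      show "bij_betw (\<lambda>_. v) {..<card {v}} {v}" by (auto simp: bij_betw_def inj_on_def)
      show "finite (f ` U)" using finU by simp
      show "card (f ` U) \<le> 2 * (m + 1 - card U - card {v}) + 1 + i" for i
        using card_image_le[OF finU, of f] U(4) T4 by simp
    qed auto
    have new: "\<not> [f' v = f' u] (mod ?p)" if "u \<in> U" for u
      using f'(3)[of 0 "f u"] f'(1)[OF that] that by auto
    show ?case
    proof (intro exI[of _ "insert v U"] exI[of _ f'] conjI ballI impI)
      show "insert v U \<subseteq> T" "r \<in> insert v U" using v U by auto
      show "par w \<in> insert v U" if "w \<in> insert v U - {r}" for w using that U(3) pv by auto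
      show "card (insert v U) = Suc (Suc k)" using U(4) v finU by simp
      show "rainbow m f' (insert v U)" using f'(2) by simp
      show "\<not> [f' u = f' w] (mod ?p)" if "u \<in> insert v U" "w \<in> insert v U" "u \<noteq> w" for u w
        using that new f'(1) f(2) by (metis cong_sym insertE)
    qed
  qed
  note ex = this[of "card T - 1"]
  have eq: "Suc (card T - 1) = card T" using T(2) finT card_gt_0_iff[of T] by auto
  from ex[unfolded eq, OF order_refl] obtain U f where U: "U \<subseteq> T" "card U = card T" and f: "rainbow m f U"
    "\<forall>u\<in>U. \<forall>v\<in>U. u \<noteq> v \<longrightarrow> \<not> [f u = f v] (mod ?p)"
    by (elim exE conjE) (rule that)
  have "U = T" using U finT by (intro card_subset_eq)
  show ?thesis
  proof (rule that)
    show "rainbow m f T" using f(1) \<open>U = T\<close> by simp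
    show "\<not> [f u = f v] (mod ?p)" if "u \<in> T" "v \<in> T" "u \<noteq> v" for u v
      using f(2) that \<open>U = T\<close> by simp
  qed
qed

text \<open>The budgets dictate the hypotheses. For \<open>G1\<close> the budget is at least
  \<open>2 * card G2 + 1\<close>, enough to avoid all of \<open>T\<close>; the same bound makes
  \<open>T\<close> small enough for the greedy stage. For \<open>G2\<close> no difference is spare
  and the budget shrinks to \<open>1 + i\<close>. Once \<open>G2\<close> is sorted by the values of
  \<nu> at the parents, at most \<open>i\<close> parents precede that of the \<open>i\<close>-th
  vertex.\<close>

lemma staged_embedding:
  fixes \<nu> :: "'a \<Rightarrow> nat"
  assumes p: "prime (2 * m + 1)" "m > 0" and m: "card V = m + 1"
    and T: "r \<in> T" "\<And>v. v \<in> T - {r} \<Longrightarrow> par v \<in> T" "card T \<le> 2 * card G2 + 1"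
    and V: "V = T \<union> G1 \<union> G2" "T \<inter> G1 = {}" "(T \<union> G1) \<inter> G2 = {}"
    and G: "par ` G1 \<subseteq> T" "par ` G2 \<subseteq> T \<union> G1"
    and \<nu>: "inj_on \<nu> (par ` G2)"
  obtains f where "rainbow m f V"
    "\<And>u v. u \<in> T \<union> G1 \<Longrightarrow> v \<in> T \<union> G1 \<Longrightarrow> u \<noteq> v \<Longrightarrow> \<not> [f u = f v] (mod int (2 * m + 1))"
    "\<And>u v. u \<in> G2 \<Longrightarrow> v \<in> G2 \<Longrightarrow> u \<noteq> v \<Longrightarrow> \<not> [f u = f v] (mod int (2 * m + 1))"
    "\<And>x u. x \<in> G2 \<Longrightarrow> u \<in> par ` G2 \<Longrightarrow> \<nu> u < \<nu> (par x) \<Longrightarrow> \<not> [f x = f u] (mod int (2 * m + 1))"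
proof -
  let ?p = "int (2 * m + 1)"
  have fin: "finite T" "finite G1" "finite G2" using V(1) finite_V by auto
  have cV: "card T + card G1 + card G2 = m + 1"
    using m V fin by (simp add: card_Un_disjoint)
  have "3 * (card T - 1) \<le> 2 * m + 1" using T(3) cV by simp
  then obtain f0 where f0: "rainbow m f0 T"
    "\<And>u v. u \<in> T \<Longrightarrow> v \<in> T \<Longrightarrow> u \<noteq> v \<Longrightarrow> \<not> [f0 u = f0 v] (mod ?p)"
    using greedy_embedding[OF p, of T] T V cV by auto
  obtain e1 where e1: "bij_betw e1 {..<card G1} G1" using finite_sorted_enum[OF fin(2)] by blast
  obtain f1 where f1: "\<And>v. v \<in> T \<Longrightarrow> f1 v = f0 v" "rainbow m f1 (T \<union> G1)"
    "\<And>u v. u \<in> G1 \<Longrightarrow> v \<in> G1 \<Longrightarrow> u \<noteq> v \<Longrightarrow> \<not> [f1 u = f1 v] (mod ?p)"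
    "\<And>i u. i < card G1 \<Longrightarrow> u \<in> f0 ` T \<Longrightarrow> \<not> [f1 (e1 i) = u] (mod ?p)"
  proof (rule rainbow_extend[OF p, of T f0 G1 e1 "\<lambda>_. f0 ` T"])
    show "T \<subseteq> V" "r \<in> T" "rainbow m f0 T" "G1 \<subseteq> V - T" "par ` G1 \<subseteq> T" "bij_betw e1 {..<card G1} G1"
      using T V f0 G e1 by auto
    show "par v \<in> T" if "v \<in> T - {r}" for v using T(2)[OF that] .
    show "card T + card G1 \<le> m + 1" using cV by simp
    show "finite (f0 ` T)" using fin by simp
    show "card (f0 ` T) \<le> 2 * (m + 1 - card T - card G1) + 1 + i" for i
      using card_image_le[OF fin(1), of f0] T(3) cV by simp
  qed auto
  have f1TG: "\<not> [f1 u = f1 v] (mod ?p)" if "u \<in> G1" "v \<in> T" for u v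
  proof -
    have "u \<in> e1 ` {..<card G1}" using e1 that(1) by (simp add: bij_betw_def)
    then obtain i where "i < card G1" "u = e1 i" by auto
    thus ?thesis using f1(4)[of i "f0 v"] f1(1)[OF that(2)] that by auto
  qed
  have f1inj: "\<not> [f1 u = f1 v] (mod ?p)" if "u \<in> T \<union> G1" "v \<in> T \<union> G1" "u \<noteq> v" for u v
    using that f1TG f1(3) f0(2) f1(1) cong_sym by (metis UnE)
  obtain e2 where e2: "bij_betw e2 {..<card G2} G2"
    "\<And>i j. i < j \<Longrightarrow> j < card G2 \<Longrightarrow> \<nu> (par (e2 i)) \<le> \<nu> (par (e2 j))"
    using finite_sorted_enum[OF fin(3), of "\<lambda>x. \<nu> (par x)"] by blast
  define F where "F i = f1 ` {u \<in> par ` G2. \<nu> u < \<nu> (par (e2 i))}" for i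
  have finF: "finite (F i)" for i using fin by (simp add: F_def)
  have cF: "card (F i) \<le> i" if "i < card G2" for i
  proof -
    have "{u \<in> par ` G2. \<nu> u < \<nu> (par (e2 i))} \<subseteq> (\<lambda>j. par (e2 j)) ` {..<i}"
    proof safe
      fix x assume x: "x \<in> G2" "\<nu> (par x) < \<nu> (par (e2 i))"
      hence "x \<in> e2 ` {..<card G2}" using e2(1) by (simp add: bij_betw_def)
      then obtain j where j: "j < card G2" "x = e2 j" by auto
      have "j < i"
      proof (rule ccontr)
        assume "\<not> j < i"
        hence "i = j \<or> i < j" by auto
        hence "\<nu> (par (e2 i)) \<le> \<nu> (par (e2 j))" using e2(2)[OF _ j(1)] by blast
        thus False using x(2) j(2) by simp
      qed
      thus "par x \<in> (\<lambda>j. par (e2 j)) ` {..<i}" unfolding j(2) by (intro imageI) simp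
    qed
    from image_mono[OF this, of f1] have "F i \<subseteq> (\<lambda>j. f1 (par (e2 j))) ` {..<i}"
      unfolding F_def image_image .
    hence "card (F i) \<le> card ((\<lambda>j. f1 (par (e2 j))) ` {..<i})" by (intro card_mono) auto
    also have "\<dots> \<le> i" using card_image_le[of "{..<i}" "\<lambda>j. f1 (par (e2 j))"] by simp
    finally show ?thesis .
  qed
  have cTG: "card (T \<union> G1) = card T + card G1" using V fin by (simp add: card_Un_disjoint)
  obtain f2 where f2: "\<And>v. v \<in> T \<union> G1 \<Longrightarrow> f2 v = f1 v" "rainbow m f2 (T \<union> G1 \<union> G2)"
    "\<And>u v. u \<in> G2 \<Longrightarrow> v \<in> G2 \<Longrightarrow> u \<noteq> v \<Longrightarrow> \<not> [f2 u = f2 v] (mod ?p)"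
    "\<And>i u. i < card G2 \<Longrightarrow> u \<in> F i \<Longrightarrow> \<not> [f2 (e2 i) = u] (mod ?p)"
  proof (rule rainbow_extend[OF p, of "T \<union> G1" f1 G2 e2 F])
    show "T \<union> G1 \<subseteq> V" "r \<in> T \<union> G1" "rainbow m f1 (T \<union> G1)" "G2 \<subseteq> V - (T \<union> G1)"
      "par ` G2 \<subseteq> T \<union> G1" "bij_betw e2 {..<card G2} G2"
      using T V f1 G e2 by auto
    show "par v \<in> T \<union> G1" if "v \<in> T \<union> G1 - {r}" for v using T(2)[of v] G(1) that by blast
    show "card (T \<union> G1) + card G2 \<le> m + 1" using cTG cV by simp
    show "finite (F i)" for i by (rule finF)
    show "card (F i) \<le> 2 * (m + 1 - card (T \<union> G1) - card G2) + 1 + i" if "i < card G2" for i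
      using cF[OF that] by simp
  qed auto
  show ?thesis
  proof (rule that)
    show "rainbow m f2 V" using f2(2) V(1) by simp
    show "\<not> [f2 u = f2 v] (mod ?p)" if "u \<in> T \<union> G1" "v \<in> T \<union> G1" "u \<noteq> v" for u v
      using f1inj[OF that] f2(1) that by simp
    show "\<not> [f2 u = f2 v] (mod ?p)" if "u \<in> G2" "v \<in> G2" "u \<noteq> v" for u v using f2(3)[OF that] .
    show "\<not> [f2 x = f2 u] (mod ?p)" if "x \<in> G2" "u \<in> par ` G2" "\<nu> u < \<nu> (par x)" for x u
    proof -
      have "x \<in> e2 ` {..<card G2}" using e2(1) that(1) by (simp add: bij_betw_def)
      then obtain i where i: "i < card G2" "x = e2 i" by auto
      have "f1 u \<in> F i" using that i by (auto simp: F_def)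
      hence "\<not> [f2 x = f1 u] (mod ?p)" using f2(4)[OF i(1)] i by simp
      thus ?thesis using f2(1) that(2) G(2) by auto
    qed
  qed
qed

end

section \<open>Three-colouring the identified graph\<close>

lemma card_le_1I:
  assumes "\<And>a b. a \<in> S \<Longrightarrow> b \<in> S \<Longrightarrow> a = b"
  shows "finite S \<and> card S \<le> 1"
proof (cases "S = {}")
  case False
  then obtain a where "a \<in> S" by blast
  hence "S = {a}" using assms by blast
  thus ?thesis by simp
qed simp

context rooted_tree
begin

text \<open>
  Side \<open>A\<close> (where \<open>\<sigma>\<close> holds) is coloured with 1 and 3 in the order \<open>\<nu>\<close>: a vertex of \<open>A\<close>
  is hit by at most one leaf, which hangs on an earlier source. The sources \<open>b\<close> of the other
  side are coloured last, in reverse order; such a \<open>b\<close> must only avoid the colours of its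
  parent and of the vertex hit by its leaf.
\<close>

lemma base_colouring:
  fixes \<nu> :: "'a \<Rightarrow> nat" and p :: int
  assumes \<sigma>: "\<And>v. v \<in> V - {r} \<Longrightarrow> \<sigma> v \<noteq> \<sigma> (par v)"
    and B: "B \<subseteq> V" "r \<in> B" "\<And>v. v \<in> B - {r} \<Longrightarrow> par v \<in> B"
    and G: "G \<subseteq> V - B" "par ` G \<subseteq> B"
    and src: "\<And>x. x \<in> G \<Longrightarrow> \<not> \<sigma> (par x) \<Longrightarrow> par x \<noteq> r \<and> children (par x) = {x}"
    and \<nu>: "inj_on \<nu> (par ` G)"
      "\<And>x y. x \<in> G \<Longrightarrow> y \<in> G \<Longrightarrow> \<not> \<sigma> (par x) \<Longrightarrow> \<sigma> (par y) \<Longrightarrow> \<nu> (par x) < \<nu> (par y)"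
    and f: "\<And>u v. u \<in> B \<Longrightarrow> v \<in> B \<Longrightarrow> u \<noteq> v \<Longrightarrow> \<not> [f u = f v] (mod p)"
      "\<And>u v. u \<in> G \<Longrightarrow> v \<in> G \<Longrightarrow> u \<noteq> v \<Longrightarrow> \<not> [f u = f v] (mod p)"
      "\<And>x. x \<in> G \<Longrightarrow> \<not> [f x = f (par x)] (mod p)"
      "\<And>x u. x \<in> G \<Longrightarrow> u \<in> par ` G \<Longrightarrow> \<nu> u < \<nu> (par x) \<Longrightarrow> \<not> [f x = f u] (mod p)"
  obtains c where "\<And>v. v \<in> B \<Longrightarrow> c v \<in> {1, 2, 3 :: nat}"
    "\<And>v. v \<in> B - {r} \<Longrightarrow> c v \<noteq> c (par v)"
    "\<And>x u. x \<in> G \<Longrightarrow> u \<in> B \<Longrightarrow> [f x = f u] (mod p) \<Longrightarrow> c u \<noteq> c (par x)"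
proof -
  have finG: "finite G" and finB: "finite B" using G(1) B(1) finite_V finite_subset by blast+
  define K where "K = Suc (Max (insert 0 (\<nu> ` par ` G)))"
  have K: "\<nu> u < K" if "u \<in> par ` G" for u
    unfolding K_def less_Suc_eq_le using finG that by (intro Max_ge) auto
  let ?S = "par ` G"
  \<comment> \<open>Off side \<open>A\<close> only the sources have a choice; the others get colour
    2, which side \<open>A\<close> never uses. The order \<mu> begins with these fixed vertices,
    continues with side \<open>A\<close> along \<nu>, and ends with the remaining sources along
    descending \<nu>. \<open>N\<close> collects the conflicts with vertices of smaller rank.\<close>
  define L where "L v = (if \<sigma> v then {1, 3} else if v \<in> ?S then {1, 2, 3} else {2 :: nat})" for v
  define N where "N v = (if \<sigma> v then {par x |x. x \<in> G \<and> \<sigma> (par x) \<and> [f x = f v] (mod p)}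
      else if v \<in> ?S then {par v} \<union> {u \<in> B. \<exists>x\<in>G. par x = v \<and> [f x = f u] (mod p)} else {})" for v
  define \<mu> where "\<mu> v = (if \<sigma> v then if v \<in> ?S then \<nu> v else K
      else if v \<in> ?S then 2 * K + 1 - \<nu> v else 0)" for v
  \<comment> \<open>A leaf misses its own parent and all earlier sources, so every source that it
    hits comes strictly later in \<nu>.\<close>
  have later: "u \<noteq> par x \<and> (u \<in> ?S \<longrightarrow> \<nu> (par x) < \<nu> u)" if "x \<in> G" "[f x = f u] (mod p)" for x u
  proof -
    have ne: "u \<noteq> par x" using f(3)[OF that(1)] that(2) by blast
    moreover have "\<nu> (par x) < \<nu> u" if u: "u \<in> ?S"
    proof -
      have "\<not> \<nu> u < \<nu> (par x)" using f(4)[OF \<open>x \<in> G\<close> u] \<open>[f x = f u] (mod p)\<close> by blast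
      moreover have "\<nu> u \<noteq> \<nu> (par x)" using \<nu>(1) u ne \<open>x \<in> G\<close> unfolding inj_on_def by blast
      ultimately show ?thesis by simp
    qed
    ultimately show ?thesis by blast
  qed
  have src': "v \<noteq> r \<and> (\<forall>x. x \<in> G \<and> par x = v \<longrightarrow> children v = {x})" if "v \<in> ?S" "\<not> \<sigma> v" for v
  proof -
    obtain y where "y \<in> G" "v = par y" using \<open>v \<in> ?S\<close> by blast
    hence "v \<noteq> r" using src[of y] \<open>\<not> \<sigma> v\<close> by simp
    moreover have "children v = {x}" if "x \<in> G" "par x = v" for x
      using src[of x] that \<open>\<not> \<sigma> v\<close> by simp
    ultimately show ?thesis by blast
  qed
  obtain c where c: "\<And>v. v \<in> B \<Longrightarrow> c v \<in> L v" "\<And>v u. v \<in> B \<Longrightarrow> u \<in> N v \<Longrightarrow> c u \<noteq> c v"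
  proof (rule list_colouring[of B L N \<mu>])
    show "finite (L v)" for v by (simp add: L_def)
    show "u \<in> B \<and> \<mu> u < \<mu> v" if v: "v \<in> B" and u: "u \<in> N v" for v u
    proof (cases "\<sigma> v")
      case True
      then obtain x where x: "x \<in> G" "u = par x" "\<sigma> u" "[f x = f v] (mod p)"
        using u by (auto simp: N_def)
      have "\<nu> u < \<mu> v" using later[OF x(1,4)] K[of u] x(1,2) True by (auto simp: \<mu>_def)
      thus ?thesis using x G(2) by (auto simp: \<mu>_def)
    next
      case False
      hence vS: "v \<in> ?S" using u by (auto simp: N_def split: if_splits)
      have \<mu>v: "\<mu> v = 2 * K + 1 - \<nu> v" "\<nu> v < K" using vS False K by (auto simp: \<mu>_def)
      have vr: "v \<in> V - {r}" "v \<in> B - {r}" using src'[OF vS False] v B(1) by auto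
      consider "u = par v" | x where "u \<in> B" "x \<in> G" "par x = v" "[f x = f u] (mod p)"
        using u False vS by (auto simp: N_def)
      thus ?thesis
      proof cases
        case 1
        hence "\<sigma> u" using \<sigma>[OF vr(1)] False by simp
        hence "\<mu> u \<le> K" using K[of u] by (auto simp: \<mu>_def)
        thus ?thesis using \<mu>v 1 B(3)[OF vr(2)] by simp
      next
        case 2
        have "\<mu> u < \<mu> v"
        proof (cases "u \<in> ?S")
          case True
          hence "\<nu> v < \<nu> u" "\<nu> u < K" using later[OF 2(2,4)] 2(3) K by auto
          thus ?thesis using \<mu>v by (auto simp: \<mu>_def)
        next
          case False
          thus ?thesis using \<mu>v by (auto simp: \<mu>_def)
        qed
        thus ?thesis using 2 by simp
      qed
    qed
    show "finite (N v) \<and> card (N v) < card (L v)" if v: "v \<in> B" for v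
    proof -
      consider "\<sigma> v" | "\<not> \<sigma> v" "v \<in> ?S" | "\<not> \<sigma> v" "v \<notin> ?S" by blast
      thus ?thesis
      proof cases
        case 1
        have "finite {par x |x. x \<in> G \<and> \<sigma> (par x) \<and> [f x = f v] (mod p)} \<and>
            card {par x |x. x \<in> G \<and> \<sigma> (par x) \<and> [f x = f v] (mod p)} \<le> 1"
        proof (rule card_le_1I, clarify)
          fix x y assume "x \<in> G" "y \<in> G" "[f x = f v] (mod p)" "[f y = f v] (mod p)"
          hence "x = y" using f(2)[of x y] cong_trans[of "f x" "f v" p "f y"] cong_sym by blast
          thus "par x = par y" by simp
        qed
        thus ?thesis using 1 by (simp add: N_def L_def)
      next
        case 2
        let ?U = "{u \<in> B. \<exists>x\<in>G. par x = v \<and> [f x = f u] (mod p)}"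
        have U: "finite ?U \<and> card ?U \<le> 1"
        proof (rule card_le_1I)
          fix a b assume "a \<in> ?U" "b \<in> ?U"
          then obtain x y where xy: "x \<in> G" "par x = v" "[f x = f a] (mod p)"
             "y \<in> G" "par y = v" "[f y = f b] (mod p)" "a \<in> B" "b \<in> B" by blast
          have "children v = {x}" "children v = {y}" using src'[OF 2(2,1)] xy by auto
          hence "x = y" by simp
          hence "[f a = f b] (mod p)"
            using cong_trans[OF cong_sym[OF xy(3)], of "f b"] xy(6) by simp
          thus "a = b" using f(1)[of a b] xy(7,8) by blast
        qed
        have "card (insert (par v) ?U) \<le> Suc (card ?U)" by (rule card_insert_le_m1) auto
        hence "card (insert (par v) ?U) < 3" using U by simp
        thus ?thesis using 2 U by (simp add: N_def L_def)
      next
        case 3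
        thus ?thesis by (simp add: N_def L_def)
      qed
    qed
  qed auto
  show ?thesis
  proof (rule that)
    show "c v \<in> {1, 2, 3}" if "v \<in> B" for v
      using c(1)[OF that] by (auto simp: L_def split: if_splits)
    show "c v \<noteq> c (par v)" if v: "v \<in> B - {r}" for v
    proof -
      have vV: "v \<in> V - {r}" and pB: "par v \<in> B" using v B by auto
      have vG: "v \<notin> G" using v G by auto
      show ?thesis
      proof (cases "\<sigma> v")
        case True
        hence np: "\<not> \<sigma> (par v)" using \<sigma>[OF vV] by simp
        \<comment> \<open>The only child of a source off side \<open>A\<close> is its leaf, which
          lies in \<open>G\<close> and not in \<open>B\<close>. So \<open>par v\<close> has the
          fixed colour 2.\<close>
        have "par v \<notin> ?S"
        proof
          assume "par v \<in> ?S"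
          then obtain x where x: "x \<in> G" "par x = par v" by force
          hence "children (par v) = {x}" using src'[of "par v"] np by (metis imageI)
          moreover have "v \<in> children (par v)" using vV by (simp add: children_def)
          ultimately show False using x vG by simp
        qed
        thus ?thesis using c(1)[of v] c(1)[OF pB] v True np by (auto simp: L_def)
      next
        case False
        hence np: "\<sigma> (par v)" using \<sigma>[OF vV] by simp
        show ?thesis
        proof (cases "v \<in> ?S")
          case True
          hence "par v \<in> N v" using False by (simp add: N_def)
          thus ?thesis using c(2) v by fastforce
        next
          case F: False
          thus ?thesis using c(1)[of v] c(1)[OF pB] v False np by (auto simp: L_def)
        qed
      qed
    qed
    show "c u \<noteq> c (par x)" if x: "x \<in> G" and u: "u \<in> B" and xu: "[f x = f u] (mod p)" for x u
    proof -
      have pS: "par x \<in> ?S" and pB: "par x \<in> B" using x G(2) by auto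
      show ?thesis
      proof (cases "\<sigma> (par x)")
        case True
        show ?thesis
        proof (cases "\<sigma> u")
          case True
          hence "par x \<in> N u" using x xu \<open>\<sigma> (par x)\<close> by (auto simp: N_def)
          thus ?thesis using c(2)[OF u] by metis
        next
          case False
          \<comment> \<open>All sources off side \<open>A\<close> precede those on it, hence a leaf
            hanging on side \<open>A\<close> cannot hit one of them. The vertex hit therefore has
            colour 2.\<close>
          have "u \<notin> ?S"
          proof
            assume "u \<in> ?S"
            moreover from this obtain y where "y \<in> G" "u = par y" by blast
            ultimately show False
              using later[OF x xu] \<nu>(2)[of y x] x False True by auto
          qed
          thus ?thesis using c(1)[OF u] c(1)[OF pB] False True by (auto simp: L_def)
        qed
      next
        case False
        hence "u \<in> N (par x)" using pS u x xu by (auto simp: N_def)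
        thus ?thesis using c(2)[OF pB] by metis
      qed
    qed
  qed
qed

text \<open>A vertex of \<open>G2\<close> that hits a vertex placed before takes over its colour,
  with the opposite complement \<open>h\<close>; otherwise it only avoids the colour of its parent.
  Fibres have at most two elements because \<open>T \<union> G1\<close> and \<open>G2\<close> are
  each placed injectively.\<close>

lemma decomposes_of_staging:
  assumes p: "prime (2 * m + 1)" "m > 0" and m: "card V = m + 1"
    and \<sigma>: "\<And>v. v \<in> V - {r} \<Longrightarrow> \<sigma> v \<noteq> \<sigma> (par v)"
    and T: "r \<in> T" "\<And>v. v \<in> T - {r} \<Longrightarrow> par v \<in> T" "card T \<le> 2 * card G2 + 1"
    and V: "V = T \<union> G1 \<union> G2" "T \<inter> G1 = {}" "(T \<union> G1) \<inter> G2 = {}"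
    and G: "par ` G1 \<subseteq> T" "par ` G2 \<subseteq> T \<union> G1"
    and src: "\<And>x. x \<in> G2 \<Longrightarrow> \<not> \<sigma> (par x) \<Longrightarrow> par x \<noteq> r \<and> children (par x) = {x}"
    and M: "perfect_matching (complete_ugraph (4 * m + 2)) M"
  shows "decomposes (parent_graph V r par) (delete_edges (complete_ugraph (4 * m + 2)) M)"
proof -
  let ?p = "int (2 * m + 1)"
  have fin: "finite T" "finite G1" "finite G2" using V(1) finite_V by auto
  obtain \<nu>0 :: "'a \<Rightarrow> nat" where \<nu>0: "inj_on \<nu>0 (par ` G2)" 
    using fin finite_imp_inj_to_nat_seg[of "par ` G2"] by auto
  define K where "K = Suc (Max (insert 0 (\<nu>0 ` par ` G2)))"
  have K: "\<nu>0 u < K" if "u \<in> par ` G2" for u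
    unfolding K_def less_Suc_eq_le using fin that by (intro Max_ge) auto
  \<comment> \<open>The shift by \<open>K\<close> puts the sources where \<sigma> fails before all
    others, as \<open>base_colouring\<close> requires.\<close>
  define \<nu> where "\<nu> u = (if \<sigma> u then K + \<nu>0 u else \<nu>0 u)" for u
  have \<nu>: "inj_on \<nu> (par ` G2)"
  proof (rule inj_onI)
    fix u v assume uv: "u \<in> par ` G2" "v \<in> par ` G2" "\<nu> u = \<nu> v"
    hence "\<nu>0 u = \<nu>0 v" using K[OF uv(1)] K[OF uv(2)] by (auto simp: \<nu>_def split: if_splits)
    thus "u = v" using \<nu>0 uv by (auto dest: inj_onD)
  qed
  have \<nu>2: "\<nu> (par x) < \<nu> (par y)" if "x \<in> G2" "y \<in> G2" "\<not> \<sigma> (par x)" "\<sigma> (par y)" for x y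
    using K[of "par x"] that by (simp add: \<nu>_def)
  let ?B = "T \<union> G1"
  obtain f where f: "rainbow m f V"
    "\<And>u v. u \<in> ?B \<Longrightarrow> v \<in> ?B \<Longrightarrow> u \<noteq> v \<Longrightarrow> \<not> [f u = f v] (mod ?p)"
    "\<And>u v. u \<in> G2 \<Longrightarrow> v \<in> G2 \<Longrightarrow> u \<noteq> v \<Longrightarrow> \<not> [f u = f v] (mod ?p)"
    "\<And>x u. x \<in> G2 \<Longrightarrow> u \<in> par ` G2 \<Longrightarrow> \<nu> u < \<nu> (par x) \<Longrightarrow> \<not> [f x = f u] (mod ?p)"
    by (rule staged_embedding[OF p m T V G \<nu>]) (assumption, rule that)
  have cls: "gap f v \<in> {1..int m}" if "v \<in> V - {r}" for v
    using f(1) that by (auto simp: rainbow_def)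
  have parne: "\<not> [f v = f (par v)] (mod ?p)" if "v \<in> V - {r}" for v
  proof
    assume "[f v = f (par v)] (mod ?p)"
    hence "?p dvd (f v - f (par v)) - 0" by (simp only: cong_iff_dvd_diff diff_0_right)
    hence "f v - f (par v) = 0" using cls[OF that] by (intro abs_eq_of_dvd) auto
    thus False using cls[OF that] by simp
  qed
  have G2r: "x \<in> V - {r}" if "x \<in> G2" for x using that V T by auto
  obtain c0 where c0: "\<And>v. v \<in> ?B \<Longrightarrow> c0 v \<in> {1, 2, 3 :: nat}"
    "\<And>v. v \<in> ?B - {r} \<Longrightarrow> c0 v \<noteq> c0 (par v)"
    "\<And>x u. x \<in> G2 \<Longrightarrow> u \<in> ?B \<Longrightarrow> [f x = f u] (mod ?p) \<Longrightarrow> c0 u \<noteq> c0 (par x)"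
  proof (rule base_colouring[of \<sigma> ?B G2 \<nu> f ?p])
    show "?B \<subseteq> V" "r \<in> ?B" "G2 \<subseteq> V - ?B" "par ` G2 \<subseteq> ?B" using V T G by auto
    show "par v \<in> ?B" if "v \<in> ?B - {r}" for v using T(2)[of v] G(1) that by blast
    show "\<sigma> v \<noteq> \<sigma> (par v)" if "v \<in> V - {r}" for v using \<sigma>[OF that] .
    show "par x \<noteq> r \<and> children (par x) = {x}" if "x \<in> G2" "\<not> \<sigma> (par x)" for x using src[OF that] .
    show "inj_on \<nu> (par ` G2)" by (rule \<nu>)
    show "\<nu> (par x) < \<nu> (par y)" if "x \<in> G2" "y \<in> G2" "\<not> \<sigma> (par x)" "\<sigma> (par y)" for x y using \<nu>2[OF that] .
    show "\<not> [f u = f v] (mod ?p)" if "u \<in> ?B" "v \<in> ?B" "u \<noteq> v" for u v using f(2)[OF that] .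
    show "\<not> [f u = f v] (mod ?p)" if "u \<in> G2" "v \<in> G2" "u \<noteq> v" for u v using f(3)[OF that] .
    show "\<not> [f x = f (par x)] (mod ?p)" if "x \<in> G2" for x using parne[OF G2r[OF that]] .
    show "\<not> [f x = f u] (mod ?p)" if "x \<in> G2" "u \<in> par ` G2" "\<nu> u < \<nu> (par x)" for x u using f(4)[OF that] .
  qed (rule that)
  define hit where "hit x u \<longleftrightarrow> u \<in> ?B \<and> [f x = f u] (mod ?p)" for x u
  define h where "h v \<longleftrightarrow> v \<in> G2 \<and> (\<exists>u. hit v u)" for v
  define c where "c v = (if v \<in> ?B then c0 v else if \<exists>u. hit v u then c0 (SOME u. hit v u)
      else if c0 (par v) = 1 then 2 else 1)" for v
  have c_hit: "c x = c0 u" if "x \<in> G2" "hit x u" for x u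
  proof -
    have "hit x (SOME u. hit x u)" using that(2) by (rule someI)
    hence u': "(SOME u. hit x u) \<in> ?B" "[f x = f (SOME u. hit x u)] (mod ?p)"
      unfolding hit_def by blast+
    have "u \<in> ?B" "[f x = f u] (mod ?p)" using that(2) unfolding hit_def by blast+
    hence "(SOME u. hit x u) = u"
      using f(2)[OF u'(1), of u] cong_trans[OF cong_sym[OF u'(2)], of "f u"] by blast
    moreover have "x \<notin> ?B" using that V by auto
    ultimately show ?thesis using that(2) by (auto simp: c_def)
  qed
  have cG2: "c x \<in> {1, 2, 3} \<and> c x \<noteq> c0 (par x)" if "x \<in> G2" for x
  proof (cases "\<exists>u. hit x u")
    case True
    then obtain u where u: "hit x u" by blast
    thus ?thesis using c_hit[OF that u] c0(1)[of u] c0(3)[OF that, of u] by (simp add: hit_def)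
  next
    case False
    have "x \<notin> ?B" using that V by auto
    thus ?thesis using False by (auto simp: c_def)
  qed
  show ?thesis
  proof (rule decomposes_of_lift[where f = f and c = c and h = h])
    show "finite V" "r \<in> V" "card V = m + 1" "m > 0" using finite_V root m p by auto
    show "par v \<in> V" if "v \<in> V - {r}" for v using par_in[OF that] .
    show "gap f v \<in> {1..int m}" if "v \<in> V - {r}" for v using cls[OF that] .
    show "inj_on (gap f) (V - {r})" using f(1) by (simp add: rainbow_def)
    show "c v \<in> {1, 2, 3}" if "v \<in> V" for v
    proof (cases "v \<in> ?B")
      case True thus ?thesis using c0(1)[OF True] by (simp add: c_def)
    next
      case False thus ?thesis using cG2 that V by blast
    qed
    show "c v \<noteq> c (par v)" if v: "v \<in> V - {r}" for v
    proof -
      have "par v \<in> ?B" using v V(1) T(2)[of v] G by blast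
      hence pc: "c (par v) = c0 (par v)" by (simp add: c_def)
      show ?thesis
      proof (cases "v \<in> ?B")
        case True thus ?thesis using c0(2)[of v] v pc by (simp add: c_def)
      next
        case False thus ?thesis using cG2[of v] v V pc by auto
      qed
    qed
    show "c u = c v \<and> h u \<noteq> h v" if uv: "u \<in> V" "v \<in> V" "u \<noteq> v" "[f u = f v] (mod ?p)" for u v
    proof -
      have mixed: "c x = c u \<and> h x \<noteq> h u" if "x \<in> G2" "u \<in> ?B" "[f x = f u] (mod ?p)" for x u
      proof -
        have "hit x u" using that by (simp add: hit_def)
        hence "c x = c u" "h x" using c_hit that by (auto simp: c_def h_def)
        moreover have "\<not> h u" using that V(3) by (auto simp: h_def)
        ultimately show ?thesis by simp
      qed
      consider "u \<in> ?B" "v \<in> ?B" | "u \<in> G2" "v \<in> G2" | "u \<in> G2" "v \<in> ?B" | "v \<in> G2" "u \<in> ?B"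
        using uv V(1) by blast
      thus ?thesis
      proof cases
        case 1 thus ?thesis using f(2)[of u v] uv by blast
      next
        case 2 thus ?thesis using f(3)[of u v] uv by blast
      next
        case 3 thus ?thesis using mixed[of u v] uv by blast
      next
        case 4 thus ?thesis using mixed[of v u] cong_sym[OF uv(4)] by simp
      qed
    qed
    show "perfect_matching (complete_ugraph (4 * m + 2)) M" by (rule M)
  qed
qed

text \<open>Let \<open>L = card leaf_set + card pendant_set\<close>. A leaf below a vertex of
  \<open>pendant_set\<close> belongs to \<open>G2\<close> for both sides of the bipartition, any
  other leaf for exactly one. So the two candidates for \<open>G2\<close> have \<open>L\<close>
  elements together, and the larger satisfies \<open>2 * card G2 \<ge> L\<close>. As
  \<open>card T = m + 1 - L\<close>, the bound \<open>card T \<le> 2 * card G2 + 1\<close> follows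
  from \<open>m \<le> 2 * L\<close>.\<close>

theorem decomposes_if_many_leaves:
  assumes p: "prime (2 * m + 1)" "m > 0" and m: "card V = m + 1"
    and many: "m \<le> 2 * (card leaf_set + card pendant_set)"
    and M: "perfect_matching (complete_ugraph (4 * m + 2)) M"
  shows "decomposes (parent_graph V r par) (delete_edges (complete_ugraph (4 * m + 2)) M)"
proof -
  define T where "T = V - leaf_set - pendant_set"
  define G2 where "G2 \<sigma> = {x \<in> leaf_set. \<sigma> (par x) \<or> par x \<in> pendant_set}" for \<sigma>
  define G1 where "G1 \<sigma> = pendant_set \<union> (leaf_set - G2 \<sigma>)" for \<sigma>
  define \<sigma> where "\<sigma> v = even (d v)" for v
  have sub: "leaf_set \<subseteq> V - {r}" "pendant_set \<subseteq> V - {r}" "leaf_set \<inter> pendant_set = {}"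
    by (auto simp: leaf_set_def pendant_set_def)
  have fin: "finite leaf_set" "finite pendant_set" using sub finite_V finite_subset by blast+
  have ch: "v \<in> children (par v)" if "v \<in> V - {r}" for v using that by (simp add: children_def)
  have par_leaf: "par v \<notin> leaf_set" if "v \<in> V - {r}" for v using ch[OF that] by (auto simp: leaf_set_def)
  have par_pend: "v \<in> leaf_set \<and> children (par v) = {v}" if "v \<in> V - {r}" "par v \<in> pendant_set" for v
    using ch[OF that(1)] that by (auto simp: leaf_set_def pendant_set_def)
  have T: "r \<in> T" using sub root by (auto simp: T_def)
  have parT: "par v \<in> T" if "v \<in> T - {r}" for v
    using that par_in[of v] par_leaf[of v] par_pend[of v] by (auto simp: T_def)
  have parP: "par v \<in> T" if "v \<in> pendant_set" for v
  proof -
    have "v \<in> V - {r}" using that sub by blast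
    thus ?thesis using that par_in[of v] par_leaf[of v] par_pend[of v] sub(3) by (auto simp: T_def)
  qed
  have cT: "card T + card leaf_set + card pendant_set = m + 1"
  proof -
    have "V = T \<union> leaf_set \<union> pendant_set" using sub by (auto simp: T_def)
    moreover have "card (T \<union> leaf_set \<union> pendant_set) = card T + card leaf_set + card pendant_set"
    proof -
      have "finite T" "T \<inter> leaf_set = {}" "(T \<union> leaf_set) \<inter> pendant_set = {}"
        using finite_V sub(3) by (auto simp: T_def)
      thus ?thesis using fin by (simp add: card_Un_disjoint)
    qed
    ultimately show ?thesis using m by simp
  qed
  have main: "decomposes (parent_graph V r par) (delete_edges (complete_ugraph (4 * m + 2)) M)"
    if alt: "\<And>v. v \<in> V - {r} \<Longrightarrow> \<sigma> v \<noteq> \<sigma> (par v)" and le: "card T \<le> 2 * card (G2 \<sigma>) + 1" for \<sigma>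
  proof (rule decomposes_of_staging[where \<sigma> = \<sigma> and T = T and ?G1.0 = "G1 \<sigma>" and ?G2.0 = "G2 \<sigma>"])
    show "prime (2 * m + 1)" "m > 0" "card V = m + 1" "r \<in> T" "card T \<le> 2 * card (G2 \<sigma>) + 1"
      "perfect_matching (complete_ugraph (4 * m + 2)) M" by fact+
    show "\<sigma> v \<noteq> \<sigma> (par v)" if "v \<in> V - {r}" for v using alt[OF that] .
    show "par v \<in> T" if "v \<in> T - {r}" for v using parT[OF that] .
    show "V = T \<union> G1 \<sigma> \<union> G2 \<sigma>" using sub by (auto simp: T_def G1_def G2_def)
    show "T \<inter> G1 \<sigma> = {}" "(T \<union> G1 \<sigma>) \<inter> G2 \<sigma> = {}" using sub by (auto simp: T_def G1_def G2_def)
    show "par ` G1 \<sigma> \<subseteq> T"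
    proof safe
      fix v assume v: "v \<in> G1 \<sigma>"
      show "par v \<in> T"
      proof (cases "v \<in> pendant_set")
        case True thus ?thesis by (rule parP)
      next
        case False
        hence "v \<in> leaf_set" "par v \<notin> pendant_set" using v by (auto simp: G1_def G2_def)
        thus ?thesis using sub par_in[of v] par_leaf[of v] by (auto simp: T_def)
      qed
    qed
    show "par ` G2 \<sigma> \<subseteq> T \<union> G1 \<sigma>"
    proof (rule image_subsetI)
      fix v assume "v \<in> G2 \<sigma>"
      hence "v \<in> V - {r}" using sub by (auto simp: G2_def)
      hence "par v \<in> V" "par v \<notin> leaf_set" using par_in par_leaf by blast+
      thus "par v \<in> T \<union> G1 \<sigma>" by (auto simp: T_def G1_def)
    qed
    show "par x \<noteq> r \<and> children (par x) = {x}" if "x \<in> G2 \<sigma>" "\<not> \<sigma> (par x)" for x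
      using that sub par_pend[of x] by (auto simp: G2_def)
  qed
  have cP: "card {x \<in> leaf_set. par x \<in> pendant_set} = card pendant_set"
  proof (rule bij_betw_same_card[of par])
    show "bij_betw par {x \<in> leaf_set. par x \<in> pendant_set} pendant_set"
      unfolding bij_betw_def
    proof
      show "inj_on par {x \<in> leaf_set. par x \<in> pendant_set}"
      proof (rule inj_onI)
        fix x y assume xy: "x \<in> {x \<in> leaf_set. par x \<in> pendant_set}" "y \<in> {x \<in> leaf_set. par x \<in> pendant_set}"
          "par x = par y"
        hence "x \<in> V - {r}" "y \<in> V - {r}" using sub by auto
        hence "children (par x) = {x}" "children (par x) = {y}"
          using par_pend[of x] par_pend[of y] xy by auto
        thus "x = y" by simp
      qed
      show "par ` {x \<in> leaf_set. par x \<in> pendant_set} = pendant_set"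
      proof safe
        fix v assume v: "v \<in> pendant_set"
        then obtain x where x: "children v = {x}" "children x = {}" by (auto simp: pendant_set_def)
        hence "x \<in> V - {r}" "par x = v" by (auto simp: children_def)
        thus "v \<in> par ` {x \<in> leaf_set. par x \<in> pendant_set}"
          using v x by (intro image_eqI[of _ _ x]) (auto simp: leaf_set_def)
      qed
    qed
  qed
  have fG: "finite (G2 \<sigma>)" for \<sigma> using fin by (simp add: G2_def)
  have "card (G2 \<sigma>) + card (G2 (\<lambda>v. \<not> \<sigma> v)) = card (G2 \<sigma> \<union> G2 (\<lambda>v. \<not> \<sigma> v)) + card (G2 \<sigma> \<inter> G2 (\<lambda>v. \<not> \<sigma> v))"
    by (rule card_Un_Int[OF fG fG])
  also have "G2 \<sigma> \<union> G2 (\<lambda>v. \<not> \<sigma> v) = leaf_set" by (auto simp: G2_def)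
  also have "G2 \<sigma> \<inter> G2 (\<lambda>v. \<not> \<sigma> v) = {x \<in> leaf_set. par x \<in> pendant_set}" by (auto simp: G2_def)
  finally have "card (G2 \<sigma>) + card (G2 (\<lambda>v. \<not> \<sigma> v)) = card leaf_set + card pendant_set"
    using cP by simp
  hence "card T \<le> 2 * card (G2 \<sigma>) + 1 \<or> card T \<le> 2 * card (G2 (\<lambda>v. \<not> \<sigma> v)) + 1"
  proof -
    have half: "t \<le> 2 * b + 1"
      if "a \<le> b" "a + b = l + q" "t + l + q = m + 1" "m \<le> 2 * (l + q)" for a b l q t m :: nat
    proof -
      have "t \<le> l + q + 1" using that by simp
      thus ?thesis using that by simp
    qed
    have "t \<le> 2 * a + 1 \<or> t \<le> 2 * b + 1"
      if "a + b = l + q" "t + l + q = m + 1" "m \<le> 2 * (l + q)" for a b l q t m :: nat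
      using half[of a b l q t m] half[of b a l q t m] that by (simp add: add.commute) linarith
    thus ?thesis
      using \<open>card (G2 \<sigma>) + card (G2 (\<lambda>v. \<not> \<sigma> v)) = card leaf_set + card pendant_set\<close> cT many by blast
  qed
  moreover have "\<sigma> v \<noteq> \<sigma> (par v)" if "v \<in> V - {r}" for v
    using depth[OF that] by (simp add: \<sigma>_def)
  ultimately show ?thesis using main[of \<sigma>] main[of "\<lambda>v. \<not> \<sigma> v"] by blast
qed

end

section \<open>The generating function of rooted trees\<close>

text \<open>The Euler product for multisets: splitting off the multiplicity of a new element
  contributes a geometric series.\<close>

lemma has_sum_multisets:
  fixes w :: "'a \<Rightarrow> real"
  assumes "finite A" "\<And>a. a \<in> A \<Longrightarrow> 0 \<le> w a" "\<And>a. a \<in> A \<Longrightarrow> w a < 1"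
  shows "((\<lambda>M. \<Prod>t\<in>#M. w t) has_sum (\<Prod>a\<in>A. 1 / (1 - w a))) {M. set_mset M \<subseteq> A}"
  using assms
proof (induction A rule: finite_induct)
  case empty
  have "{M :: 'a multiset. set_mset M \<subseteq> {}} = {{#}}" by auto
  thus ?case using has_sum_finite[of "{{#}}" "\<lambda>M. \<Prod>t\<in>#M. w t"] by simp
next
  case (insert a B)
  let ?S = "{M :: 'a multiset. set_mset M \<subseteq> B}"
  let ?P = "\<Prod>a\<in>B. 1 / (1 - w a)"
  let ?f = "\<lambda>M. \<Prod>t\<in>#M. w t"
  define g where "g = (\<lambda>(k, M). replicate_mset k a + M)"
  have nonneg: "0 \<le> ?f M" if "set_mset M \<subseteq> insert a B" for M
    using that insert.prems(1) by (induction M) auto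
  have IH: "(?f has_sum ?P) ?S" using insert by simp
  have fg: "?f (g (k, M)) = w a ^ k * ?f M" for k M
    by (simp add: g_def)
  have inner: "((\<lambda>M. ?f (g (k, M))) has_sum (w a ^ k * ?P)) ?S" for k
    unfolding fg by (rule has_sum_cmult_right[OF IH])
  have geo: "((\<lambda>k. w a ^ k) has_sum (1 / (1 - w a))) UNIV"
    by (rule sums_nonneg_imp_has_sum) (use insert.prems geometric_sums[of "w a"] in auto)
  have outer: "((\<lambda>k. w a ^ k * ?P) has_sum (1 / (1 - w a) * ?P)) UNIV"
    by (rule has_sum_cmult_left[OF geo])
  have "((\<lambda>z. ?f (g z)) has_sum (1 / (1 - w a) * ?P)) (UNIV \<times> ?S)"
  proof (rule has_sum_SigmaI)
    show "((\<lambda>M. ?f (g (k, M))) has_sum (w a ^ k * ?P)) ?S" for k by (rule inner)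
    show "((\<lambda>k. w a ^ k * ?P) has_sum (1 / (1 - w a) * ?P)) UNIV" by (rule outer)
    show "(\<lambda>z. ?f (g z)) summable_on UNIV \<times> ?S"
    proof (rule summable_on_SigmaI)
      show "((\<lambda>M. ?f (g (k, M))) has_sum (w a ^ k * ?P)) ?S" for k by (rule inner)
      show "(\<lambda>k. w a ^ k * ?P) summable_on UNIV" using outer by (auto simp: summable_on_def)
      show "0 \<le> ?f (g (k, M))" if "M \<in> ?S" for k M
        by (rule nonneg) (use that in \<open>auto simp: g_def\<close>)
    qed
  qed
  also have "((\<lambda>z. ?f (g z)) has_sum (1 / (1 - w a) * ?P)) (UNIV \<times> ?S) \<longleftrightarrow>
      (?f has_sum (1 / (1 - w a) * ?P)) {M. set_mset M \<subseteq> insert a B}"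
  proof (rule has_sum_reindex_bij_betw)
    show "bij_betw g (UNIV \<times> ?S) {M. set_mset M \<subseteq> insert a B}"
    proof (rule bij_betwI[where g = "\<lambda>M. (count M a, filter_mset (\<lambda>t. t \<noteq> a) M)"])
      show "g \<in> UNIV \<times> ?S \<rightarrow> {M. set_mset M \<subseteq> insert a B}"
        by (auto simp: g_def in_replicate_mset split: if_splits)
      show "(\<lambda>M. (count M a, filter_mset (\<lambda>t. t \<noteq> a) M)) \<in> {M. set_mset M \<subseteq> insert a B} \<rightarrow> UNIV \<times> ?S"
        by auto
      show "(count (g z) a, filter_mset (\<lambda>t. t \<noteq> a) (g z)) = z" if "z \<in> UNIV \<times> ?S" for z
      proof -
        obtain k M where z: "z = (k, M)" by (cases z)
        hence "set_mset M \<subseteq> B" using that by simp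
        hence aM: "a \<notin># M" using insert.hyps by auto
        hence "filter_mset (\<lambda>t. t \<noteq> a) M = M" by (auto simp: filter_mset_eq_conv)
        thus ?thesis using aM by (simp add: z g_def count_eq_zero_iff)
      qed
      show "g (count M a, filter_mset (\<lambda>t. t \<noteq> a) M) = M" for M
        by (rule multiset_eqI) (auto simp: g_def)
    qed
  qed
  finally show ?case using insert.hyps by simp
qed

lemma finite_multisets_bounded:
  assumes "finite A"
  shows "finite {M. set_mset M \<subseteq> A \<and> size M \<le> n}"
proof (rule finite_surj[where f = mset])
  show "finite {xs. set xs \<subseteq> A \<and> length xs \<le> n}" by (rule finite_lists_length_le[OF assms])
  show "{M. set_mset M \<subseteq> A \<and> size M \<le> n} \<subseteq> mset ` {xs. set xs \<subseteq> A \<and> length xs \<le> n}"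
  proof
    fix M assume M: "M \<in> {M. set_mset M \<subseteq> A \<and> size M \<le> n}"
    obtain xs where "mset xs = M" using ex_mset by blast
    thus "M \<in> mset ` {xs. set xs \<subseteq> A \<and> length xs \<le> n}" using M by (intro image_eqI[of _ _ xs]) auto
  qed
qed

section \<open>Rooted trees as nested multisets\<close>

datatype rtree = Node "rtree multiset"

abbreviation leaf :: rtree where "leaf \<equiv> Node {#}"

primrec nodes :: "rtree \<Rightarrow> nat" where
  "nodes (Node M) = Suc (\<Sum>k\<in>#image_mset nodes M. k)"

text \<open>Counts the nodes without children and the nodes whose only child is such a node. Unlike
  in \<open>leaf_set\<close> and \<open>pendant_set\<close> the root counts too; from three nodes on
  this makes no difference, by \<open>tips_code\<close>.\<close>

primrec tips :: "rtree \<Rightarrow> nat" where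
  "tips (Node M) = (if M = {#} then 1 else (if M = {#leaf#} then 1 else 0) + (\<Sum>k\<in>#image_mset tips M. k))"

lemma nodes_Node: "nodes (Node M) = Suc (\<Sum>t\<in>#M. nodes t)"
  by simp

lemma nodes_pos: "nodes t > 0" by (cases t) simp

lemma nodes_le_sum: "t \<in># M \<Longrightarrow> nodes t \<le> (\<Sum>t\<in>#M. nodes t)"
  by (induction M) auto

lemma size_le_sum_nodes: "size M \<le> (\<Sum>t\<in>#M. nodes t)"
proof (induction M)
  case (add t M)
  thus ?case using nodes_pos[of t] by simp
qed simp

definition rtrees_le :: "nat \<Rightarrow> rtree set" where
  "rtrees_le n = {t. nodes t \<le> n}"

definition rtrees :: "nat \<Rightarrow> rtree set" where
  "rtrees n = {t. nodes t = n}"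

lemma rtrees_le_Suc:
  "rtrees_le (Suc n) \<subseteq> Node ` {M. set_mset M \<subseteq> rtrees_le n \<and> size M \<le> n}"
proof
  fix t assume t: "t \<in> rtrees_le (Suc n)"
  obtain M where M: "t = Node M" by (cases t)
  have "(\<Sum>t\<in>#M. nodes t) \<le> n" using t by (simp add: M rtrees_le_def)
  thus "t \<in> Node ` {M. set_mset M \<subseteq> rtrees_le n \<and> size M \<le> n}"
    using size_le_sum_nodes[of M] nodes_le_sum[of _ M] unfolding M rtrees_le_def
    by (intro imageI) (auto intro: order.trans)
qed

lemma rtrees_le_0: "rtrees_le 0 = {}"
  using nodes_pos by (auto simp: rtrees_le_def)

lemma finite_rtrees_le: "finite (rtrees_le n)"
proof (induction n)
  case (Suc n)
  show ?case
    by (rule finite_subset[OF rtrees_le_Suc]) (intro finite_imageI finite_multisets_bounded Suc)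
qed (simp add: rtrees_le_0)

lemma finite_rtrees: "finite (rtrees n)"
  by (rule finite_subset[OF _ finite_rtrees_le[of n]]) (auto simp: rtrees_def rtrees_le_def)

lemma rtrees_le_mono: "m \<le> n \<Longrightarrow> rtrees_le m \<subseteq> rtrees_le n"
  by (auto simp: rtrees_le_def)

definition weight :: "real \<Rightarrow> real \<Rightarrow> rtree \<Rightarrow> real" where
  "weight x z t = x ^ nodes t * z ^ tips t"

definition gf :: "nat \<Rightarrow> real \<Rightarrow> real \<Rightarrow> real" where
  "gf n x z = (\<Sum>t\<in>rtrees_le n. weight x z t)"

lemma weight_power: "weight x z t ^ k = weight (x ^ k) (z ^ k) t"
  by (simp add: weight_def power_mult_distrib power_mult[symmetric] mult.commute)

lemma tips_pos: "tips t > 0"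
proof (induction t)
  case (Node M)
  show ?case
  proof (cases "M = {#}")
    case False
    then obtain t N where "M = add_mset t N" by (metis multiset_cases)
    thus ?thesis using Node[of t] by simp
  qed simp
qed

lemma weight_nonneg: "x \<ge> 0 \<Longrightarrow> z \<ge> 0 \<Longrightarrow> weight x z t \<ge> 0"
  by (simp add: weight_def)

lemma weight_le:
  assumes "0 \<le> x" "x \<le> 1" "0 \<le> z" "z \<le> 1"
  shows "weight x z t \<le> x * z"
proof -
  have "x ^ nodes t \<le> x ^ 1" "z ^ tips t \<le> z ^ 1"
    using assms nodes_pos[of t] tips_pos[of t] by (intro power_decreasing; simp)+
  thus ?thesis unfolding weight_def using assms by (intro mult_mono) auto
qed

lemma prod_mset_weight: "(\<Prod>t\<in>#M. weight x z t) = x ^ (\<Sum>t\<in>#M. nodes t) * z ^ (\<Sum>t\<in>#M. tips t)"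
  by (induction M) (auto simp: weight_def power_add)

text \<open>The weight is \<open>x\<close> times the product over the children up to two
  corrections: \<open>leaf\<close> has a factor \<open>z\<close> that the empty product lacks, and
  the two-node path has a second one for its root.\<close>

lemma weight_Node:
  "weight x z (Node M) = x * (\<Prod>t\<in>#M. weight x z t)
     + (if M = {#} then x * (z - 1) else 0) + (if M = {#leaf#} then x\<^sup>2 * z * (z - 1) else 0)"
  by (subst prod_mset_weight) (simp add: weight_def algebra_simps power2_eq_square)

lemma gf_mono: "x \<ge> 0 \<Longrightarrow> z \<ge> 0 \<Longrightarrow> m \<le> n \<Longrightarrow> gf m x z \<le> gf n x z"
  unfolding gf_def by (intro sum_mono2 finite_rtrees_le rtrees_le_mono weight_nonneg)

lemma gf_1: "gf (Suc 0) x z = x * z"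
proof -
  have "rtrees_le (Suc 0) = {leaf}"
  proof
    show "rtrees_le (Suc 0) \<subseteq> {leaf}" using rtrees_le_Suc[of 0] by (auto simp: rtrees_le_0)
  qed (simp add: rtrees_le_def)
  thus ?thesis by (simp add: gf_def weight_def)
qed

text \<open>The children form a multiset of smaller trees; forgetting the bound on their total size
  leaves the Euler product. Since \<open>n \<ge> 1\<close>, the two-node path is among the trees, so
  its correction, which lowers the bound, is present.\<close>

lemma gf_Suc_le:
  assumes x: "0 \<le> x" "x < 1" and z: "0 \<le> z" "z \<le> 1" and n: "n \<ge> 1"
  shows "gf (Suc n) x z \<le> x * ((\<Prod>t\<in>rtrees_le n. 1 / (1 - weight x z t)) - 1) + x * z + x\<^sup>2 * z * (z - 1)"
proof -
  let ?S = "{M. (\<Sum>t\<in>#M. nodes t) \<le> n}"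
  have S: "rtrees_le (Suc n) = Node ` ?S"
  proof -
    have "t \<in> Node ` ?S" if "nodes t \<le> Suc n" for t using that by (cases t) auto
    thus ?thesis by (auto simp: rtrees_le_def)
  qed
  have inj: "inj_on Node ?S" by (auto simp: inj_on_def)
  have finS: "finite ?S" using finite_rtrees_le[of "Suc n"] unfolding S by (rule finite_imageD[OF _ inj])
  have sub: "?S \<subseteq> {M. set_mset M \<subseteq> rtrees_le n}"
    using nodes_le_sum by (auto simp: rtrees_le_def intro: order.trans)
  have w: "0 \<le> weight x z t" "weight x z t < 1" for t
  proof -
    show "0 \<le> weight x z t" using x z by (intro weight_nonneg) auto
    have "weight x z t \<le> x * z" using x z by (intro weight_le) auto
    also have "\<dots> \<le> x" using x z by (simp add: mult_left_le)
    finally show "weight x z t < 1" using x by simp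
  qed
  have "gf (Suc n) x z = (\<Sum>M\<in>?S. weight x z (Node M))"
    unfolding gf_def S by (subst sum.reindex[OF inj]) simp
  also have "\<dots> = x * (\<Sum>M\<in>?S. \<Prod>t\<in>#M. weight x z t) + x * (z - 1) + x\<^sup>2 * z * (z - 1)"
    unfolding weight_Node sum.distrib using finS n
    by (simp add: sum_distrib_left sum.delta)
  finally have eq: "gf (Suc n) x z = x * (\<Sum>M\<in>?S. \<Prod>t\<in>#M. weight x z t) + x * (z - 1) + x\<^sup>2 * z * (z - 1)" .
  have "(\<Sum>M\<in>?S. \<Prod>t\<in>#M. weight x z t) \<le> (\<Prod>t\<in>rtrees_le n. 1 / (1 - weight x z t))"
  proof (rule finite_sum_le_has_sum[OF has_sum_multisets finS sub])
    show "finite (rtrees_le n)" by (rule finite_rtrees_le)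
    show "0 \<le> (\<Prod>t\<in>#M. weight x z t)" for M
      using w(1) by (induction M) auto
  qed (use w in auto)
  from mult_left_mono[OF this x(1)] show ?thesis unfolding eq by (simp add: algebra_simps)
qed

lemma neg_ln_one_minus_le:
  fixes w b :: real
  assumes "0 \<le> w" "w \<le> b" "b < 1"
  shows "- ln (1 - w) \<le> w + w ^ 2 / 2 + w ^ 3 / 3 + w ^ 4 / (4 * (1 - b))"
proof -
  let ?g = "\<lambda>w. w + w ^ 2 / 2 + w ^ 3 / 3 + w ^ 4 / (4 * (1 - b)) + ln (1 - w)"
  define c where "c = 1 - b"
  have c: "c > 0" using assms by (simp add: c_def)
  have "?g 0 \<le> ?g w"
    unfolding c_def[symmetric]
  proof (rule DERIV_nonneg_imp_nondecreasing[OF assms(1)])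
    fix u assume u: "0 \<le> u" "u \<le> w"
    have "u < 1" using u assms by simp
    hence "((\<lambda>w. w + w ^ 2 / 2 + w ^ 3 / 3 + w ^ 4 / (4 * c) + ln (1 - w))
        has_real_derivative (1 + u + u ^ 2 + u ^ 3 / c - 1 / (1 - u))) (at u)"
      using c by (auto intro!: derivative_eq_intros)
    moreover have "1 + u + u ^ 2 + u ^ 3 / c - 1 / (1 - u) \<ge> 0"
    proof -
      have "1 / (1 - u) = 1 + u + u ^ 2 + u ^ 3 / (1 - u)"
        using \<open>u < 1\<close> by (simp add: field_simps power3_eq_cube power2_eq_square)
      moreover have "u ^ 3 / (1 - u) \<le> u ^ 3 / c"
        using u assms c unfolding c_def by (intro divide_left_mono mult_pos_pos) auto
      ultimately show ?thesis by simp
    qed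
    ultimately show "\<exists>y. ((\<lambda>w. w + w ^ 2 / 2 + w ^ 3 / 3 + w ^ 4 / (4 * c) + ln (1 - w))
        has_real_derivative y) (at u) \<and> 0 \<le> y" by blast
  qed
  thus ?thesis by simp
qed

section \<open>Upper bounds for the generating function by supersolutions\<close>

lemma neg_ln_one_minus_le_linear:
  fixes w b :: real
  assumes "0 \<le> w" "w \<le> b" "b < 1"
  shows "- ln (1 - w) \<le> (1 + b / (2 * (1 - b))) * w"
proof -
  let ?g = "\<lambda>w. w + w ^ 2 / (2 * (1 - b)) + ln (1 - w)"
  define c where "c = 1 - b"
  have c: "c > 0" using assms by (simp add: c_def)
  have "?g 0 \<le> ?g w"
    unfolding c_def[symmetric]
  proof (rule DERIV_nonneg_imp_nondecreasing[OF assms(1)])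
    fix u assume u: "0 \<le> u" "u \<le> w"
    have "u < 1" using u assms by simp
    hence "((\<lambda>w. w + w ^ 2 / (2 * c) + ln (1 - w))
        has_real_derivative (1 + u / c - 1 / (1 - u))) (at u)"
      using c by (auto intro!: derivative_eq_intros)
    moreover have "1 + u / c - 1 / (1 - u) \<ge> 0"
    proof -
      have "1 / (1 - u) = 1 + u / (1 - u)"
        using \<open>u < 1\<close> by (simp add: field_simps)
      moreover have "u / (1 - u) \<le> u / c"
        using u assms c unfolding c_def by (intro divide_left_mono mult_pos_pos) auto
      ultimately show ?thesis by simp
    qed
    ultimately show "\<exists>y. ((\<lambda>w. w + w ^ 2 / (2 * c) + ln (1 - w))
        has_real_derivative y) (at u) \<and> 0 \<le> y" by blast
  qed
  moreover have "w ^ 2 \<le> b * w" using assms by (simp add: power2_eq_square mult_right_mono)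
  hence "w ^ 2 / (2 * (1 - b)) \<le> b * w / (2 * (1 - b))" using assms by (intro divide_right_mono) auto
  ultimately show ?thesis by (simp add: algebra_simps)
qed

lemma prod_inverse_eq_exp:
  assumes "\<And>t. t \<in> A \<Longrightarrow> w t < (1 :: real)"
  shows "(\<Prod>t\<in>A. 1 / (1 - w t)) = exp (\<Sum>t\<in>A. - ln (1 - w t))"
proof (cases "finite A")
  case True
  have "(\<Prod>t\<in>A. 1 / (1 - w t)) = (\<Prod>t\<in>A. exp (- ln (1 - w t)))"
    using assms by (intro prod.cong refl) (auto simp: exp_minus field_simps)
  thus ?thesis using True by (simp add: exp_sum)
qed simp

text \<open>\<open>E\<close> bounds the logarithm of the Euler product as soon as \<tau> bounds the
  generating function. So a \<tau> that the recursion does not increase bounds all truncations by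
  induction, and convergence need not be known beforehand.\<close>

lemma gf_bounded:
  assumes x: "0 \<le> x" "x < 1" and z: "0 \<le> z" "z \<le> 1"
    and E: "\<And>n. gf n x z \<le> \<tau> \<Longrightarrow> (\<Sum>t\<in>rtrees_le n. - ln (1 - weight x z t)) \<le> E"
    and \<tau>: "x * z \<le> \<tau>" "x * (exp E - 1) + x * z + x\<^sup>2 * z * (z - 1) \<le> \<tau>"
  shows "gf n x z \<le> \<tau>"
proof (induction n)
  case 0
  show ?case using \<tau>(1) x z by (simp add: gf_def rtrees_le_0) (metis mult_nonneg_nonneg order_trans)
next
  case (Suc n)
  show ?case
  proof (cases "n = 0")
    case True
    thus ?thesis using \<tau>(1) by (simp add: gf_1)
  next
    case False
    have w: "weight x z t < 1" for t
    proof -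
      have "weight x z t \<le> x * z" using x z by (intro weight_le) auto
      also have "\<dots> \<le> x" using x z by (simp add: mult_left_le)
      finally show ?thesis using x by simp
    qed
    have "(\<Prod>t\<in>rtrees_le n. 1 / (1 - weight x z t)) \<le> exp E"
      using E[OF Suc] w by (simp add: prod_inverse_eq_exp)
    hence "x * ((\<Prod>t\<in>rtrees_le n. 1 / (1 - weight x z t)) - 1) \<le> x * (exp E - 1)"
      using x by (intro mult_left_mono) auto
    thus ?thesis using gf_Suc_le[OF x z, of n] False \<tau>(2) by simp
  qed
qed

lemma gf_bounded_linear:
  assumes x: "0 \<le> x" "x < 1" and z: "0 \<le> z" "z \<le> 1"
    and \<tau>: "x * z \<le> \<tau>" "x * (exp ((1 + x * z / (2 * (1 - x * z))) * \<tau>) - 1) + x * z + x\<^sup>2 * z * (z - 1) \<le> \<tau>"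
  shows "gf n x z \<le> \<tau>"
proof (rule gf_bounded[OF x z _ \<tau>])
  fix n assume le: "gf n x z \<le> \<tau>"
  let ?\<kappa> = "1 + x * z / (2 * (1 - x * z))"
  have "x * z \<le> x" using x z by (simp add: mult_left_le)
  hence b: "x * z < 1" using x by simp
  have "(\<Sum>t\<in>rtrees_le n. - ln (1 - weight x z t)) \<le> (\<Sum>t\<in>rtrees_le n. ?\<kappa> * weight x z t)"
    using x z b by (intro sum_mono neg_ln_one_minus_le_linear weight_nonneg weight_le) auto
  also have "\<dots> = ?\<kappa> * gf n x z" by (simp add: gf_def sum_distrib_left)
  also have "\<dots> \<le> ?\<kappa> * \<tau>" using le x z b by (intro mult_left_mono) auto
  finally show "(\<Sum>t\<in>rtrees_le n. - ln (1 - weight x z t)) \<le> ?\<kappa> * \<tau>" .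
qed

text \<open>As in Polya's formula, the logarithm of the Euler product is the sum of
  \<open>gf n (x ^ k) (z ^ k) / k\<close>. The terms from \<open>k = 4\<close> on are bounded by a
  geometric series, as no weight exceeds \<open>x * z\<close>. The bounds at the powers come from
  the cruder \<open>gf_bounded_linear\<close>.\<close>

lemma gf_bounded_powers:
  assumes x: "0 \<le> x" "x < 1" and z: "0 \<le> z" "z \<le> 1"
    and \<tau>s: "\<And>n. gf n (x ^ 2) (z ^ 2) \<le> \<tau>2" "\<And>n. gf n (x ^ 3) (z ^ 3) \<le> \<tau>3" "\<And>n. gf n (x ^ 4) (z ^ 4) \<le> \<tau>4"
    and \<tau>: "x * z \<le> \<tau>"
      "x * (exp (\<tau> + \<tau>2 / 2 + \<tau>3 / 3 + \<tau>4 / (4 * (1 - x * z))) - 1) + x * z + x\<^sup>2 * z * (z - 1) \<le> \<tau>"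
  shows "gf n x z \<le> \<tau>"
proof (rule gf_bounded[OF x z _ \<tau>])
  fix n assume le: "gf n x z \<le> \<tau>"
  have "x * z \<le> x" using x z by (simp add: mult_left_le)
  hence b: "x * z < 1" using x by simp
  have "(\<Sum>t\<in>rtrees_le n. - ln (1 - weight x z t))
      \<le> (\<Sum>t\<in>rtrees_le n. weight x z t + weight x z t ^ 2 / 2 + weight x z t ^ 3 / 3
           + weight x z t ^ 4 / (4 * (1 - x * z)))"
    using x z b by (intro sum_mono neg_ln_one_minus_le weight_nonneg weight_le) auto
  also have "\<dots> = gf n x z + gf n (x ^ 2) (z ^ 2) / 2 + gf n (x ^ 3) (z ^ 3) / 3
      + gf n (x ^ 4) (z ^ 4) / (4 * (1 - x * z))"
    by (simp add: gf_def weight_power sum.distrib sum_divide_distrib)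
  also have "\<dots> \<le> \<tau> + \<tau>2 / 2 + \<tau>3 / 3 + \<tau>4 / (4 * (1 - x * z))"
    using le \<tau>s b by (intro add_mono divide_right_mono) auto
  finally show "(\<Sum>t\<in>rtrees_le n. - ln (1 - weight x z t)) \<le> \<tau> + \<tau>2 / 2 + \<tau>3 / 3 + \<tau>4 / (4 * (1 - x * z))" .
qed

section \<open>Numerical estimates inside the region of convergence\<close>

lemma exp_upper_Taylor:
  assumes "0 \<le> c" "c \<le> (1 :: real)"
  shows "exp c \<le> (\<Sum>k<8. c ^ k / fact k) + 3 / fact 8 * c ^ 8"
proof -
  obtain t where t: "\<bar>t\<bar> \<le> \<bar>c\<bar>" "exp c = (\<Sum>k<8. c ^ k / fact k) + (exp t / fact 8) * c ^ 8"
    using Maclaurin_exp_le[of c 8] by blast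
  have "exp t \<le> exp 1" using t(1) assms by simp
  also have "exp 1 \<le> (3 :: real)" using exp_le by simp
  finally have "(exp t / fact 8) * c ^ 8 \<le> 3 / fact 8 * c ^ 8"
    using assms by (intro mult_right_mono divide_right_mono) auto
  thus ?thesis using t(2) by simp
qed

lemma exp_lower_Taylor:
  assumes "0 \<le> c"
  shows "(\<Sum>k<8. c ^ k / fact k) \<le> exp (c :: real)"
proof -
  obtain t where t: "exp c = (\<Sum>k<8. c ^ k / fact k) + (exp t / fact 8) * c ^ 8"
    using Maclaurin_exp_le[of c 8] by blast
  have "(exp t / fact 8) * c ^ 8 \<ge> 0" using assms by (intro mult_nonneg_nonneg) auto
  thus ?thesis using t by simp
qed

text \<open>
  The radius of convergence of the generating function is \<open>\<rho> = 0.33832...\<close>. The point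
  \<open>(99/250, 36/49)\<close> is chosen in the region of convergence such that
  \<open>99/250 * sqrt (36/49)\<close> exceeds \<open>\<rho>\<close>, by about 0.3 percent.
\<close>

lemma supersolution_mono:
  fixes x :: real
  assumes "exp E \<le> K" "0 \<le> x" "x * (K - 1) + a + b \<le> \<tau>"
  shows "x * (exp E - 1) + a + b \<le> \<tau>"
proof -
  have "x * (exp E - 1) \<le> x * (K - 1)" using assms by (intro mult_left_mono) auto
  thus ?thesis using assms(3) by simp
qed

text \<open>Here and at the next two powers the bound on the right lies slightly above the fixed
  point of the recursion; the rationals inside the proof round up the exponent and then the
  exponential.\<close>

lemma gf_upper_square: "gf n ((99/250) ^ 2) ((36/49) ^ 2) \<le> 12/125"
proof (rule gf_bounded_linear)
  have "exp ((1 + (99/250) ^ 2 * (36/49) ^ 2 / (2 * (1 - (99/250) ^ 2 * (36/49) ^ 2))) * (12/125)) \<le> exp (101/1000 :: real)"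
    by (simp add: power_divide)
  also have "\<dots> \<le> 2213/2000"
    using exp_upper_Taylor[of "101/1000"] by (simp add: eval_nat_numeral power_divide)
  finally show "((99/250) ^ 2 :: real) * (exp ((1 + (99/250) ^ 2 * (36/49) ^ 2 / (2 * (1 - (99/250) ^ 2 * (36/49) ^ 2))) * (12/125)) - 1) + (99/250) ^ 2 * (36/49) ^ 2
      + ((99/250) ^ 2)\<^sup>2 * (36/49) ^ 2 * ((36/49) ^ 2 - 1) \<le> 12/125"
    by (rule supersolution_mono) (simp_all add: power_divide)
qed (simp_all add: power_divide)

lemma gf_upper_cube: "gf n ((99/250) ^ 3) ((36/49) ^ 3) \<le> 16/625"
proof (rule gf_bounded_linear)
  have "exp ((1 + (99/250) ^ 3 * (36/49) ^ 3 / (2 * (1 - (99/250) ^ 3 * (36/49) ^ 3))) * (16/625)) \<le> exp (26/1000 :: real)"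
    by (simp add: power_divide)
  also have "\<dots> \<le> 1027/1000"
    using exp_upper_Taylor[of "26/1000"] by (simp add: eval_nat_numeral power_divide)
  finally show "((99/250) ^ 3 :: real) * (exp ((1 + (99/250) ^ 3 * (36/49) ^ 3 / (2 * (1 - (99/250) ^ 3 * (36/49) ^ 3))) * (16/625)) - 1) + (99/250) ^ 3 * (36/49) ^ 3
      + ((99/250) ^ 3)\<^sup>2 * (36/49) ^ 3 * ((36/49) ^ 3 - 1) \<le> 16/625"
    by (rule supersolution_mono) (simp_all add: power_divide)
qed (simp_all add: power_divide)

lemma gf_upper_fourth: "gf n ((99/250) ^ 4) ((36/49) ^ 4) \<le> 37/5000"
proof (rule gf_bounded_linear)
  have "exp ((1 + (99/250) ^ 4 * (36/49) ^ 4 / (2 * (1 - (99/250) ^ 4 * (36/49) ^ 4))) * (37/5000)) \<le> exp (75/10000 :: real)"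
    by (simp add: power_divide)
  also have "\<dots> \<le> 10076/10000"
    using exp_upper_Taylor[of "75/10000"] by (simp add: eval_nat_numeral power_divide)
  finally show "((99/250) ^ 4 :: real) * (exp ((1 + (99/250) ^ 4 * (36/49) ^ 4 / (2 * (1 - (99/250) ^ 4 * (36/49) ^ 4))) * (37/5000)) - 1) + (99/250) ^ 4 * (36/49) ^ 4
      + ((99/250) ^ 4)\<^sup>2 * (36/49) ^ 4 * ((36/49) ^ 4 - 1) \<le> 37/5000"
    by (rule supersolution_mono) (simp_all add: power_divide)
qed (simp_all add: power_divide)

text \<open>At \<open>\<tau> = 217/250\<close> the recursion has slope close to 1 in \<tau>, as
  \<open>99/250\<close> times the exponential is about 1.001. There the slack of the supersolution
  inequality is nearly largest, which leaves room for the rounding.\<close>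

lemma gf_upper: "gf n (99/250) (36/49) \<le> 217/250"
proof (rule gf_bounded_powers[OF _ _ _ _ gf_upper_square gf_upper_cube gf_upper_fourth])
  have "exp (217/250 + (12/125) / 2 + (16/625) / 3 + (37/5000) / (4 * (1 - 99/250 * (36/49)))) \<le> exp (92715/100000 :: real)"
    by simp
  also have "\<dots> \<le> 25274/10000"
    using exp_upper_Taylor[of "92715/100000"] by (simp add: eval_nat_numeral power_divide)
  finally show "99/250 * (exp (217/250 + (12/125) / 2 + (16/625) / 3 + (37/5000) / (4 * (1 - 99/250 * (36/49)))) - 1)
      + 99/250 * (36/49) + (99/250)\<^sup>2 * (36/49) * (36/49 - 1) \<le> (217/250 :: real)"
    by (rule supersolution_mono) (simp_all add: power_divide)
qed simp_all

section \<open>Lower bounds for the number of rooted trees\<close>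

lemma exp_ge_e_mult: "exp 1 * u \<le> exp (u :: real)"
proof -
  have "exp 1 * u \<le> exp 1 * exp (u - 1)" using exp_ge_add_one_self[of "u - 1"] by simp
  thus ?thesis by (simp add: exp_add[symmetric])
qed

lemma exp_le_inverse_one_minus: "w < 1 \<Longrightarrow> exp w \<le> 1 / (1 - w :: real)"
  using exp_ge_add_one_self[of "- w"] by (simp add: exp_minus field_simps)

text \<open>
  If the generating function converges at \<open>x\<close>, its value \<open>\<tau>\<close> satisfies
  \<open>x * exp (\<tau> + q) \<le> \<tau>\<close>, which is impossible for \<open>x * exp (1 + q) > 1\<close>.
\<close>

lemma gf_bounded_imp:
  assumes x: "0 < x" "x < 1" and bd: "\<And>n. gf n x 1 \<le> C" and F: "F \<subseteq> rtrees_le n0"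
  shows "x * (exp 1 * (\<Prod>t\<in>F. exp (- weight x 1 t) / (1 - weight x 1 t))) \<le> 1"
proof -
  let ?w = "weight x 1"
  let ?P = "\<Prod>t\<in>F. exp (- ?w t) / (1 - ?w t)"
  define \<tau> where "\<tau> = (SUP n. gf n x 1)"
  have bdd: "bdd_above (range (\<lambda>n. gf n x 1))" using bd by (auto intro!: bdd_aboveI)
  have le\<tau>: "gf n x 1 \<le> \<tau>" for n unfolding \<tau>_def by (rule cSUP_upper[OF _ bdd]) simp
  have w: "0 \<le> ?w t" "?w t < 1" for t
  proof -
    show "0 \<le> ?w t" using x by (intro weight_nonneg) auto
    have "?w t \<le> x * 1" using x by (intro weight_le) auto
    thus "?w t < 1" using x by simp
  qed
  have finF: "finite F" using F finite_rtrees_le finite_subset by blast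
  have P0: "?P > 0" using w by (intro prod_pos) (auto intro!: divide_pos_pos)
  \<comment> \<open>At \<open>z = 1\<close> the corrections of \<open>weight_Node\<close> vanish.
    Any finite set of multisets yields trees of bounded size, so finite parts of the Euler product
    stay below the supremum.\<close>
  have prod_le: "x * (\<Prod>t\<in>rtrees_le n. 1 / (1 - ?w t)) \<le> \<tau>" for n
  proof -
    have "(\<Prod>t\<in>rtrees_le n. 1 / (1 - ?w t)) \<le> \<tau> / x"
    proof (rule has_sum_le_finite_sums[OF has_sum_multisets])
      fix S assume S: "finite S" "S \<subseteq> {M. set_mset M \<subseteq> rtrees_le n}"
      have "x * (\<Sum>M\<in>S. \<Prod>t\<in>#M. ?w t) = (\<Sum>M\<in>S. ?w (Node M))"
        unfolding weight_Node sum_distrib_left by (intro sum.cong refl) simp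
      also have "\<dots> = (\<Sum>t\<in>Node ` S. ?w t)" by (subst sum.reindex) (auto simp: inj_on_def)
      also have "\<dots> \<le> gf (Max (insert 0 (nodes ` Node ` S))) x 1"
        unfolding gf_def
      proof (rule sum_mono2[OF finite_rtrees_le])
        show "Node ` S \<subseteq> rtrees_le (Max (insert 0 (nodes ` Node ` S)))"
          using S(1) by (auto simp: rtrees_le_def simp del: nodes.simps intro!: Max_ge)
      qed (rule w)
      also have "\<dots> \<le> \<tau>" by (rule le\<tau>)
      finally show "(\<Sum>M\<in>S. \<Prod>t\<in>#M. ?w t) \<le> \<tau> / x" using x by (simp add: field_simps)
    qed (use w finite_rtrees_le in auto)
    thus ?thesis using x by (simp add: field_simps)
  qed
  \<comment> \<open>The factors from \<open>F\<close> are kept exactly and the others weakened to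
    exponentials. Then \<open>exp_ge_e_mult\<close> makes the bound linear in
    \<open>gf n x 1\<close>, so that \<tau> cancels after passing to the supremum.\<close>
  have step: "x * (exp 1 * ?P) * gf n x 1 \<le> \<tau>" if n: "n \<ge> n0" for n
  proof -
    have sub: "F \<subseteq> rtrees_le n" using F rtrees_le_mono[OF n] by blast
    have "?P * exp (gf n x 1) = (\<Prod>t\<in>F. 1 / (1 - ?w t)) * (\<Prod>t\<in>rtrees_le n - F. exp (?w t))"
    proof -
      have "exp (gf n x 1) = (\<Prod>t\<in>F. exp (?w t)) * (\<Prod>t\<in>rtrees_le n - F. exp (?w t))"
        unfolding gf_def exp_sum[OF finite_rtrees_le]
        by (subst prod.subset_diff[OF sub finite_rtrees_le]) (simp add: mult.commute)
      moreover have "?P * (\<Prod>t\<in>F. exp (?w t)) = (\<Prod>t\<in>F. 1 / (1 - ?w t))"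
        unfolding prod.distrib[symmetric] by (intro prod.cong refl) (simp add: exp_minus)
      ultimately show ?thesis by (simp add: mult.assoc[symmetric])
    qed
    also have "\<dots> \<le> (\<Prod>t\<in>F. 1 / (1 - ?w t)) * (\<Prod>t\<in>rtrees_le n - F. 1 / (1 - ?w t))"
      using w by (intro mult_left_mono prod_mono prod_nonneg conjI exp_le_inverse_one_minus) (auto simp: less_imp_le)
    also have "\<dots> = (\<Prod>t\<in>rtrees_le n. 1 / (1 - ?w t))"
      by (subst prod.subset_diff[OF sub finite_rtrees_le, of "\<lambda>t. 1 / (1 - ?w t)"]) (simp add: mult.commute)
    finally have "x * (?P * exp (gf n x 1)) \<le> \<tau>"
      using mult_left_mono[of _ _ x] prod_le[of n] x by (meson less_imp_le order_trans)
    moreover have "x * (?P * (exp 1 * gf n x 1)) \<le> x * (?P * exp (gf n x 1))"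
      using x P0 exp_ge_e_mult by (intro mult_left_mono) auto
    ultimately show ?thesis by (simp add: mult_ac)
  qed
  have "\<tau> > 0" using le\<tau>[of 1] x by (simp add: gf_1)
  let ?c = "x * (exp 1 * ?P)"
  have c0: "?c > 0" using x P0 by simp
  have "\<tau> \<le> \<tau> / ?c"
    unfolding \<tau>_def
  proof (rule cSUP_least)
    fix n
    have "gf n x 1 \<le> gf (max n n0) x 1" using x by (intro gf_mono) auto
    also have "\<dots> \<le> \<tau> / ?c" using step[of "max n n0"] c0 by (simp add: pos_le_divide_eq mult.commute)
    finally show "gf n x 1 \<le> (SUP n. gf n x 1) / ?c" by (simp add: \<tau>_def)
  qed simp
  hence "?c * \<tau> \<le> 1 * \<tau>" using c0 by (simp add: pos_le_divide_eq mult.commute)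
  thus ?thesis using \<open>\<tau> > 0\<close> by (simp only: mult_le_cancel_right)
qed

text \<open>The point 0.3387 lies about 0.1 percent above \<rho>. \<open>F\<close> consists of the
  four trees with at most three nodes; with these the inequality of \<open>gf_bounded_imp\<close>
  fails by less than 0.1 percent.\<close>

lemma gf_unbounded: "\<not> (\<forall>n. gf n (3387/10000) 1 \<le> C)"
proof
  assume "\<forall>n. gf n (3387/10000) 1 \<le> C"
  hence bd: "\<And>n. gf n (3387/10000) 1 \<le> C" by blast
  define P2 where "P2 = Node {#leaf#}"
  define F where "F = {leaf, P2, Node {#P2#}, Node {#leaf, leaf#}}"
  define x :: real where "x = 3387/10000"
  have F: "F \<subseteq> rtrees_le 3" by (auto simp: F_def P2_def rtrees_le_def)
  have "(\<Prod>t\<in>F. exp (- weight x 1 t) / (1 - weight x 1 t))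
      = exp (- x) / (1 - x) * (exp (- (x ^ 2)) / (1 - x ^ 2) * (exp (- (x ^ 3)) / (1 - x ^ 3) * (exp (- (x ^ 3)) / (1 - x ^ 3))))"
    by (simp add: F_def P2_def weight_def numeral_2_eq_2 numeral_3_eq_3)
  also have "\<dots> = exp (- (x + x ^ 2 + 2 * x ^ 3)) / ((1 - x) * (1 - x ^ 2) * (1 - x ^ 3) ^ 2)"
  proof -
    have "exp (- x) * (exp (- (x ^ 2)) * (exp (- (x ^ 3)) * exp (- (x ^ 3)))) = exp (- (x + x ^ 2 + 2 * x ^ 3))"
      by (simp add: exp_add[symmetric])
    moreover have "a / A * (b / B * (c / C * (c / C))) = (a * (b * (c * c))) / (A * B * C ^ 2)"
      for a b c A B C :: real
      by (simp add: power2_eq_square)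
    ultimately show ?thesis by metis
  qed
  finally have "exp 1 * (\<Prod>t\<in>F. exp (- weight x 1 t) / (1 - weight x 1 t))
      = exp (1 - x - x ^ 2 - 2 * x ^ 3) / ((1 - x) * (1 - x ^ 2) * (1 - x ^ 3) ^ 2)"
    by (simp add: exp_add[symmetric] algebra_simps)
  moreover have "x * (exp 1 * (\<Prod>t\<in>F. exp (- weight x 1 t) / (1 - weight x 1 t))) \<le> 1"
    by (rule gf_bounded_imp[OF _ _ _ F]) (use bd in \<open>auto simp: x_def\<close>)
  ultimately have le: "x * exp (1 - x - x ^ 2 - 2 * x ^ 3) \<le> (1 - x) * (1 - x ^ 2) * (1 - x ^ 3) ^ 2"
    by (simp add: x_def power_divide field_simps)
  have "15981/10000 \<le> exp (46887/100000 :: real)"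
    using exp_lower_Taylor[of "46887/100000"] by (simp add: eval_nat_numeral power_divide)
  also have "\<dots> \<le> exp (1 - x - x ^ 2 - 2 * x ^ 3)" by (simp add: x_def power_divide)
  finally have "x * (15981/10000) \<le> (1 - x) * (1 - x ^ 2) * (1 - x ^ 3) ^ 2"
    using le by (simp add: x_def power_divide)
  thus False by (simp add: x_def power_divide)
qed

lemma gf_eq_sum_card: "gf n x 1 = (\<Sum>a=1..n. real (card (rtrees a)) * x ^ a)"
proof -
  have eq: "rtrees_le n = (\<Union>a\<in>{1..n}. rtrees a)"
    using nodes_pos by (auto simp: rtrees_le_def rtrees_def Suc_le_eq)
  have "gf n x 1 = (\<Sum>a=1..n. \<Sum>t\<in>rtrees a. weight x 1 t)"
    unfolding gf_def eq by (rule sum.UNION_disjoint) (auto simp: finite_rtrees, auto simp: rtrees_def)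
  also have "\<dots> = (\<Sum>a=1..n. real (card (rtrees a)) * x ^ a)"
    by (intro sum.cong refl) (simp add: weight_def rtrees_def)
  finally show ?thesis .
qed

text \<open>The larger tree becomes an additional child of the root of the smaller one. It can be
  recovered, because the other children have fewer than \<open>b\<close> nodes altogether.\<close>

lemma card_rtrees_mult_aux:
  assumes "0 < a" "a \<le> b"
  shows "card (rtrees a) * card (rtrees b) \<le> card (rtrees (a + b))"
proof -
  define att where "att = (\<lambda>(s, t). case s of Node M \<Rightarrow> Node (add_mset t M))"
  have "inj_on att (rtrees a \<times> rtrees b)"
  proof (rule inj_onI)
    fix z z' assume z: "z \<in> rtrees a \<times> rtrees b" "z' \<in> rtrees a \<times> rtrees b" "att z = att z'"
    obtain M t where z1: "z = (Node M, t)" by (metis rtree.exhaust surj_pair)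
    obtain M' t' where z2: "z' = (Node M', t')" by (metis rtree.exhaust surj_pair)
    have eq: "add_mset t M = add_mset t' M'" using z(3) by (simp add: att_def z1 z2)
    have n: "nodes t = b" "(\<Sum>t\<in>#M'. nodes t) < b"
      using z z1 z2 assms by (auto simp: rtrees_def)
    have "t = t'"
    proof (rule ccontr)
      assume "t \<noteq> t'"
      hence "t \<in># M'" using arg_cong[OF eq, of set_mset] by auto
      thus False using nodes_le_sum[of t M'] n by simp
    qed
    thus "z = z'" using eq z1 z2 by simp
  qed
  moreover have "att ` (rtrees a \<times> rtrees b) \<subseteq> rtrees (a + b)"
  proof (rule image_subsetI)
    fix z assume z: "z \<in> rtrees a \<times> rtrees b"
    obtain M t where z1: "z = (Node M, t)" by (metis rtree.exhaust surj_pair)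
    show "att z \<in> rtrees (a + b)" using z by (auto simp: att_def z1 rtrees_def)
  qed
  ultimately have "card (rtrees a \<times> rtrees b) \<le> card (rtrees (a + b))"
    using finite_rtrees by (rule card_inj_on_le)
  thus ?thesis by (simp add: card_cartesian_product)
qed

lemma card_rtrees_mult:
  assumes "0 < a" "0 < b"
  shows "card (rtrees a) * card (rtrees b) \<le> card (rtrees (a + b))"
  using card_rtrees_mult_aux[of a b] card_rtrees_mult_aux[of b a] assms
  by (cases "a \<le> b") (auto simp: mult.commute add.commute)

lemma card_rtrees_pos: "n > 0 \<Longrightarrow> card (rtrees n) > 0"
proof (induction n)
  case (Suc n)
  have 1: "card (rtrees 1) > 0"
    using finite_rtrees[of 1] by (auto simp: card_gt_0_iff rtrees_def intro: exI[of _ leaf])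
  show ?case
  proof (cases "n = 0")
    case False
    thus ?thesis using Suc.IH 1 card_rtrees_mult[of n 1]
      by (metis One_nat_def Suc_eq_plus1 mult_pos_pos neq0_conv order_less_le_trans zero_less_one)
  qed (use 1 in simp)
qed simp

lemma card_rtrees_power:
  assumes "a > 0" "j > 0"
  shows "card (rtrees a) ^ k \<le> card (rtrees (a * k + j))"
proof (induction k)
  case 0
  show ?case using card_rtrees_pos[OF assms(2)] by simp
next
  case (Suc k)
  have "card (rtrees a) ^ Suc k \<le> card (rtrees a) * card (rtrees (a * k + j))"
    using Suc by simp
  also have "\<dots> \<le> card (rtrees (a + (a * k + j)))" using assms by (intro card_rtrees_mult) auto
  finally show ?case by (simp add: add.assoc)
qed

text \<open>Divergence gives the growth only for some size \<open>a\<close>. Supermultiplicativity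
  carries it to all sizes at the cost of the constant \<open>\<delta> ^ a\<close>, as in Fekete's
  lemma.\<close>

lemma card_rtrees_growth:
  fixes \<delta> :: real
  assumes \<delta>: "1 \<le> \<delta>" "\<delta> * (3387/10000) < 1"
  obtains a where "\<And>n. n > 0 \<Longrightarrow> \<delta> ^ n \<le> \<delta> ^ a * real (card (rtrees n))"
proof -
  let ?x = "3387/10000 :: real"
  have "\<exists>a>0. \<delta> ^ a < real (card (rtrees a))"
  proof (rule ccontr)
    assume neg: "\<not> ?thesis"
    have "gf n ?x 1 \<le> 1 / (1 - \<delta> * ?x)" for n
    proof -
      have "real (card (rtrees a)) \<le> \<delta> ^ a" if "a \<in> {1..n}" for a
        using neg that by (metis atLeastAtMost_iff less_le_trans not_less zero_less_one)
      hence "gf n ?x 1 \<le> (\<Sum>a=1..n. \<delta> ^ a * ?x ^ a)"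
        unfolding gf_eq_sum_card by (intro sum_mono mult_right_mono) simp_all
      also have "\<dots> = (\<Sum>a=1..n. (\<delta> * ?x) ^ a)" by (simp only: power_mult_distrib)
      also have "\<dots> \<le> (\<Sum>a. (\<delta> * ?x) ^ a)"
        using \<delta> by (intro sum_le_suminf summable_geometric) auto
      also have "\<dots> = 1 / (1 - \<delta> * ?x)" using \<delta> by (intro suminf_geometric) auto
      finally show ?thesis .
    qed
    thus False using gf_unbounded by blast
  qed
  then obtain a where a: "a > 0" "\<delta> ^ a < real (card (rtrees a))" by blast
  show ?thesis
  proof (rule that)
    fix n :: nat assume n: "n > 0"
    define k where "k = (n - 1) div a"
    define j where "j = (n - 1) mod a + 1"
    have nkj: "n = a * k + j" using n by (simp add: k_def j_def)
    have ja: "j \<le> a" using a(1) by (simp add: j_def Suc_le_eq)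
    have "\<delta> ^ n \<le> \<delta> ^ (a + a * k)" using \<delta> nkj ja by (intro power_increasing) auto
    also have "\<dots> = \<delta> ^ a * (\<delta> ^ a) ^ k" by (simp add: power_add power_mult)
    also have "\<dots> \<le> \<delta> ^ a * real (card (rtrees a)) ^ k"
      using a \<delta> by (intro mult_left_mono power_mono) auto
    also have "\<dots> \<le> \<delta> ^ a * real (card (rtrees n))"
    proof (rule mult_left_mono)
      have "card (rtrees a) ^ k \<le> card (rtrees n)"
        unfolding nkj by (rule card_rtrees_power[OF a(1)]) (simp add: j_def)
      thus "real (card (rtrees a)) ^ k \<le> real (card (rtrees n))"
        unfolding of_nat_power[symmetric] of_nat_le_iff .
      show "0 \<le> \<delta> ^ a" using \<delta> by simp
    qed
    finally show "\<delta> ^ n \<le> \<delta> ^ a * real (card (rtrees n))" .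
  qed
qed

text \<open>An exponential Markov inequality: for \<open>z = 36/49\<close> a tree with
  \<open>2 * tips t \<le> n\<close> has \<open>z ^ tips t \<ge> (6/7) ^ n\<close>. As
  \<open>z\<close> is a square, the half power is rational.\<close>

lemma card_few_tips:
  "real (card {t \<in> rtrees n. 2 * tips t \<le> n}) * (99/250 * (6/7)) ^ n \<le> 217/250"
proof -
  let ?B = "{t \<in> rtrees n. 2 * tips t \<le> n}"
  have "real (card ?B) * (99/250 * (6/7)) ^ n = (\<Sum>t\<in>?B. (99/250 * (6/7)) ^ n)" by simp
  also have "\<dots> \<le> (\<Sum>t\<in>?B. weight (99/250) (36/49) t)"
  proof (rule sum_mono)
    fix t assume t: "t \<in> ?B"
    have "(6/7 :: real) ^ n \<le> (6/7) ^ (2 * tips t)" using t by (intro power_decreasing) auto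
    also have "\<dots> = (36/49) ^ tips t" by (simp add: power_mult power_divide)
    finally have "(99/250) ^ n * (6/7) ^ n \<le> (99/250) ^ n * (36/49 :: real) ^ tips t"
      by (intro mult_left_mono) auto
    moreover have "nodes t = n" using t by (simp add: rtrees_def)
    ultimately show "(99/250 * (6/7)) ^ n \<le> weight (99/250) (36/49) t"
      by (simp only: weight_def power_mult_distrib)
  qed
  also have "\<dots> \<le> gf n (99/250) (36/49)"
    unfolding gf_def by (intro sum_mono2 finite_rtrees_le weight_nonneg) (auto simp: rtrees_def rtrees_le_def)
  also have "\<dots> \<le> 217/250" by (rule gf_upper)
  finally show ?thesis .
qed

theorem few_tips_rare:
  "(\<lambda>n. real n * real (card {t \<in> rtrees n. 2 * tips t \<le> n}) / real (card (rtrees n))) \<longlonglongrightarrow> 0"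
proof -
  \<comment> \<open>The number 0.3388 lies between 0.3387, where the series is unbounded, and
    \<open>99/250 * (6/7)\<close>, about 0.3394. The first gap gives the growth, the second gives
    \<open>q < 1\<close>, and a geometric decay absorbs the factor \<open>n\<close>.\<close>
  define \<delta> :: real where "\<delta> = 10000/3388"
  obtain a where a: "\<And>n. n > 0 \<Longrightarrow> \<delta> ^ n \<le> \<delta> ^ a * real (card (rtrees n))"
    by (rule card_rtrees_growth[of \<delta>]) (auto simp: \<delta>_def)
  define q :: real where "q = 1 / (99/250 * (6/7) * \<delta>)"
  have q: "0 < q" "q < 1" by (auto simp: q_def \<delta>_def)
  have lim: "(\<lambda>n. 217/250 * \<delta> ^ a * (real n * q ^ n)) \<longlonglongrightarrow> 0"
    using tendsto_mult_right_zero[OF powser_times_n_limit_0[of q]] q by simp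
  show ?thesis
  proof (rule tendsto_sandwich[OF _ _ tendsto_const lim])
    show "\<forall>\<^sub>F n in sequentially. 0 \<le> real n * real (card {t \<in> rtrees n. 2 * tips t \<le> n}) / real (card (rtrees n))"
      by simp
    show "\<forall>\<^sub>F n in sequentially. real n * real (card {t \<in> rtrees n. 2 * tips t \<le> n}) / real (card (rtrees n))
        \<le> 217/250 * \<delta> ^ a * (real n * q ^ n)"
      using eventually_gt_at_top[of 0]
    proof eventually_elim
      case (elim n)
      let ?b = "real (card {t \<in> rtrees n. 2 * tips t \<le> n})" and ?r = "real (card (rtrees n))"
      have r: "?r > 0" using card_rtrees_pos[OF elim] by simp
      have d: "\<delta> > 0" by (simp add: \<delta>_def)
      have "?b * (99/250 * (6/7)) ^ n * \<delta> ^ n \<le> 217/250 * (\<delta> ^ a * ?r)"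
        using card_few_tips[of n] a[OF elim] d by (intro mult_mono) auto
      hence "?b / q ^ n \<le> 217/250 * \<delta> ^ a * ?r"
        by (simp add: q_def power_divide power_mult_distrib mult_ac)
      hence "?b \<le> 217/250 * \<delta> ^ a * ?r * q ^ n" using q by (simp add: pos_divide_le_eq)
      hence "?b / ?r \<le> 217/250 * \<delta> ^ a * q ^ n" using r by (simp add: pos_divide_le_eq mult_ac)
      hence "real n * (?b / ?r) \<le> real n * (217/250 * \<delta> ^ a * q ^ n)" by (intro mult_left_mono) auto
      thus ?case by (simp add: mult_ac)
    qed
  qed
qed

section \<open>Codes of rooted trees\<close>

text \<open>Unfolds the graph from \<open>v\<close> without stepping back to \<open>u\<close>. In
  \<open>root_code\<close> the start \<open>u = v = r\<close> excludes no neighbour, as edges have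
  two ends. In a tree the counter \<open>card (verts G)\<close> exceeds every distance from the
  root, so the default \<open>leaf\<close> is never reached.\<close>

primrec code :: "nat \<Rightarrow> 'a set set \<Rightarrow> 'a \<Rightarrow> 'a \<Rightarrow> rtree" where
  "code 0 E u v = leaf"
| "code (Suc n) E u v = Node (image_mset (code n E v) (mset_set {w. {v, w} \<in> E \<and> w \<noteq> u}))"

definition root_code :: "'a ugraph \<Rightarrow> 'a \<Rightarrow> rtree" where
  "root_code G r = code (card (verts G)) (edges G) r r"

lemma code_image:
  assumes f: "inj_on f V" and E: "\<Union>E \<subseteq> V" "\<Union>E' \<subseteq> f ` V"
    and iso: "\<And>u v. u \<in> V \<Longrightarrow> v \<in> V \<Longrightarrow> {u, v} \<in> E \<longleftrightarrow> {f u, f v} \<in> E'"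
    and uv: "u \<in> V" "v \<in> V"
  shows "code n E' (f u) (f v) = code n E u v"
  using uv
proof (induction n arbitrary: u v)
  case (Suc n)
  have eq: "{w. {f v, w} \<in> E' \<and> w \<noteq> f u} = f ` {w. {v, w} \<in> E \<and> w \<noteq> u}"
  proof
    show "{w. {f v, w} \<in> E' \<and> w \<noteq> f u} \<subseteq> f ` {w. {v, w} \<in> E \<and> w \<noteq> u}"
    proof
      fix w assume w: "w \<in> {w. {f v, w} \<in> E' \<and> w \<noteq> f u}"
      hence "w \<in> f ` V" using E(2) by blast
      then obtain x where x: "x \<in> V" "w = f x" by blast
      thus "w \<in> f ` {w. {v, w} \<in> E \<and> w \<noteq> u}" using w iso[of v x] Suc.prems by auto
    qed
    show "f ` {w. {v, w} \<in> E \<and> w \<noteq> u} \<subseteq> {w. {f v, w} \<in> E' \<and> w \<noteq> f u}"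
    proof (rule image_subsetI)
      fix x assume x: "x \<in> {w. {v, w} \<in> E \<and> w \<noteq> u}"
      hence "x \<in> V" using E(1) by blast
      moreover from this have "f x \<noteq> f u" using x f Suc.prems by (auto dest: inj_onD)
      ultimately show "f x \<in> {w. {f v, w} \<in> E' \<and> w \<noteq> f u}" using iso[of v x] x Suc.prems by auto
    qed
  qed
  have sub: "{w. {v, w} \<in> E \<and> w \<noteq> u} \<subseteq> V" using E(1) by blast
  have "mset_set (f ` {w. {v, w} \<in> E \<and> w \<noteq> u}) = image_mset f (mset_set {w. {v, w} \<in> E \<and> w \<noteq> u})"
    by (rule image_mset_mset_set[symmetric]) (rule inj_on_subset[OF f sub])
  hence "code (Suc n) E' (f u) (f v) = Node (image_mset (\<lambda>w. code n E' (f v) (f w)) (mset_set {w. {v, w} \<in> E \<and> w \<noteq> u}))"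
    by (simp add: eq image_mset.compositionality o_def)
  also have "\<dots> = code (Suc n) E u v"
  proof -
    have "code n E' (f v) (f w) = code n E v w" if "w \<in># mset_set {w. {v, w} \<in> E \<and> w \<noteq> u}" for w
    proof -
      have "w \<in> {w. {v, w} \<in> E \<and> w \<noteq> u}"
        using that by (cases "finite {w. {v, w} \<in> E \<and> w \<noteq> u}") auto
      hence "w \<in> V" using sub by blast
      thus ?thesis using Suc.IH[of v w] Suc.prems by simp
    qed
    hence "image_mset (\<lambda>w. code n E' (f v) (f w)) (mset_set {w. {v, w} \<in> E \<and> w \<noteq> u})
        = image_mset (code n E v) (mset_set {w. {v, w} \<in> E \<and> w \<noteq> u})"
      by (rule image_mset_cong)
    thus ?thesis by simp
  qed
  finally show ?case .
qed simp

text \<open>Equal multisets have equally large fibres over every value; bijections between the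
  fibres are glued.\<close>

lemma image_mset_eq_bij:
  assumes "finite A" "finite B" "image_mset f (mset_set A) = image_mset g (mset_set B)"
  obtains h where "bij_betw h A B" "\<And>a. a \<in> A \<Longrightarrow> g (h a) = f a"
proof -
  have "card {a \<in> A. f a = c} = card {b \<in> B. g b = c}" for c
    using arg_cong[OF assms(3), of "\<lambda>M. count M c"]
    unfolding count_image_mset_eq_card_vimage[OF assms(1)] count_image_mset_eq_card_vimage[OF assms(2)] .
  hence "\<exists>k. bij_betw k {a \<in> A. f a = c} {b \<in> B. g b = c}" for c
    using assms by (intro finite_same_card_bij) auto
  then obtain k where k: "\<And>c. bij_betw (k c) {a \<in> A. f a = c} {b \<in> B. g b = c}" by metis
  define h where "h a = k (f a) a" for a
  have h: "h a \<in> B \<and> g (h a) = f a" if "a \<in> A" for a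
    using bij_betwE[OF k[of "f a"]] that by (auto simp: h_def)
  have "bij_betw h A B"
    unfolding bij_betw_def
  proof
    show "inj_on h A"
    proof (rule inj_onI)
      fix a b assume ab: "a \<in> A" "b \<in> A" "h a = h b"
      hence "f a = f b" using h by metis
      thus "a = b" using ab bij_betw_imp_inj_on[OF k[of "f b"]] by (auto simp: h_def dest: inj_onD)
    qed
    show "h ` A = B"
    proof
      show "B \<subseteq> h ` A"
      proof
        fix b assume "b \<in> B"
        hence "b \<in> k (g b) ` {a \<in> A. f a = g b}"
          using bij_betw_imp_surj_on[OF k[of "g b"]] by blast
        then obtain a where "a \<in> A" "f a = g b" "b = k (g b) a" by blast
        thus "b \<in> h ` A" by (auto simp: h_def intro!: image_eqI[of _ _ a])
      qed
    qed (use h in auto)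
  qed
  thus ?thesis using that h by blast
qed

section \<open>Codes computed along a parent function\<close>

context rooted_tree
begin

lemma finite_children: "finite (children v)"
  using finite_V by (simp add: children_def)

lemma children_sub: "children v \<subseteq> V - {r}"
  by (auto simp: children_def)

lemma depth_child: "c \<in> children v \<Longrightarrow> d c = Suc (d v)"
  using depth by (auto simp: children_def)

lemma root_induct [consumes 1, case_names root step]:
  assumes "v \<in> V" "P r" "\<And>v. v \<in> V - {r} \<Longrightarrow> P (par v) \<Longrightarrow> P v"
  shows "P v"
  using assms(1)
proof (induction "d v" arbitrary: v rule: less_induct)
  case less
  show ?case
  proof (cases "v = r")
    case False
    hence v: "v \<in> V - {r}" using less.prems by simp
    have "P (par v)" by (rule less.hyps) (use depth[OF v] par_in[OF v] in auto)
    thus ?thesis by (rule assms(3)[OF v])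
  qed (use assms in simp)
qed

lemma depth_ge: "v \<in> V \<Longrightarrow> d r \<le> d v"
  by (induction v rule: root_induct) (use depth in auto)

lemma depth_lt: "v \<in> V \<Longrightarrow> d v < d r + card V"
proof -
  have "{d r..d v} \<subseteq> d ` V" if "v \<in> V" for v
    using that
  proof (induction v rule: root_induct)
    case root
    show ?case using rooted_tree.root[OF rooted_tree_axioms] by auto
  next
    case (step v)
    have "{d r..d v} \<subseteq> insert (d v) {d r..d (par v)}" using depth[OF step.hyps] by auto
    thus ?case using step by blast
  qed
  moreover assume "v \<in> V"
  ultimately have "{d r..d v} \<subseteq> d ` V" by blast
  hence "card {d r..d v} \<le> card (d ` V)" using finite_V by (intro card_mono) auto
  also have "\<dots> \<le> card V" using finite_V by (rule card_image_le)
  finally show ?thesis using depth_ge[OF \<open>v \<in> V\<close>] by simp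
qed

abbreviation E :: "'a set set" where "E \<equiv> edges (parent_graph V r par)"

lemma edges_iff: "{v, w} \<in> E \<longleftrightarrow> (v \<in> V - {r} \<and> w = par v) \<or> w \<in> children v"
  by (auto simp: parent_graph_def children_def doubleton_eq_iff)

definition up :: "'a \<Rightarrow> 'a" where "up v = (if v = r then r else par v)"

lemma nbrs_eq_children:
  assumes "v \<in> V"
  shows "{w. {v, w} \<in> E \<and> w \<noteq> up v} = children v"
proof -
  have "w \<noteq> up v" if "w \<in> children v" for w
  proof
    assume "w = up v"
    hence "v \<noteq> r" "w = par v" using that by (auto simp: up_def children_def split: if_splits)
    thus False using depth_child[OF that] depth[of v] assms by simp
  qed
  moreover have "w \<in> children v" if "{v, w} \<in> E" "w \<noteq> up v" for w
    using that by (auto simp: edges_iff up_def)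
  ultimately show ?thesis by (auto simp: edges_iff)
qed

text \<open>The recursion of codes freed from the step counter and the previous vertex. By
  \<open>ex_code\<close> it has a solution, and by \<open>code_eq\<close> its values on
  \<open>V\<close> are those of \<open>code\<close>.\<close>

definition is_code :: "('a \<Rightarrow> rtree) \<Rightarrow> bool" where
  "is_code f \<longleftrightarrow> (\<forall>v\<in>V. f v = Node (image_mset f (mset_set (children v))))"

lemma code_eq:
  assumes f: "is_code f" and v: "v \<in> V" "d r + card V \<le> n + d v"
  shows "code n E (up v) v = f v"
  using v
proof (induction n arbitrary: v)
  case 0
  thus ?case using depth_lt[of v] by simp
next
  case (Suc n)
  have "code n E v w = f w" if "w \<in># mset_set (children v)" for w
  proof -
    have w: "w \<in> children v" using that finite_children by simp
    hence "up w = v" "w \<in> V" by (auto simp: children_def up_def)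
    thus ?thesis using Suc.IH[of w] Suc.prems depth_child[OF w] by simp
  qed
  hence "image_mset (code n E v) (mset_set (children v)) = image_mset f (mset_set (children v))"
    by (rule image_mset_cong)
  hence "code (Suc n) E (up v) v = Node (image_mset f (mset_set (children v)))"
    unfolding code.simps nbrs_eq_children[OF Suc.prems(1)] by simp
  thus ?case using f Suc.prems(1) by (simp add: is_code_def)
qed

lemma code_stable:
  assumes "v \<in> V" "d r + card V \<le> n + d v" "d r + card V \<le> n' + d v"
  shows "code n E (up v) v = code n' E (up v) v"
  using assms
proof (induction n arbitrary: n' v)
  case 0
  thus ?case using depth_lt[of v] by simp
next
  case (Suc n)
  obtain k where k: "n' = Suc k" using Suc.prems depth_lt[of v] by (cases n') auto
  have "code n E v w = code k E v w" if "w \<in># mset_set (children v)" for w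
  proof -
    have w: "w \<in> children v" using that finite_children by simp
    hence "up w = v" "w \<in> V" by (auto simp: children_def up_def)
    thus ?thesis using Suc.IH[of w k] Suc.prems depth_child[OF w] k by simp
  qed
  hence "image_mset (code n E v) (mset_set (children v)) = image_mset (code k E v) (mset_set (children v))"
    by (rule image_mset_cong)
  thus ?case unfolding k code.simps nbrs_eq_children[OF Suc.prems(1)] by simp
qed

lemma ex_code: "\<exists>f. is_code f"
proof (intro exI, unfold is_code_def, intro ballI)
  let ?N = "card V"
  let ?f = "\<lambda>v. code ?N E (up v) v"
  fix v assume v: "v \<in> V"
  have "?f v = code (Suc ?N) E (up v) v" using depth_ge[OF v] by (intro code_stable[OF v]) auto
  also have "\<dots> = Node (image_mset (code ?N E v) (mset_set (children v)))"
    using nbrs_eq_children[OF v] by simp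
  also have "image_mset (code ?N E v) (mset_set (children v)) = image_mset ?f (mset_set (children v))"
  proof (rule image_mset_cong)
    fix w assume "w \<in># mset_set (children v)"
    hence "up w = v" using finite_children by (auto simp: children_def up_def)
    thus "code ?N E v w = ?f w" by simp
  qed
  finally show "?f v = Node (image_mset ?f (mset_set (children v)))" .
qed

lemma root_code_eq:
  assumes "is_code f"
  shows "root_code (parent_graph V r par) r = f r"
  using code_eq[OF assms root, of "card V"] by (simp add: root_code_def up_def parent_graph_def)

text \<open>Summed over \<open>V\<close>, every vertex except the root occurs once as a child, and
  its value of \<open>s\<close> cancels.\<close>

lemma sum_recursion:
  fixes s g :: "'a \<Rightarrow> nat"
  assumes "\<And>v. v \<in> V \<Longrightarrow> s v = g v + (\<Sum>c\<in>children v. s c)"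
  shows "s r = (\<Sum>v\<in>V. g v)"
proof -
  have "(\<Sum>v\<in>V. s v) = (\<Sum>v\<in>V. g v) + (\<Sum>v\<in>V. \<Sum>c\<in>children v. s c)"
    using assms by (simp add: sum.distrib)
  also have "(\<Sum>v\<in>V. \<Sum>c\<in>children v. s c) = (\<Sum>c\<in>(\<Union>v\<in>V. children v). s c)"
    using finite_V finite_children by (intro sum.UNION_disjoint[symmetric]) (auto simp: children_def)
  also have "(\<Union>v\<in>V. children v) = V - {r}" using par_in by (auto simp: children_def)
  also have "(\<Sum>v\<in>V. s v) = s r + (\<Sum>v\<in>V - {r}. s v)" by (rule sum.remove[OF finite_V root])
  finally show ?thesis by simp
qed

lemma sum_mset_children: "(\<Sum>t\<in>#image_mset f (mset_set (children v)). h t) = (\<Sum>c\<in>children v. h (f c))"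
  by (simp add: image_mset.compositionality o_def sum_unfold_sum_mset)

lemma nodes_code:
  assumes f: "is_code f"
  shows "nodes (f r) = card V"
proof -
  have "nodes (f v) = 1 + (\<Sum>c\<in>children v. nodes (f c))" if "v \<in> V" for v
  proof -
    have "f v = Node (image_mset f (mset_set (children v)))" using f that by (simp add: is_code_def)
    thus ?thesis by (metis nodes_Node plus_1_eq_Suc sum_mset_children)
  qed
  from sum_recursion[of "\<lambda>v. nodes (f v)" "\<lambda>_. 1", OF this] show ?thesis by simp
qed

lemma code_eq_leaf_iff:
  assumes f: "is_code f" and v: "v \<in> V"
  shows "f v = leaf \<longleftrightarrow> children v = {}"
proof -
  have "f v = Node (image_mset f (mset_set (children v)))" using f v by (simp add: is_code_def)
  thus ?thesis using finite_children[of v] by (simp add: mset_set_empty_iff)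
qed

text \<open>With at least three vertices the root has a child, and not a leaf as its only child. So
  the root contributes nothing to \<open>tips\<close>, in accordance with its exclusion from both
  sets.\<close>

lemma tips_code:
  assumes f: "is_code f" and V: "card V \<ge> 3"
  shows "tips (f r) = card leaf_set + card pendant_set"
proof -
  define pend where "pend v \<longleftrightarrow> (\<exists>x. children v = {x} \<and> children x = {})" for v
  have "tips (f v) = ((if children v = {} then 1 else 0) + (if pend v then 1 else 0)) + (\<Sum>c\<in>children v. tips (f c))"
    if v: "v \<in> V" for v
  proof -
    let ?M = "image_mset f (mset_set (children v))"
    have fv: "f v = Node ?M" using f v by (simp add: is_code_def)
    have "?M = {#leaf#} \<longleftrightarrow> pend v"
    proof
      assume M: "?M = {#leaf#}"
      hence "size ?M = 1" by simp
      hence "card (children v) = 1" by simp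
      then obtain x where x: "children v = {x}" by (auto simp: card_1_singleton_iff)
      hence "f x = leaf" "x \<in> V" using M children_sub[of v] by auto
      thus "pend v" using x code_eq_leaf_iff[OF f] by (auto simp: pend_def)
    next
      assume "pend v"
      then obtain x where x: "children v = {x}" "children x = {}" by (auto simp: pend_def)
      hence "x \<in> V" using children_sub[of v] by auto
      thus "?M = {#leaf#}" using x code_eq_leaf_iff[OF f] by simp
    qed
    moreover have "?M = {#} \<longleftrightarrow> children v = {}" using finite_children[of v] by (simp add: mset_set_empty_iff)
    moreover have "pend v \<Longrightarrow> children v \<noteq> {}" by (auto simp: pend_def)
    moreover have "(\<Sum>k\<in>#image_mset tips ?M. k) = (\<Sum>c\<in>children v. tips (f c))"
      using sum_mset_children[of tips f v] by simp
    ultimately show ?thesis unfolding fv tips.simps by (simp split del: if_split) (simp split: if_split)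
  qed
  from sum_recursion[of "\<lambda>v. tips (f v)", OF this]
  have "tips (f r) = (\<Sum>v\<in>V. if children v = {} then 1 else 0) + (\<Sum>v\<in>V. if pend v then 1 else 0)"
    by (simp add: sum.distrib)
  also have "\<dots> = card {v \<in> V. children v = {}} + card {v \<in> V. pend v}"
    using finite_V by (simp add: sum.If_cases Int_def)
  also have "{v \<in> V. children v = {}} = leaf_set"
  proof -
    have "children r \<noteq> {}"
    proof
      assume e: "children r = {}"
      have "v = r" if "v \<in> V" for v
        using that
      proof (induction v rule: root_induct)
        case (step v)
        hence "v \<in> children r" by (simp add: children_def)
        thus ?case using e by simp
      qed simp
      hence "V \<subseteq> {r}" by blast
      hence "card V \<le> 1" using card_mono[of "{r}" V] by simp
      thus False using V by simp
    qed
    thus ?thesis by (auto simp: leaf_set_def)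
  qed
  also have "{v \<in> V. pend v} = pendant_set"
  proof -
    have "\<not> pend r"
    proof
      assume "pend r"
      then obtain x where x: "children r = {x}" "children x = {}" by (auto simp: pend_def)
      have "v \<in> {r, x}" if "v \<in> V" for v
        using that
      proof (induction v rule: root_induct)
        case (step v)
        hence "v \<in> children r \<or> v \<in> children x" by (auto simp: children_def)
        thus ?case using x by auto
      qed simp
      hence "V \<subseteq> {r, x}" by blast
      hence "card V \<le> card {r, x}" by (intro card_mono) auto
      also have "\<dots> \<le> 2" by (simp add: card_insert_if)
      finally show False using V by simp
    qed
    thus ?thesis by (auto simp: pendant_set_def pend_def)
  qed
  finally show ?thesis .
qed

end

text \<open>Vertices with equal codes admit a bijection of their children that preserves codes;
  following these from the roots defines \<open>F\<close>. Injectivity goes by induction from the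
  root, and surjectivity follows since the common code gives both numbers of vertices.\<close>

lemma isomorphic_of_code:
  assumes "rooted_tree V r par d" "rooted_tree V' r' par' d'"
    and "rooted_tree.is_code V r par f" "rooted_tree.is_code V' r' par' f'" "f r = f' r'"
  shows "isomorphic (parent_graph V r par) (parent_graph V' r' par')"
proof -
  interpret A: rooted_tree V r par d by fact
  interpret B: rooted_tree V' r' par' d' by fact
  have "\<exists>h. bij_betw h (A.children v) (B.children v') \<and> (\<forall>c\<in>A.children v. f' (h c) = f c)"
    if "v \<in> V" "v' \<in> V'" "f v = f' v'" for v v'
  proof -
    have "image_mset f (mset_set (A.children v)) = image_mset f' (mset_set (B.children v'))"
      using assms(3,4) that by (metis A.is_code_def B.is_code_def rtree.inject)
    from image_mset_eq_bij[OF A.finite_children B.finite_children this] show ?thesis by metis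
  qed
  then obtain h where h: "\<And>v v'. v \<in> V \<Longrightarrow> v' \<in> V' \<Longrightarrow> f v = f' v' \<Longrightarrow>
      bij_betw (h v v') (A.children v) (B.children v') \<and> (\<forall>c\<in>A.children v. f' (h v v' c) = f c)"
    by metis
  define G where "G = rec_nat (\<lambda>_. r') (\<lambda>k g u. h (par u) (g (par u)) u)"
  have G_Suc: "G (Suc k) u = h (par u) (G k (par u)) u" for k u by (simp add: G_def)
  define F where "F u = G (d u - d r) u" for u
  have F_r: "F r = r'" by (simp add: F_def G_def)
  have F_step: "F u = h (par u) (F (par u)) u" if "u \<in> V - {r}" for u
  proof -
    have "d u - d r = Suc (d (par u) - d r)"
      using A.depth[OF that] A.depth_ge[OF A.par_in[OF that]] by simp
    thus ?thesis by (simp add: F_def G_Suc)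
  qed
  have F: "F u \<in> V' \<and> f' (F u) = f u \<and> d u + d' r' = d' (F u) + d r
      \<and> (u \<noteq> r \<longrightarrow> F u \<in> V' - {r'} \<and> par' (F u) = F (par u))"
    if "u \<in> V" for u
    using that
  proof (induction u rule: A.root_induct)
    case root
    show ?case using F_r B.root assms(5) by simp
  next
    case (step u)
    show ?case
    proof -
      have u: "u \<in> V - {r}" by (rule step.hyps)
      have IH: "F (par u) \<in> V'" "f' (F (par u)) = f (par u)" "d (par u) + d' r' = d' (F (par u)) + d r"
        using step.IH by auto
      have hh: "bij_betw (h (par u) (F (par u))) (A.children (par u)) (B.children (F (par u)))"
        "\<forall>c\<in>A.children (par u). f' (h (par u) (F (par u)) c) = f c"
        using h[OF A.par_in[OF u] IH(1)] IH(2) by auto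
      have uc: "u \<in> A.children (par u)" using u by (simp add: A.children_def)
      hence Fc: "F u \<in> B.children (F (par u))" using bij_betwE[OF hh(1)] F_step[OF u] by simp
      have "f' (F u) = f u" using hh(2) uc F_step[OF u] by simp
      thus ?thesis using Fc B.depth_child[OF Fc] A.depth[OF u] IH(3) by (auto simp: B.children_def)
    qed
  qed
  have inj: "u = w" if "u \<in> V" "w \<in> V" "F u = F w" for u w
    using that
  proof (induction u arbitrary: w rule: A.root_induct)
    case root
    thus ?case using F[of w] F_r by auto
  next
    case (step u)
    show ?case
    proof -
      have u: "u \<in> V - {r}" by (rule step.hyps)
      hence w: "w \<in> V - {r}" using F[of u] step.prems F_r by auto
      have "F (par u) = F (par w)" using F[of u] F[of w] step.prems u w by auto
      hence pp: "par u = par w" using step.IH[of "par w"] A.par_in[OF w] by simp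
      have "inj_on (h (par u) (F (par u))) (A.children (par u))"
        using h[OF A.par_in[OF u]] F[OF A.par_in[OF u]] by (metis bij_betw_imp_inj_on)
      moreover have "h (par u) (F (par u)) u = h (par u) (F (par u)) w"
        using step.prems F_step[OF u] F_step[OF w] pp by simp
      moreover have "u \<in> A.children (par u)" "w \<in> A.children (par u)"
        using u w pp by (auto simp: A.children_def)
      ultimately show ?thesis by (auto dest: inj_onD)
    qed
  qed
  have injF: "inj_on F V" using inj by (auto intro: inj_onI)
  have "card V = card V'"
    using A.nodes_code[OF assms(3)] B.nodes_code[OF assms(4)] assms(5) by simp
  hence "F ` V = V'"
    using F card_image[OF injF] B.finite_V by (intro card_subset_eq) auto
  have edge: "v \<in> A.children u \<longleftrightarrow> F v \<in> B.children (F u)" if "u \<in> V" "v \<in> V" for u v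
  proof
    assume "v \<in> A.children u"
    thus "F v \<in> B.children (F u)" using F[OF that(2)] by (auto simp: A.children_def B.children_def)
  next
    assume a: "F v \<in> B.children (F u)"
    hence "F v \<noteq> r'" by (simp add: B.children_def)
    hence "v \<noteq> r" using F_r by auto
    hence "F (par v) = F u" using F[OF that(2)] a by (simp add: B.children_def)
    hence "par v = u" using inj[OF A.par_in that(1)] that \<open>v \<noteq> r\<close> by simp
    thus "v \<in> A.children u" using that \<open>v \<noteq> r\<close> by (simp add: A.children_def)
  qed
  have E: "{u, v} \<in> A.E \<longleftrightarrow> v \<in> A.children u \<or> u \<in> A.children v" for u v
    by (auto simp: A.edges_iff A.children_def)
  have E': "{u, v} \<in> B.E \<longleftrightarrow> v \<in> B.children u \<or> u \<in> B.children v" for u v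
    by (auto simp: B.edges_iff B.children_def)
  show ?thesis
    unfolding isomorphic_def
  proof (intro exI conjI ballI)
    show "bij_betw F (verts (parent_graph V r par)) (verts (parent_graph V' r' par'))"
      using injF \<open>F ` V = V'\<close> by (simp add: bij_betw_def parent_graph_def)
    fix u v assume "u \<in> verts (parent_graph V r par)" "v \<in> verts (parent_graph V r par)"
    hence "u \<in> V" "v \<in> V" by (auto simp: parent_graph_def)
    thus "{u, v} \<in> A.E \<longleftrightarrow> {F u, F v} \<in> B.E" unfolding E E' using edge by blast
  qed
qed

section \<open>Counting unlabelled trees\<close>

lemma rtrancl_distinct_path:
  assumes "(a, b) \<in> R\<^sup>*"
  obtains xs where "distinct xs" "xs \<noteq> []" "hd xs = a" "last xs = b"
    "\<And>i. Suc i < length xs \<Longrightarrow> (xs ! i, xs ! Suc i) \<in> R"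
proof -
  have "\<exists>xs. distinct xs \<and> xs \<noteq> [] \<and> hd xs = a \<and> last xs = b \<and>
      (\<forall>i. Suc i < length xs \<longrightarrow> (xs ! i, xs ! Suc i) \<in> R)"
    using assms
  proof (induction rule: rtrancl_induct)
    case base
    show ?case by (intro exI[of _ "[a]"]) simp
  next
    case (step b c)
    then obtain xs where xs: "distinct xs" "xs \<noteq> []" "hd xs = a" "last xs = b"
      "\<And>i. Suc i < length xs \<Longrightarrow> (xs ! i, xs ! Suc i) \<in> R" by blast
    show ?case
    proof (cases "c \<in> set xs")
      case True
      then obtain i where i: "i < length xs" "xs ! i = c" by (auto simp: in_set_conv_nth)
      show ?thesis
      proof (intro exI[of _ "take (Suc i) xs"] conjI allI impI)
        show "distinct (take (Suc i) xs)" "take (Suc i) xs \<noteq> []" using xs by auto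
        show "hd (take (Suc i) xs) = a" using xs by (cases xs) auto
        show "last (take (Suc i) xs) = c" using i by (simp add: take_Suc_conv_app_nth)
        show "(take (Suc i) xs ! j, take (Suc i) xs ! Suc j) \<in> R" if "Suc j < length (take (Suc i) xs)" for j
          using xs(5)[of j] that by simp
      qed
    next
      case False
      show ?thesis
      proof (intro exI[of _ "xs @ [c]"] conjI allI impI)
        show "distinct (xs @ [c])" "xs @ [c] \<noteq> []" "hd (xs @ [c]) = a" "last (xs @ [c]) = c"
          using xs False by auto
        show "((xs @ [c]) ! j, (xs @ [c]) ! Suc j) \<in> R" if "Suc j < length (xs @ [c])" for j
        proof (cases "Suc j < length xs")
          case True
          thus ?thesis using xs(5)[of j] by (simp add: nth_append)
        next
          case False
          hence j: "Suc j = length xs" using that by simp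
          hence "xs ! j = b" using xs(2,4) by (metis diff_Suc_1 last_conv_nth)
          thus ?thesis using step.hyps(2) j by (simp add: nth_append)
        qed
      qed
    qed
  qed
  thus ?thesis using that by blast
qed

text \<open>The depth is the distance from \<open>r\<close>, and the parent is some neighbour nearer
  to \<open>r\<close>. Any further edge would close a simple path of parent edges to a
  cycle.\<close>

lemma tree_rooted:
  fixes G :: "'a ugraph"
  assumes G: "tree G" and r: "r \<in> verts G"
  obtains par d where "rooted_tree (verts G) r par d" "G = parent_graph (verts G) r par"
proof -
  let ?V = "verts G"
  define R where "R = {(x, y). {x, y} \<in> edges G}"
  have fin: "finite ?V" and E: "\<And>e. e \<in> edges G \<Longrightarrow> e \<subseteq> ?V \<and> card e = 2"
    and conn: "\<And>v. v \<in> ?V \<Longrightarrow> (r, v) \<in> R\<^sup>*" and acyc: "\<And>xs. \<not> is_cycle G xs"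
    using G r by (auto simp: tree_def simple_graph_def connected_graph_def R_def)
  define d where "d v = (LEAST k. (r, v) \<in> R ^^ k)" for v
  have d_le: "d v \<le> k" if "(r, v) \<in> R ^^ k" for v k unfolding d_def using that by (rule Least_le)
  have d_in: "(r, v) \<in> R ^^ d v" if "v \<in> ?V" for v
  proof -
    have "\<exists>k. (r, v) \<in> R ^^ k" using conn[OF that] rtrancl_imp_relpow by blast
    then obtain k where "(r, v) \<in> R ^^ k" ..
    thus ?thesis unfolding d_def by (rule LeastI)
  qed
  have ex: "\<exists>u. {u, v} \<in> edges G \<and> d v = Suc (d u)" if v: "v \<in> ?V - {r}" for v
  proof -
    have "d v \<noteq> 0"
    proof
      assume "d v = 0"
      hence "(r, v) \<in> R ^^ 0" using d_in[of v] v by (metis DiffD1)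
      thus False using v by simp
    qed
    then obtain k where k: "d v = Suc k" by (cases "d v") auto
    then obtain u where u: "(r, u) \<in> R ^^ k" "(u, v) \<in> R" using d_in[of v] v by auto
    hence uv: "{u, v} \<in> edges G" by (simp add: R_def)
    hence "u \<in> ?V" using E by blast
    hence "(r, v) \<in> R ^^ Suc (d u)" using d_in[of u] u(2) by (meson relpow_Suc_I)
    hence "Suc k \<le> Suc (d u)" using d_le k by metis
    moreover have "d u \<le> k" using d_le[OF u(1)] .
    ultimately show ?thesis using uv k by auto
  qed
  define par where "par v = (SOME u. {u, v} \<in> edges G \<and> d v = Suc (d u))" for v
  have par: "{par v, v} \<in> edges G" "d v = Suc (d (par v))" if "v \<in> ?V - {r}" for v
    using someI_ex[OF ex[OF that]] by (auto simp: par_def)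
  have rt: "rooted_tree ?V r par d"
    by unfold_locales (use fin r par E in auto)
  interpret rooted_tree ?V r par d by (rule rt)
  define P where "P = (\<lambda>v. {v, par v}) ` (?V - {r})"
  have PE: "P \<subseteq> edges G" using par by (auto simp: P_def insert_commute)
  define R' where "R' = {(x, y). {x, y} \<in> P}"
  have toroot: "(v, r) \<in> R'\<^sup>*" if "v \<in> ?V" for v
    using that
  proof (induction v rule: root_induct)
    case (step v)
    have "(v, par v) \<in> R'" using step.hyps by (auto simp: R'_def P_def)
    thus ?case using step.IH by (rule converse_rtrancl_into_rtrancl)
  qed simp
  have "sym R'" by (auto simp: sym_def R'_def insert_commute)
  hence symR: "(x, y) \<in> R'\<^sup>* \<Longrightarrow> (y, x) \<in> R'\<^sup>*" for x y by (meson sym_rtrancl symD)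
  have "edges G \<subseteq> P"
  proof (rule subsetI, rule ccontr)
    fix e assume e: "e \<in> edges G" "e \<notin> P"
    then obtain a b where ab: "e = {a, b}" "a \<noteq> b" "a \<in> ?V" "b \<in> ?V"
      using E[of e] by (auto simp: card_2_iff)
    have "(a, b) \<in> R'\<^sup>*" using toroot[OF ab(3)] symR[OF toroot[OF ab(4)]] by (rule rtrancl_trans)
    then obtain xs where xs: "distinct xs" "xs \<noteq> []" "hd xs = a" "last xs = b"
      "\<And>i. Suc i < length xs \<Longrightarrow> (xs ! i, xs ! Suc i) \<in> R'"
      by (rule rtrancl_distinct_path) (rule that)
    have x0: "xs ! 0 = a" "xs ! (length xs - 1) = b" using xs by (auto simp: hd_conv_nth last_conv_nth)
    have "length xs \<noteq> 1" using x0 ab(2) by auto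
    moreover have "length xs \<noteq> 2" using xs(5)[of 0] x0 e ab by (auto simp: R'_def)
    moreover have "length xs \<noteq> 0" using xs(2) by simp
    ultimately have len: "length xs \<ge> 3" by linarith
    have "is_cycle G xs"
      unfolding is_cycle_def
    proof (intro conjI allI impI)
      show "3 \<le> length xs" "distinct xs" by fact+
      fix i assume i: "i < length xs"
      show "{xs ! i, xs ! (Suc i mod length xs)} \<in> edges G"
      proof (cases "Suc i < length xs")
        case True
        thus ?thesis using xs(5)[of i] PE by (auto simp: R'_def)
      next
        case False
        hence "i = length xs - 1" "Suc i mod length xs = 0" using i by (auto simp: not_less le_Suc_eq)
        thus ?thesis using x0 e ab by (simp add: insert_commute)
      qed
    qed
    thus False using acyc by blast
  qed
  hence "edges G = P" using PE by blast
  hence "G = parent_graph ?V r par" by (simp add: parent_graph_def P_def)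
  thus ?thesis using that rt by blast
qed

text \<open>A cycle is impossible because both neighbours of its deepest vertex would be the parent
  of that vertex.\<close>

lemma (in rooted_tree) tree_parent_graph:
  "tree (parent_graph V r par)" "card E = card V - 1"
proof -
  have ne: "v \<noteq> par v" if "v \<in> V - {r}" for v using depth[OF that] by (metis n_not_Suc_n)
  have up: "y = par x \<and> x \<noteq> r" if "{x, y} \<in> E" "d y \<le> d x" for x y
    using that depth_child[of y x] by (auto simp: edges_iff)
  show "card E = card V - 1"
  proof -
    have "inj_on (\<lambda>v. {v, par v}) (V - {r})"
    proof (rule inj_onI)
      fix u v assume uv: "u \<in> V - {r}" "v \<in> V - {r}" "{u, par u} = {v, par v}"
      show "u = v"
      proof (rule ccontr)
        assume "u \<noteq> v"
        hence "u = par v" "v = par u" using uv(3) by (auto simp: doubleton_eq_iff)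
        thus False using depth[OF uv(1)] depth[OF uv(2)] by simp
      qed
    qed
    hence "card E = card (V - {r})" by (simp add: parent_graph_def card_image)
    thus ?thesis using root finite_V by simp
  qed
  have simple: "simple_graph (parent_graph V r par)"
    using finite_V par_in ne by (auto simp: simple_graph_def parent_graph_def card_2_iff)
  let ?R = "{(x, y). {x, y} \<in> E}"
  have toroot: "(v, r) \<in> ?R\<^sup>*" if "v \<in> V" for v
    using that
  proof (induction v rule: root_induct)
    case (step v)
    have "(v, par v) \<in> ?R" using step.hyps by (auto simp: edges_iff)
    thus ?case using step.IH by (rule converse_rtrancl_into_rtrancl)
  qed simp
  have "sym ?R" by (auto simp: sym_def insert_commute)
  hence symR: "(x, y) \<in> ?R\<^sup>* \<Longrightarrow> (y, x) \<in> ?R\<^sup>*" for x y by (meson sym_rtrancl symD)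
  have "(u, v) \<in> ?R\<^sup>*" if "u \<in> V" "v \<in> V" for u v
    using toroot[OF that(1)] symR[OF toroot[OF that(2)]] by (rule rtrancl_trans)
  hence conn: "connected_graph (parent_graph V r par)"
    using root unfolding connected_graph_def by (auto simp: parent_graph_def)
  have "\<not> is_cycle (parent_graph V r par) xs" for xs
  proof
    assume c: "is_cycle (parent_graph V r par) xs"
    let ?L = "length xs"
    have len: "?L \<ge> 3" and dist: "distinct xs"
      and e: "\<And>i. i < ?L \<Longrightarrow> {xs ! i, xs ! (Suc i mod ?L)} \<in> E"
      using c by (auto simp: is_cycle_def)
    obtain i where i: "i < ?L" "\<And>j. j < ?L \<Longrightarrow> d (xs ! j) \<le> d (xs ! i)"
    proof -
      have "0 < ?L" using len by linarith
      hence "0 \<in> {..<?L}" by simp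
      hence "Max ((\<lambda>i. d (xs ! i)) ` {..<?L}) \<in> (\<lambda>i. d (xs ! i)) ` {..<?L}" by (intro Max_in) auto
      then obtain i where "i < ?L" "Max ((\<lambda>i. d (xs ! i)) ` {..<?L}) = d (xs ! i)" by blast
      thus thesis by (intro that[of i]) (auto simp flip: \<open>Max _ = _\<close>)
    qed
    define j where "j = Suc i mod ?L"
    define k where "k = (if i = 0 then ?L - 1 else i - 1)"
    have jk: "j < ?L" "k < ?L"
    proof -
      show "j < ?L" unfolding j_def using len by (intro mod_less_divisor) linarith
      show "k < ?L" using i(1) len unfolding k_def by (cases i) simp_all
    qed
    have "xs ! j = par (xs ! i)"
      using up[of "xs ! i" "xs ! j"] e[OF i(1)] i(2)[OF jk(1)] by (simp add: j_def)
    moreover have "Suc k mod ?L = i" using len i by (auto simp: k_def)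
    hence "{xs ! i, xs ! k} \<in> E" using e[OF jk(2)] by (simp add: insert_commute)
    hence "xs ! k = par (xs ! i)" using up i(2)[OF jk(2)] by blast
    ultimately have "j = k" using dist jk nth_eq_iff_index_eq by metis
    moreover have "j \<noteq> k"
    proof (cases "Suc i = ?L")
      case True
      thus ?thesis using len by (auto simp: j_def k_def)
    next
      case False
      hence "j = Suc i" using i by (simp add: j_def)
      thus ?thesis using len False by (auto simp: k_def)
    qed
    ultimately show False by simp
  qed
  thus "tree (parent_graph V r par)" using simple conn by (simp add: tree_def)
qed

text \<open>Vertices are addresses, the lists of child indices on the way from the root. Thus the
  parent is \<open>butlast\<close>, the depth is \<open>length\<close>, and the \<open>i\<close>-th
  subtree is prefixed with \<open>i\<close>.\<close>

lemma ex_list_tree: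
  "\<exists>(V :: nat list set) f. rooted_tree V [] butlast length \<and> rooted_tree.is_code V [] butlast f \<and> f [] = t"
proof (induction t)
  case (Node M)
  obtain ts where ts: "mset ts = M" using ex_mset by blast
  have "\<forall>i\<in>{..<length ts}. \<exists>(V :: nat list set) f. rooted_tree V [] butlast length \<and> rooted_tree.is_code V [] butlast f \<and> f [] = ts ! i"
    using Node.IH ts nth_mem_mset by blast
  then obtain W g where Wg: "\<And>i. i < length ts \<Longrightarrow> rooted_tree (W i :: nat list set) [] butlast length"
      "\<And>i. i < length ts \<Longrightarrow> rooted_tree.is_code (W i) [] butlast (g i)" "\<And>i. i < length ts \<Longrightarrow> g i [] = ts ! i"
    by (metis lessThan_iff)
  define V where "V = insert [] (\<Union>i<length ts. (#) i ` W i)"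
  define f where "f v = (case v of [] \<Rightarrow> Node M | i # p \<Rightarrow> g i p)" for v
  have V_Cons: "i # p \<in> V \<longleftrightarrow> i < length ts \<and> p \<in> W i" for i p by (auto simp: V_def)
  have W: "finite (W i)" "[] \<in> W i" "\<And>p. p \<in> W i - {[]} \<Longrightarrow> butlast p \<in> W i" if "i < length ts" for i
    using Wg(1)[OF that] by (auto simp: rooted_tree_def)
  interpret rooted_tree V "[]" butlast length
  proof
    show "finite V" using W by (auto simp: V_def)
    show "[] \<in> V" by (simp add: V_def)
    show "butlast v \<in> V" if "v \<in> V - {[]}" for v
      using that W(3) by (cases v) (auto simp: V_Cons V_def)
    show "length v = Suc (length (butlast v))" if "v \<in> V - {[]}" for v
      using that by simp
  qed
  have ch_Nil: "children [] = (\<lambda>i. [i]) ` {..<length ts}"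
  proof
    show "children [] \<subseteq> (\<lambda>i. [i]) ` {..<length ts}"
    proof
      fix u assume "u \<in> children []"
      hence u: "u \<in> V" "u \<noteq> []" "butlast u = []" by (auto simp: children_def)
      then obtain i p where "u = i # p" by (cases u) auto
      thus "u \<in> (\<lambda>i. [i]) ` {..<length ts}" using u by (cases p) (auto simp: V_Cons)
    qed
    show "(\<lambda>i. [i]) ` {..<length ts} \<subseteq> children []"
      using W(2) by (auto simp: children_def V_Cons)
  qed
  have ch_Cons: "children (i # p) = (#) i ` rooted_tree.children (W i) [] butlast p" if i: "i < length ts" for i p
  proof -
    interpret Wi: rooted_tree "W i" "[]" butlast length using Wg(1)[OF i] .
    show ?thesis
    proof
      show "children (i # p) \<subseteq> (#) i ` Wi.children p"
      proof
        fix u assume "u \<in> children (i # p)"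
        hence u: "u \<in> V" "u \<noteq> []" "butlast u = i # p" by (auto simp: children_def)
        then obtain j q where jq: "u = j # q" by (cases u) auto
        hence "q \<noteq> []" "j = i" "butlast q = p" using u(3) by (auto split: if_splits)
        thus "u \<in> (#) i ` Wi.children p" using u(1) jq by (auto simp: Wi.children_def V_Cons)
      qed
      show "(#) i ` Wi.children p \<subseteq> children (i # p)"
        using i by (auto simp: Wi.children_def children_def V_Cons)
    qed
  qed
  have "is_code f"
    unfolding is_code_def
  proof
    fix v assume v: "v \<in> V"
    show "f v = Node (image_mset f (mset_set (children v)))"
    proof (cases v)
      case Nil
      have "image_mset f (mset_set (children [])) = image_mset (\<lambda>i. f [i]) (mset_set {..<length ts})"
        unfolding ch_Nil by (subst image_mset_mset_set[symmetric]) (auto simp: inj_on_def image_mset.compositionality o_def)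
      also have "\<dots> = image_mset ((!) ts) (mset_set {..<length ts})"
        by (rule image_mset_cong) (use Wg(3) in \<open>auto simp: f_def\<close>)
      also have "\<dots> = mset (map ((!) ts) [0..<length ts])" by (simp add: atLeast0LessThan)
      also have "\<dots> = M" using ts by (simp add: map_nth)
      finally show ?thesis by (simp add: Nil f_def)
    next
      case (Cons i p)
      hence i: "i < length ts" "p \<in> W i" using v by (auto simp: V_Cons)
      interpret Wi: rooted_tree "W i" "[]" butlast length using Wg(1)[OF i(1)] .
      have "image_mset f (mset_set (children (i # p))) = image_mset (g i) (mset_set (Wi.children p))"
        unfolding ch_Cons[OF i(1)]
        by (subst image_mset_mset_set[symmetric]) (auto simp: inj_on_def image_mset.compositionality o_def f_def)
      thus ?thesis using Wg(2)[OF i(1)] i(2) by (simp add: Wi.is_code_def Cons f_def)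
    qed
  qed
  moreover have "f [] = Node M" by (simp add: f_def)
  ultimately show ?case using rooted_tree_axioms by blast
qed

lemma ex_nat_tree:
  obtains G :: "nat ugraph" and r where "tree G" "card (edges G) = nodes t - 1" "r \<in> verts G" "root_code G r = t"
proof -
  obtain V f where V: "rooted_tree (V :: nat list set) [] butlast length"
    and f: "rooted_tree.is_code V [] butlast f" "f [] = t"
    using ex_list_tree[of t] by blast
  interpret A: rooted_tree V "[]" butlast length by (rule V)
  let ?i = "from_nat :: nat \<Rightarrow> nat list"
  interpret B: rooted_tree "to_nat ` V" "to_nat ([] :: nat list)" "\<lambda>x. to_nat (butlast (?i x))" "\<lambda>x. length (?i x)"
    by unfold_locales (use A.finite_V A.root A.par_in in \<open>auto\<close>)
  have ch: "B.children (to_nat v) = to_nat ` A.children v" for v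
    by (auto simp: B.children_def A.children_def)
  have "B.is_code (\<lambda>x. f (?i x))"
    unfolding B.is_code_def
  proof
    fix x assume "x \<in> to_nat ` V"
    then obtain v where v: "x = to_nat v" "v \<in> V" by blast
    have "image_mset (\<lambda>x. f (?i x)) (mset_set (B.children x)) = image_mset f (mset_set (A.children v))"
      unfolding v(1) ch by (subst image_mset_mset_set[symmetric]) (auto simp: inj_on_def image_mset.compositionality o_def)
    thus "f (?i x) = Node (image_mset (\<lambda>x. f (?i x)) (mset_set (B.children x)))"
      using f(1) v by (simp add: A.is_code_def)
  qed
  note B_code = this
  show ?thesis
  proof (rule that)
    show "tree (parent_graph (to_nat ` V) (to_nat ([] :: nat list)) (\<lambda>x. to_nat (butlast (?i x))))"
      by (rule B.tree_parent_graph(1))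
    show "card B.E = nodes t - 1"
      using B.tree_parent_graph(2) B.nodes_code[OF B_code] f(2) by simp
    show "to_nat ([] :: nat list) \<in> verts (parent_graph (to_nat ` V) (to_nat ([] :: nat list)) (\<lambda>x. to_nat (butlast (?i x))))"
      using A.root by (simp add: parent_graph_def)
    show "root_code (parent_graph (to_nat ` V) (to_nat ([] :: nat list)) (\<lambda>x. to_nat (butlast (?i x)))) (to_nat ([] :: nat list)) = t"
      using B.root_code_eq[OF B_code] f(2) by simp
  qed
qed

section \<open>Isomorphism classes and their codes\<close>

lemma isomorphic_refl: "isomorphic G G"
  unfolding isomorphic_def by (intro exI[of _ id]) auto

lemma isomorphic_sym:
  assumes "isomorphic G H"
  shows "isomorphic H G"
proof -
  obtain f where f: "bij_betw f (verts G) (verts H)"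
    "\<And>u v. u \<in> verts G \<Longrightarrow> v \<in> verts G \<Longrightarrow> {u, v} \<in> edges G \<longleftrightarrow> {f u, f v} \<in> edges H"
    using assms unfolding isomorphic_def by blast
  let ?g = "inv_into (verts G) f"
  show ?thesis
    unfolding isomorphic_def
  proof (intro exI[of _ ?g] conjI ballI)
    show g: "bij_betw ?g (verts H) (verts G)" by (rule bij_betw_inv_into[OF f(1)])
    show "{u, v} \<in> edges H \<longleftrightarrow> {?g u, ?g v} \<in> edges G" if "u \<in> verts H" "v \<in> verts H" for u v
      using f(2)[of "?g u" "?g v"] that bij_betwE[OF g] bij_betw_inv_into_right[OF f(1)] by simp
  qed
qed

lemma isomorphic_trans:
  assumes "isomorphic G H" "isomorphic H K"
  shows "isomorphic G K"
proof -
  obtain f where f: "bij_betw f (verts G) (verts H)"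
    "\<And>u v. u \<in> verts G \<Longrightarrow> v \<in> verts G \<Longrightarrow> {u, v} \<in> edges G \<longleftrightarrow> {f u, f v} \<in> edges H"
    using assms(1) unfolding isomorphic_def by blast
  obtain g where g: "bij_betw g (verts H) (verts K)"
    "\<And>u v. u \<in> verts H \<Longrightarrow> v \<in> verts H \<Longrightarrow> {u, v} \<in> edges H \<longleftrightarrow> {g u, g v} \<in> edges K"
    using assms(2) unfolding isomorphic_def by blast
  show ?thesis
    unfolding isomorphic_def
  proof (intro exI[of _ "g \<circ> f"] conjI ballI)
    show "bij_betw (g \<circ> f) (verts G) (verts K)" by (rule bij_betw_trans[OF f(1) g(1)])
    show "{u, v} \<in> edges G \<longleftrightarrow> {(g \<circ> f) u, (g \<circ> f) v} \<in> edges K" if "u \<in> verts G" "v \<in> verts G" for u v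
      using f(2)[OF that] g(2)[of "f u" "f v"] bij_betwE[OF f(1)] that by simp
  qed
qed

text \<open>The rootings of a tree up to isomorphism. Classes of trees with \<open>m\<close> edges
  thus correspond to disjoint nonempty sets of at most \<open>m + 1\<close> codes, which compares
  free with rooted trees.\<close>

definition codes :: "'a ugraph \<Rightarrow> rtree set" where
  "codes G = root_code G ` verts G"

lemma codes_isomorphic:
  assumes "isomorphic G H" "simple_graph G" "simple_graph H"
  shows "codes G \<subseteq> codes H"
proof
  fix t assume "t \<in> codes G"
  then obtain r where r: "r \<in> verts G" "t = root_code G r" by (auto simp: codes_def)
  obtain f where f: "bij_betw f (verts G) (verts H)"
    "\<And>u v. u \<in> verts G \<Longrightarrow> v \<in> verts G \<Longrightarrow> {u, v} \<in> edges G \<longleftrightarrow> {f u, f v} \<in> edges H"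
    using assms(1) unfolding isomorphic_def by blast
  have "code (card (verts G)) (edges H) (f r) (f r) = code (card (verts G)) (edges G) r r"
    by (rule code_image[of f "verts G"])
       (use f assms(2,3) r in \<open>auto simp: bij_betw_def simple_graph_def\<close>)
  hence "root_code H (f r) = t" using bij_betw_same_card[OF f(1)] r by (simp add: root_code_def)
  hence "t = root_code H (f r)" "f r \<in> verts H" using bij_betwE[OF f(1)] r by auto
  thus "t \<in> codes H" unfolding codes_def by (rule image_eqI)
qed

lemma tree_codes:
  assumes G: "tree G" "t \<in> codes G"
  obtains r par d f where "rooted_tree (verts G) r par d" "G = parent_graph (verts G) r par"
    "rooted_tree.is_code (verts G) r par f" "f r = t"
proof -
  obtain r where r: "r \<in> verts G" "t = root_code G r" using G(2) by (auto simp: codes_def)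
  obtain par d where pd: "rooted_tree (verts G) r par d" "G = parent_graph (verts G) r par"
    by (rule tree_rooted[OF G(1) r(1)])
  obtain f where f: "rooted_tree.is_code (verts G) r par f" using rooted_tree.ex_code[OF pd(1)] by blast
  have "f r = t" using rooted_tree.root_code_eq[OF pd(1) f] pd(2) r(2) by simp
  thus ?thesis using that pd f by blast
qed

lemma codes_determine:
  assumes "tree G" "tree H" "t \<in> codes G" "t \<in> codes H"
  shows "isomorphic G H"
proof -
  obtain r par d f where 1: "rooted_tree (verts G) r par d" "G = parent_graph (verts G) r par"
    "rooted_tree.is_code (verts G) r par f" "f r = t"
    by (rule tree_codes[OF assms(1,3)])
  obtain r' par' d' f' where 2: "rooted_tree (verts H) r' par' d'" "H = parent_graph (verts H) r' par'"
    "rooted_tree.is_code (verts H) r' par' f'" "f' r' = t"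
    by (rule tree_codes[OF assms(2,4)])
  show ?thesis using isomorphic_of_code[OF 1(1) 2(1) 1(3) 2(3)] 1(2,4) 2(2,4) by simp
qed

lemma labelled_tree_verts:
  assumes "G \<in> labelled_trees m"
  shows "tree G" "card (verts G) = m + 1" "finite (verts G)" "verts G \<noteq> {}"
proof -
  show G: "tree G" using assms by (simp add: labelled_trees_def)
  thus ne: "verts G \<noteq> {}" and fin: "finite (verts G)"
    by (auto simp: tree_def connected_graph_def simple_graph_def)
  then obtain r where "r \<in> verts G" by blast
  then obtain par d where pd: "rooted_tree (verts G) r par d" "G = parent_graph (verts G) r par"
    by (rule tree_rooted[OF G])
  have "card (edges G) = card (verts G) - 1" using rooted_tree.tree_parent_graph(2)[OF pd(1)] pd(2) by simp
  moreover have "card (verts G) > 0" using ne fin by (simp add: card_gt_0_iff)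
  moreover have "card (edges G) = m" using assms by (simp add: labelled_trees_def)
  ultimately show "card (verts G) = m + 1" by linarith
qed

lemma codes_rtrees:
  assumes "G \<in> labelled_trees m"
  shows "codes G \<subseteq> rtrees (m + 1)"
proof
  fix t assume t: "t \<in> codes G"
  obtain r par d f where 1: "rooted_tree (verts G) r par d"
    "rooted_tree.is_code (verts G) r par f" "f r = t"
    by (rule tree_codes[OF labelled_tree_verts(1)[OF assms] t])
  show "t \<in> rtrees (m + 1)"
    using rooted_tree.nodes_code[OF 1(1,2)] 1(3) labelled_tree_verts(2)[OF assms] by (simp add: rtrees_def)
qed

definition iso_rel :: "nat \<Rightarrow> (nat ugraph \<times> nat ugraph) set" where
  "iso_rel m = {(S, T). S \<in> labelled_trees m \<and> T \<in> labelled_trees m \<and> isomorphic S T}"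

lemma unlabelled_trees_iso_rel: "unlabelled_trees m = labelled_trees m // iso_rel m"
  by (simp add: unlabelled_trees_def iso_rel_def)

lemma equiv_iso_rel: "equiv (labelled_trees m) (iso_rel m)"
  by (rule equivI)
     (auto simp: iso_rel_def refl_on_def sym_on_def trans_on_def intro: isomorphic_refl isomorphic_sym isomorphic_trans)

lemma unlabelled_tree_class:
  assumes "C \<in> unlabelled_trees m"
  shows "C \<subseteq> labelled_trees m" "C \<noteq> {}"
  using assms in_quotient_imp_subset[OF equiv_iso_rel] in_quotient_imp_non_empty[OF equiv_iso_rel]
  by (auto simp: unlabelled_trees_iso_rel)

lemma class_eq:
  assumes "C \<in> unlabelled_trees m" "D \<in> unlabelled_trees m" "G \<in> C" "H \<in> D" "t \<in> codes G" "t \<in> codes H"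
  shows "C = D"
proof -
  have GH: "G \<in> labelled_trees m" "H \<in> labelled_trees m" using assms unlabelled_tree_class by blast+
  hence "isomorphic G H" using codes_determine[of G H t] labelled_tree_verts(1) assms by blast
  hence "(G, H) \<in> iso_rel m" using GH by (simp add: iso_rel_def)
  thus ?thesis
    using quotient_eq_iff[OF equiv_iso_rel] assms by (auto simp: unlabelled_trees_iso_rel)
qed

text \<open>Choosing one code in \<open>B\<close> per class is injective, because different classes
  share no code. So bounding the bad classes by bad rooted trees costs no factor.\<close>

lemma card_classes_le:
  assumes A: "A \<subseteq> unlabelled_trees m" and B: "finite B"
    and ex: "\<And>C. C \<in> A \<Longrightarrow> \<exists>G\<in>C. \<exists>t\<in>codes G. t \<in> B"
  shows "finite A \<and> card A \<le> card B"
proof -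
  have "\<exists>t. t \<in> B \<and> (\<exists>G\<in>C. t \<in> codes G)" if "C \<in> A" for C using ex[OF that] by blast
  then obtain \<phi> where \<phi>: "\<And>C. C \<in> A \<Longrightarrow> \<phi> C \<in> B \<and> (\<exists>G\<in>C. \<phi> C \<in> codes G)" by metis
  have "inj_on \<phi> A"
  proof (rule inj_onI)
    fix C D assume CD: "C \<in> A" "D \<in> A" "\<phi> C = \<phi> D"
    obtain G H where "G \<in> C" "\<phi> C \<in> codes G" "H \<in> D" "\<phi> C \<in> codes H"
      using \<phi>[OF CD(1)] \<phi>[OF CD(2)] CD(3) by auto
    thus "C = D" using class_eq subsetD[OF A CD(1)] subsetD[OF A CD(2)] by blast
  qed
  moreover have "\<phi> ` A \<subseteq> B" using \<phi> by blast
  ultimately show ?thesis using B card_inj_on_le inj_on_finite by blast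
qed

lemma finite_unlabelled_trees: "finite (unlabelled_trees m)"
proof -
  have "\<exists>G\<in>C. \<exists>t\<in>codes G. t \<in> rtrees (m + 1)" if C: "C \<in> unlabelled_trees m" for C
  proof -
    obtain G where G: "G \<in> C" "G \<in> labelled_trees m" using unlabelled_tree_class[OF C] by blast
    have "codes G \<noteq> {}" using labelled_tree_verts(4)[OF G(2)] by (simp add: codes_def)
    thus ?thesis using G codes_rtrees[OF G(2)] by blast
  qed
  thus ?thesis using card_classes_le[OF subset_refl finite_rtrees] by blast
qed

text \<open>Every rooted tree is a rooting of some unlabelled tree, and each of these has at most
  \<open>m + 1\<close> rootings. This accounts for the factor \<open>n\<close> in
  \<open>few_tips_rare\<close>.\<close>

lemma card_rtrees_le: "card (rtrees (m + 1)) \<le> card (unlabelled_trees m) * (m + 1)"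
proof -
  define rep where "rep C = (SOME G. G \<in> C)" for C :: "nat ugraph set"
  have rep: "rep C \<in> C" if "C \<in> unlabelled_trees m" for C
    using unlabelled_tree_class(2)[OF that] unfolding rep_def by (simp add: some_in_eq)
  have "rtrees (m + 1) \<subseteq> (\<Union>C\<in>unlabelled_trees m. codes (rep C))"
  proof
    fix t assume t: "t \<in> rtrees (m + 1)"
    obtain G :: "nat ugraph" and r where G: "tree G" "card (edges G) = nodes t - 1" "r \<in> verts G" "root_code G r = t"
      by (rule ex_nat_tree)
    hence GL: "G \<in> labelled_trees m" and tG: "t \<in> codes G"
      using t by (auto simp: labelled_trees_def rtrees_def codes_def)
    define C where "C = iso_rel m `` {G}"
    have C: "C \<in> unlabelled_trees m" "G \<in> C"
      using GL equiv_class_self[OF equiv_iso_rel GL] by (auto simp: C_def unlabelled_trees_iso_rel quotientI)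
    hence "isomorphic G (rep C)" using rep[of C] by (auto simp: C_def iso_rel_def)
    moreover have "tree (rep C)" using rep[OF C(1)] unlabelled_tree_class(1)[OF C(1)] labelled_tree_verts(1) by blast
    ultimately have "t \<in> codes (rep C)"
      using codes_isomorphic[of G "rep C"] G(1) tG by (auto simp: tree_def)
    thus "t \<in> (\<Union>C\<in>unlabelled_trees m. codes (rep C))" using C(1) by blast
  qed
  hence "card (rtrees (m + 1)) \<le> card (\<Union>C\<in>unlabelled_trees m. codes (rep C))"
  proof (rule card_mono[rotated])
    have "finite (codes (rep C))" if "C \<in> unlabelled_trees m" for C
    proof -
      have "rep C \<in> labelled_trees m" using rep[OF that] unlabelled_tree_class(1)[OF that] by blast
      thus ?thesis using labelled_tree_verts(3) by (simp add: codes_def)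
    qed
    thus "finite (\<Union>C\<in>unlabelled_trees m. codes (rep C))"
      using finite_unlabelled_trees by simp
  qed
  also have "\<dots> \<le> (\<Sum>C\<in>unlabelled_trees m. card (codes (rep C)))"
    by (rule card_UN_le[OF finite_unlabelled_trees])
  also have "\<dots> \<le> (\<Sum>C\<in>unlabelled_trees m. m + 1)"
  proof (rule sum_mono)
    fix C assume C: "C \<in> unlabelled_trees m"
    have "rep C \<in> labelled_trees m" using rep[OF C] unlabelled_tree_class(1)[OF C] by blast
    thus "card (codes (rep C)) \<le> m + 1"
      using card_image_le[of "verts (rep C)" "root_code (rep C)"] labelled_tree_verts by (simp add: codes_def)
  qed
  finally show ?thesis by simp
qed

text \<open>A member that fails to decompose has few tips for any choice of the root, so one rooting
  can be counted. \<open>m \<ge> 2\<close> provides the three vertices for \<open>tips_code\<close>.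
  The failure gives \<open>2 * tips t < m\<close>, relaxed to \<open>m + 1\<close> to match the
  number of nodes.\<close>

lemma card_bad_classes_le:
  assumes m: "m \<ge> 2" "prime (2 * m + 1)" and M: "perfect_matching (complete_ugraph (4 * m + 2)) M"
  shows "card {C \<in> unlabelled_trees m. \<not> class_decomposes C (delete_edges (complete_ugraph (4 * m + 2)) M)}
    \<le> card {t \<in> rtrees (m + 1). 2 * tips t \<le> m + 1}"
proof -
  let ?K = "delete_edges (complete_ugraph (4 * m + 2)) M"
  have "\<exists>G\<in>C. \<exists>t\<in>codes G. t \<in> {t \<in> rtrees (m + 1). 2 * tips t \<le> m + 1}"
    if C: "C \<in> {C \<in> unlabelled_trees m. \<not> class_decomposes C ?K}" for C
  proof -
    obtain G where G: "G \<in> C" "\<not> decomposes G ?K" using C by (auto simp: class_decomposes_def)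
    have GL: "G \<in> labelled_trees m" using G C unlabelled_tree_class(1) by blast
    note GV = labelled_tree_verts[OF GL]
    then obtain t where t: "t \<in> codes G" by (auto simp: codes_def)
    obtain r par d f where 1: "rooted_tree (verts G) r par d" "G = parent_graph (verts G) r par"
      "rooted_tree.is_code (verts G) r par f" "f r = t"
      by (rule tree_codes[OF GV(1) t])
    interpret rooted_tree "verts G" r par d by (rule 1(1))
    have "\<not> m \<le> 2 * (card leaf_set + card pendant_set)"
      using decomposes_if_many_leaves[OF m(2) _ GV(2) _ M] G(2) 1(2) m(1) by auto
    moreover have "tips t = card leaf_set + card pendant_set"
      using tips_code[OF 1(3)] GV(2) m(1) 1(4) by simp
    ultimately have "2 * tips t \<le> m + 1" by simp
    thus ?thesis using G(1) t codes_rtrees[OF GL] by blast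
  qed
  moreover have "finite {t \<in> rtrees (m + 1). 2 * tips t \<le> m + 1}" using finite_rtrees by simp
  ultimately show ?thesis using card_classes_le[of "{C \<in> unlabelled_trees m. \<not> class_decomposes C ?K}"] by blast
qed

text \<open>The lower bound is the same for all \<open>M\<close>, so the matching may vary freely
  with \<open>m\<close> in the limit.\<close>

lemma prob_decomposes_ge:
  assumes m: "m \<ge> 2" "prime (2 * m + 1)" and M: "perfect_matching (complete_ugraph (4 * m + 2)) M"
  shows "1 - real (m + 1) * real (card {t \<in> rtrees (m + 1). 2 * tips t \<le> m + 1}) / real (card (rtrees (m + 1)))
    \<le> measure_pmf.prob (random_tree m) {C. class_decomposes C (delete_edges (complete_ugraph (4 * m + 2)) M)}"
proof -
  let ?K = "delete_edges (complete_ugraph (4 * m + 2)) M"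
  let ?U = "unlabelled_trees m"
  let ?B = "{C \<in> ?U. \<not> class_decomposes C ?K}"
  let ?b = "card {t \<in> rtrees (m + 1). 2 * tips t \<le> m + 1}" and ?r = "card (rtrees (m + 1))"
  have r: "?r > 0" by (rule card_rtrees_pos) simp
  have le: "?r \<le> card ?U * (m + 1)" by (rule card_rtrees_le)
  hence U: "card ?U > 0" using r by (cases "card ?U = 0") auto
  hence "?U \<noteq> {}" by auto
  hence "measure_pmf.prob (random_tree m) {C. class_decomposes C ?K} = real (card (?U \<inter> {C. class_decomposes C ?K})) / real (card ?U)"
    unfolding random_tree_def using finite_unlabelled_trees by (simp add: measure_pmf_of_set)
  also have "?U \<inter> {C. class_decomposes C ?K} = ?U - ?B" by auto
  also have "real (card (?U - ?B)) = real (card ?U) - real (card ?B)"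
    using finite_unlabelled_trees by (subst card_Diff_subset) (auto simp: of_nat_diff card_mono)
  also have "(real (card ?U) - real (card ?B)) / real (card ?U) = 1 - real (card ?B) / real (card ?U)"
    using U by (simp add: field_simps)
  finally have eq: "measure_pmf.prob (random_tree m) {C. class_decomposes C ?K} = 1 - real (card ?B) / real (card ?U)" .
  have "real (card ?B) / real (card ?U) \<le> real ?b / real (card ?U)"
    using card_bad_classes_le[OF m M] by (intro divide_right_mono) auto
  also have "\<dots> \<le> real ?b / (real ?r / real (m + 1))"
  proof (rule divide_left_mono)
    have "real ?r \<le> real (card ?U) * real (m + 1)" using le unfolding of_nat_mult[symmetric] of_nat_le_iff .
    thus "real ?r / real (m + 1) \<le> real (card ?U)" by (simp add: pos_divide_le_eq)
  qed (use r U in auto)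
  finally show ?thesis unfolding eq by (simp add: mult.commute)
qed

theorem corollary1:
  fixes M :: "nat \<Rightarrow> nat set set"
  assumes "\<And>m. m > 0 \<Longrightarrow> prime (2 * m + 1) \<Longrightarrow>
    perfect_matching (complete_ugraph (4 * m + 2)) (M m)"
  shows "((\<lambda>m. measure_pmf.prob (random_tree m)
             {C. class_decomposes C (delete_edges (complete_ugraph (4 * m + 2)) (M m))})
           \<longlongrightarrow> 1) (inf sequentially (principal {m. m > 0 \<and> prime (2 * m + 1)}))"
proof (rule tendsto_sandwich)
  let ?F = "inf sequentially (principal {m. m > 0 \<and> prime (2 * m + 1)})"
  let ?g = "\<lambda>n. real n * real (card {t \<in> rtrees n. 2 * tips t \<le> n}) / real (card (rtrees n))"
  have "(\<lambda>m. ?g (m + 1)) \<longlonglongrightarrow> 0" using LIMSEQ_ignore_initial_segment[OF few_tips_rare, of 1] by simp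
  hence "(\<lambda>m. 1 - ?g (m + 1)) \<longlonglongrightarrow> 1 - 0" by (intro tendsto_diff tendsto_const)
  thus "((\<lambda>m. 1 - ?g (m + 1)) \<longlongrightarrow> 1) ?F" using tendsto_mono[OF inf_le1] by fastforce
  show "((\<lambda>_. 1) \<longlongrightarrow> (1 :: real)) ?F" by (rule tendsto_const)
  show "\<forall>\<^sub>F m in ?F. 1 - ?g (m + 1) \<le> measure_pmf.prob (random_tree m)
      {C. class_decomposes C (delete_edges (complete_ugraph (4 * m + 2)) (M m))}"
    unfolding eventually_inf_principal using eventually_ge_at_top[of 2]
  proof eventually_elim
    case (elim m)
    show ?case using prob_decomposes_ge[OF elim _ assms[of m]] by auto
  qed
  show "\<forall>\<^sub>F m in ?F. measure_pmf.prob (random_tree m)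
      {C. class_decomposes C (delete_edges (complete_ugraph (4 * m + 2)) (M m))} \<le> 1"
    by (intro always_eventually allI measure_pmf.prob_le_1)
qed

end
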